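(* Let $\epsilon\in(0,1)$, let $V_0\in V_d(\mathbb{R}^n)$ be a compactly supported $d$-varifold with $\|V_0\|(\mathbb{R}^n)\le M$ (where $M\ge1$), and let $(V_\epsilon(t))_{t\in[0,1]}$ be the approximate mean curvature flow starting from $V_0$. Then, for all $0\le a<b\le1$, $$\|V_\epsilon(b)\|(\mathbb{R}^n)-\|V_\epsilon(a)\|(\mathbb{R}^n)=-\int_a^b\int_{\mathbb{R}^n}\frac{|(\Phi_\epsilon*\delta V_\epsilon(t))(y)|^2}{(\Phi_\epsilon*\|V_\epsilon(t)\|)(y)+\epsilon}\,dy\,dt\le0.$$ In particular, $\|V_\epsilon(t)\|(\mathbb{R}^n)\le\|V_0\|(\mathbb{R}^n)$ for all $t\in[0,1]$, and $$\int_0^1\int_{\mathbb{R}^n}\frac{|(\Phi_\epsilon*\delta V_\epsilon(t))(y)|^2}{(\Phi_\epsilon*\|V_\epsilon(t)\|)(y)+\epsilon}\,dy\,dt\le\|V_0\|(\mathbb{R}^n).$$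
   Context: Let $n\ge 2$, $1\le d\le n$. $G_{d,n}$ is the Grassmannian of $d$-dimensional linear subspaces of $\mathbb{R}^n$; $S\in G_{d,n}$ is identified with the orthogonal projection matrix onto $S$. A $d$-varifold is a nonnegative Radon measure on $\mathbb{R}^n\times G_{d,n}$; $V_d(\mathbb{R}^n)$ is the set of $d$-varifolds; $\|V\|(A)=V(A\times G_{d,n})$. Push-forward: for a $C^1$ diffeomorphism $f$ of $\mathbb{R}^n$, $f_\#V(\varphi)=\int\varphi(f(x),Df(x)(S))\,J_Sf(x)\,dV(x,S)$, where $J_Sf(x)=\det(Y^tY)^{1/2}$, $Y=Df(x)(s_1|\dots|s_d)$ with $(s_i)$ an orthonormal basis of $S$. Kernel: $\psi\in C^\infty(\mathbb{R}^n)$ is a fixed radially symmetric function (depending only on $n$) with $0\le\psi\le1$, $\psi=1$ on $\{|x|\le 1/2\}$, $\psi=0$ on $\{|x|\ge1\}$, $|\nabla\psi|\le3$; $\Phi_\epsilon(x)=c(\epsilon)\psi(x)(2\pi\epsilon^2)^{-n/2}\exp(-|x|^2/(2\epsilon^2))$ with $c(\epsilon)$ such that $\int\Phi_\epsilon=1$. Convolutions: $(\Phi_\epsilon*\|V\|)(y)=\int\Phi_\epsilon(x-y)\,d\|V\|(x)$, $(\Phi_\epsilon*\delta V)(y)=(\delta V*\Phi_\epsilon)(y)=\int S(\nabla\Phi_\epsilon(x-y))\,dV(x,S)$. Approximate mean curvature: $h_\epsilon(\cdot,V)=\Phi_\epsilon*\tilde h_\epsilon(\cdot,V)$, $\tilde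 h_\epsilon(y,V)=-\dfrac{(\delta V*\Phi_\epsilon)(y)}{(\|V\|*\Phi_\epsilon)(y)+\epsilon}$. Approximate mean curvature flow: for a subdivision $\mathcal{T}=\{0=t_0<\dots<t_m=1\}$ of $[0,1]$ with size $\delta(\mathcal{T})=\max_i(t_i-t_{i-1})$ satisfying $c_3\delta(\mathcal{T})\le(M+1)^{-3}\epsilon^8$ ($c_3$ a constant depending only on $n$ ensuring that all maps below are $C^1$ diffeomorphisms and masses stay $\le M+1$), set $V_{\epsilon,\mathcal{T}}(0)=V_0$ and $V_{\epsilon,\mathcal{T}}(t)=[\mathrm{id}+(t-t_i)h_\epsilon(\cdot,V_{\epsilon,\mathcal{T}}(t_i))]_\#V_{\epsilon,\mathcal{T}}(t_i)$ for $t\in[t_i,t_{i+1}]$. For $V_0$ compactly supported, $V_\epsilon(t)$ is the weak-$*$ limit of $V_{\epsilon,\mathcal{T}_j}(t)$ for any sequence of subdivisions with $\delta(\mathcal{T}_j)\to0$; the limit exists for every $t\in[0,1]$ and does not depend on the sequence. *)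

theory Defs
  imports "HOL-Analysis.Analysis"
begin

text \<open>
  The ambient dimension \<open>n\<close> is \<open>CARD('n)\<close> and the dimension \<open>d\<close> of the varifolds is \<open>CARD('d)\<close>,
  passed around as \<open>TYPE('d)\<close>; a type index for \<open>d\<close> makes the Gram determinant of a
  \<open>d\<close>-frame an instance of \<^const>\<open>det\<close>.
\<close>

section \<open>Grassmannian and varifolds\<close>

definition orth_proj :: "(real^'n) set \<Rightarrow> real^'n^'n" where
  "orth_proj U = (THE P. \<forall>x. P *v x \<in> U \<and> (\<forall>u\<in>U. (x - P *v x) \<bullet> u = 0))"

definition grassmannian :: "'d::finite itself \<Rightarrow> (real^'n^'n) set" where
  "grassmannian _ = orth_proj ` {U. subspace U \<and> dim U = CARD('d)}"

definition plane_of :: "real^'n^'n \<Rightarrow> (real^'n) set" where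
  "plane_of S = range (\<lambda>v. S *v v)"

definition varifold_space :: "'d::finite itself \<Rightarrow> ((real^'n) \<times> (real^'n^'n)) measure" where
  "varifold_space D = restrict_space borel (UNIV \<times> grassmannian D)"

text \<open>
  On the locally compact, second countable space \<open>\<real>\<^sup>n \<times> G\<close> a Radon measure is the same as a Borel
  measure that is finite on compact sets.
\<close>

definition varifold :: "'d::finite itself \<Rightarrow> ((real^'n) \<times> (real^'n^'n)) measure \<Rightarrow> bool" where
  "varifold D V \<longleftrightarrow> sets V = sets (varifold_space D) \<and>
     (\<forall>K. compact K \<and> K \<subseteq> UNIV \<times> grassmannian D \<longrightarrow> emeasure V K < \<infinity>)"

definition varifold_support ::
    "'d::finite itself \<Rightarrow> ((real^'n) \<times> (real^'n^'n)) measure \<Rightarrow> ((real^'n) \<times> (real^'n^'n)) set" where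
  "varifold_support D V = {z \<in> UNIV \<times> grassmannian D.
     \<forall>W. open W \<and> z \<in> W \<longrightarrow> 0 < emeasure V (W \<inter> (UNIV \<times> grassmannian D))}"

definition weight :: "((real^'n) \<times> (real^'n^'n)) measure \<Rightarrow> (real^'n) measure" where
  "weight V = distr V borel fst"

definition mass :: "((real^'n) \<times> (real^'n^'n)) measure \<Rightarrow> real" where
  "mass V = measure (weight V) UNIV"

definition weak_star_tendsto ::
    "'d::finite itself \<Rightarrow> (nat \<Rightarrow> ((real^'n) \<times> (real^'n^'n)) measure)
      \<Rightarrow> ((real^'n) \<times> (real^'n^'n)) measure \<Rightarrow> bool" where
  "weak_star_tendsto D W V \<longleftrightarrow>
     (\<forall>\<phi>::(real^'n) \<times> (real^'n^'n) \<Rightarrow> real.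
        continuous_on (UNIV \<times> grassmannian D) \<phi> \<and>
        (\<exists>K. compact K \<and> K \<subseteq> UNIV \<times> grassmannian D \<and>
             (\<forall>z \<in> UNIV \<times> grassmannian D - K. \<phi> z = 0)) \<longrightarrow>
        (\<lambda>j. \<integral>z. \<phi> z \<partial>W j) \<longlonglongrightarrow> (\<integral>z. \<phi> z \<partial>V))"

section \<open>Push-forward\<close>

definition orthonormal_basis_of :: "('d::finite \<Rightarrow> real^'n) \<Rightarrow> (real^'n) set \<Rightarrow> bool" where
  "orthonormal_basis_of s U \<longleftrightarrow>
     (\<forall>i j. s i \<bullet> s j = (if i = j then 1 else 0)) \<and> span (range s) = U"

text \<open>The value does not depend on which orthonormal basis is selected.\<close>

definition tangential_jacobian ::
    "'d::finite itself \<Rightarrow> (real^'n \<Rightarrow> real^'n) \<Rightarrow> real^'n \<Rightarrow> real^'n^'n \<Rightarrow> real" where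
  "tangential_jacobian _ f x S =
     (let s = (SOME s::'d \<Rightarrow> real^'n. orthonormal_basis_of s (plane_of S));
          Y = matrix (frechet_derivative f (at x)) ** (\<chi> i j. s j $ i)
      in sqrt (det (transpose Y ** Y)))"

definition push_plane :: "(real^'n \<Rightarrow> real^'n) \<Rightarrow> real^'n \<Rightarrow> real^'n^'n \<Rightarrow> real^'n^'n" where
  "push_plane f x S = orth_proj (frechet_derivative f (at x) ` plane_of S)"

text \<open>Meaningful only for \<open>C\<^sup>1\<close> diffeomorphisms \<open>f\<close>.\<close>

definition push_forward ::
    "'d::finite itself \<Rightarrow> (real^'n \<Rightarrow> real^'n) \<Rightarrow> ((real^'n) \<times> (real^'n^'n)) measure
      \<Rightarrow> ((real^'n) \<times> (real^'n^'n)) measure" where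
  "push_forward D f V =
     distr (density V (\<lambda>(x, S). ennreal (tangential_jacobian D f x S)))
           (varifold_space D) (\<lambda>(x, S). (f x, push_plane f x S))"

section \<open>Kernel and approximate mean curvature\<close>

definition grad :: "(real^'n \<Rightarrow> real) \<Rightarrow> real^'n \<Rightarrow> real^'n" where
  "grad f x = (\<chi> i. frechet_derivative f (at x) (axis i 1))"

primrec C_k :: "nat \<Rightarrow> (real^'n \<Rightarrow> real) \<Rightarrow> bool" where
  "C_k 0 f \<longleftrightarrow> continuous_on UNIV f"
| "C_k (Suc k) f \<longleftrightarrow> (\<forall>x. f differentiable (at x)) \<and>
     (\<forall>v. C_k k (\<lambda>x. frechet_derivative f (at x) v))"

definition cutoff :: "(real^'n \<Rightarrow> real) \<Rightarrow> bool" where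
  "cutoff \<psi> \<longleftrightarrow> (\<forall>k. C_k k \<psi>) \<and>
     (\<forall>x y. norm x = norm y \<longrightarrow> \<psi> x = \<psi> y) \<and>
     (\<forall>x. 0 \<le> \<psi> x \<and> \<psi> x \<le> 1) \<and>
     (\<forall>x. norm x \<le> 1/2 \<longrightarrow> \<psi> x = 1) \<and>
     (\<forall>x. 1 \<le> norm x \<longrightarrow> \<psi> x = 0) \<and>
     (\<forall>x. norm (grad \<psi> x) \<le> 3)"

definition truncated_gaussian :: "(real^'n \<Rightarrow> real) \<Rightarrow> real \<Rightarrow> real^'n \<Rightarrow> real" where
  "truncated_gaussian \<psi> \<epsilon> x =
     \<psi> x * (2 * pi * \<epsilon>^2) powr (- (real CARD('n) / 2)) * exp (- ((norm x)^2 / (2 * \<epsilon>^2)))"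

definition kernel :: "(real^'n \<Rightarrow> real) \<Rightarrow> real \<Rightarrow> real^'n \<Rightarrow> real" where
  "kernel \<psi> \<epsilon> x =
     truncated_gaussian \<psi> \<epsilon> x / (\<integral>z. truncated_gaussian \<psi> \<epsilon> z \<partial>lborel)"

definition conv_weight ::
    "(real^'n \<Rightarrow> real) \<Rightarrow> real \<Rightarrow> ((real^'n) \<times> (real^'n^'n)) measure \<Rightarrow> real^'n \<Rightarrow> real" where
  "conv_weight \<psi> \<epsilon> V y = (\<integral>x. kernel \<psi> \<epsilon> (x - y) \<partial>weight V)"

definition conv_first_variation ::
    "(real^'n \<Rightarrow> real) \<Rightarrow> real \<Rightarrow> ((real^'n) \<times> (real^'n^'n)) measure \<Rightarrow> real^'n \<Rightarrow> real^'n" where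
  "conv_first_variation \<psi> \<epsilon> V y = (\<integral>(x, S). S *v grad (kernel \<psi> \<epsilon>) (x - y) \<partial>V)"

definition h_tilde ::
    "(real^'n \<Rightarrow> real) \<Rightarrow> real \<Rightarrow> ((real^'n) \<times> (real^'n^'n)) measure \<Rightarrow> real^'n \<Rightarrow> real^'n" where
  "h_tilde \<psi> \<epsilon> V y =
     - (conv_first_variation \<psi> \<epsilon> V y /\<^sub>R (conv_weight \<psi> \<epsilon> V y + \<epsilon>))"

definition approx_mean_curvature ::
    "(real^'n \<Rightarrow> real) \<Rightarrow> real \<Rightarrow> ((real^'n) \<times> (real^'n^'n)) measure \<Rightarrow> real^'n \<Rightarrow> real^'n" where
  "approx_mean_curvature \<psi> \<epsilon> V x =
     (\<integral>y. kernel \<psi> \<epsilon> (x - y) *\<^sub>R h_tilde \<psi> \<epsilon> V y \<partial>lborel)"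

definition dissipation ::
    "(real^'n \<Rightarrow> real) \<Rightarrow> real \<Rightarrow> ((real^'n) \<times> (real^'n^'n)) measure \<Rightarrow> real^'n \<Rightarrow> real" where
  "dissipation \<psi> \<epsilon> V y =
     (norm (conv_first_variation \<psi> \<epsilon> V y))^2 / (conv_weight \<psi> \<epsilon> V y + \<epsilon>)"

section \<open>Approximate mean curvature flow\<close>

definition subdivision :: "real list \<Rightarrow> bool" where
  "subdivision T \<longleftrightarrow> T \<noteq> [] \<and> sorted_wrt (<) T \<and> hd T = 0 \<and> last T = 1"

definition mesh :: "real list \<Rightarrow> real" where
  "mesh T = Max ((\<lambda>i. T ! Suc i - T ! i) ` {i. Suc i < length T})"

definition euler_step ::
    "'d::finite itself \<Rightarrow> (real^'n \<Rightarrow> real) \<Rightarrow> real \<Rightarrow> real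
      \<Rightarrow> ((real^'n) \<times> (real^'n^'n)) measure \<Rightarrow> ((real^'n) \<times> (real^'n^'n)) measure" where
  "euler_step D \<psi> \<epsilon> \<tau> V =
     push_forward D (\<lambda>x. x + \<tau> *\<^sub>R approx_mean_curvature \<psi> \<epsilon> V x) V"

primrec flow_at_node ::
    "'d::finite itself \<Rightarrow> (real^'n \<Rightarrow> real) \<Rightarrow> real \<Rightarrow> ((real^'n) \<times> (real^'n^'n)) measure
      \<Rightarrow> real list \<Rightarrow> nat \<Rightarrow> ((real^'n) \<times> (real^'n^'n)) measure" where
  "flow_at_node D \<psi> \<epsilon> V\<^sub>0 T 0 = V\<^sub>0"
| "flow_at_node D \<psi> \<epsilon> V\<^sub>0 T (Suc i) =
     euler_step D \<psi> \<epsilon> (T ! Suc i - T ! i) (flow_at_node D \<psi> \<epsilon> V\<^sub>0 T i)"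

text \<open>
  For \<open>t \<in> [t\<^sub>i, t\<^sub>i\<^sub>+\<^sub>1]\<close>; at a common endpoint of two intervals both choices of \<open>i\<close> give the same
  varifold, and \<open>LEAST\<close> selects the left interval.
\<close>

definition discrete_flow ::
    "'d::finite itself \<Rightarrow> (real^'n \<Rightarrow> real) \<Rightarrow> real \<Rightarrow> ((real^'n) \<times> (real^'n^'n)) measure
      \<Rightarrow> real list \<Rightarrow> real \<Rightarrow> ((real^'n) \<times> (real^'n^'n)) measure" where
  "discrete_flow D \<psi> \<epsilon> V\<^sub>0 T t =
     (let i = (LEAST i. t \<le> T ! Suc i)
      in euler_step D \<psi> \<epsilon> (t - T ! i) (flow_at_node D \<psi> \<epsilon> V\<^sub>0 T i))"

text \<open>
  The constant \<open>c\<^sub>3\<close> only restricts which subdivisions are admissible. Since the meshes tend to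
  \<open>0\<close>, its value has no influence on the limit, so it is kept as a parameter.
\<close>

definition approx_mcf ::
    "'d::finite itself \<Rightarrow> (real^'n \<Rightarrow> real) \<Rightarrow> real \<Rightarrow> real \<Rightarrow> real
      \<Rightarrow> ((real^'n) \<times> (real^'n^'n)) measure
      \<Rightarrow> (real \<Rightarrow> ((real^'n) \<times> (real^'n^'n)) measure) \<Rightarrow> bool" where
  "approx_mcf D \<psi> c\<^sub>3 M \<epsilon> V\<^sub>0 V \<longleftrightarrow>
     (\<forall>t\<in>{0..1}. varifold D (V t)) \<and>
     (\<forall>T. (\<forall>j. subdivision (T j) \<and> c\<^sub>3 * mesh (T j) \<le> \<epsilon>^8 / (M + 1)^3) \<and>
          (\<lambda>j. mesh (T j)) \<longlonglongrightarrow> 0 \<longrightarrow>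
          (\<forall>t\<in>{0..1}. weak_star_tendsto D (\<lambda>j. discrete_flow D \<psi> \<epsilon> V\<^sub>0 (T j) t) (V t)))"

end

theory Submission
  imports Defs
begin

text \<open>
  Pushing a varifold \<open>V\<close> forward by \<open>id + \<tau> h\<close> with \<open>h = h\<^sub>\<epsilon>(\<cdot>, V)\<close> changes its mass by
  \<open>\<tau> \<integral> div\<^sub>S h dV + O(\<tau>\<^sup>2)\<close>, because the tangential Jacobian is \<open>1 + \<tau> tr(S Dh) + O(\<tau>\<^sup>2)\<close>. By Fubini the
  first-order term is minus the dissipation of \<open>V\<close>. Only a bound on \<open>Dh\<close> is needed for the error,
  and that bound depends on nothing but the mass. Summing over a uniform subdivision of mesh \<open>1/N\<close>
  gives the energy balance up to \<open>O(1/N)\<close>, with the dissipation evaluated at the node to the left of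
  the current time. A single Euler step moves \<open>\<Phi>\<^sub>\<epsilon> * \<parallel>V\<parallel>\<close> and \<open>\<Phi>\<^sub>\<epsilon> * \<delta>V\<close> uniformly little, so weak-star
  convergence at time \<open>t\<close> also identifies the limit of the dissipation at the node, and dominated
  convergence finishes the proof.
\<close>

section \<open>Projections and frames\<close>

text \<open>The energy identity is nonlinear in V, while only weak-star limits are available, and
  mass and support of the scheme have to be controlled before any limit. A bootstrap does this: as
  long as the mass is at most \<open>M + 1\<close>, one step of length at most 1/N adds at most
  C/N^2 to it, since the dissipation only subtracts; N steps add at most C/N <= 1, so the constants
  never change. The total time is 1 and the velocity is bounded, so all supports stay in one ball,
  nothing escapes to infinity, and masses pass to the limit. The nonlinearity is harmless because
  the dissipation at a point y sees V only through two convolutions, each the integral of a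
  continuous test function of compact support, and because its denominator is at least \<epsilon>. A
  second obstacle is that the push-forward is a \<open>distr\<close>, so that image planes and
  Jacobians must be shown to be measurable. Both are continuous in the derivative matrix and the
  projection. Planes are handled through d-frames stored as matrices: the Grassmannian becomes the
  image of a compact set and the Jacobian a Gram determinant.\<close>

declare transpose_matrix_vector [simp del]

text \<open>The norm on \<open>real^'n^'m\<close> is the Frobenius norm, so the bound is
  Cauchy-Schwarz row by row. Every smallness condition on a matrix below refers to this
  norm.\<close>

lemma norm_matrix_vector_le:
  fixes A :: "real^'n^'m"
  shows "norm (A *v x) \<le> norm A * norm x"
proof -
  have "norm (A *v x) \<le> L2_set (\<lambda>i. norm (A $ i) * norm x) UNIV"
    unfolding norm_vec_def[of "A *v x"]
    by (intro L2_set_mono) (auto simp: matrix_vector_mul_component Cauchy_Schwarz_ineq2)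
  then show ?thesis
    by (simp add: norm_vec_def[of A] L2_set_left_distrib)
qed

lemma inner_transpose_matrix_vector:
  fixes A :: "real^'n^'m"
  shows "(A *v x) \<bullet> y = x \<bullet> (transpose A *v y)"
  by (metis dot_lmul_matrix inner_commute transpose_matrix_vector)

text \<open>Integrals of the kernel are estimated entry by entry; this turns such estimates into a
  norm bound and is the origin of the factor \<open>CARD('n) * CARD('n)\<close> in
  \<open>deriv_bound\<close>.\<close>

lemma norm_matrix_le_sum:
  fixes A :: "real^'n^'m"
  assumes "\<And>i j. \<bar>A $ i $ j\<bar> \<le> K"
  shows "norm A \<le> real CARD('m) * real CARD('n) * K"
proof -
  have "norm (A $ i) \<le> real CARD('n) * K" for i
  proof -
    have "norm (A $ i) \<le> (\<Sum>j\<in>UNIV. \<bar>A $ i $ j\<bar>)" by (rule norm_le_l1_cart)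
    also have "\<dots> \<le> real CARD('n) * K" using sum_bounded_above[of UNIV "\<lambda>j. \<bar>A $ i $ j\<bar>" K] assms by simp
    finally show ?thesis .
  qed
  moreover have "norm A \<le> (\<Sum>i\<in>UNIV. norm (A $ i))"
    unfolding norm_vec_def[of A] by (rule L2_set_le_sum) auto
  ultimately have "norm A \<le> real CARD('m) * (real CARD('n) * K)"
    using sum_bounded_above[of UNIV "\<lambda>i. norm (A $ i)" "real CARD('n) * K"] by force
  then show ?thesis by (simp add: mult.assoc)
qed

section \<open>Continuity of matrix operations\<close>

lemma continuous_on_matrixI:
  fixes F :: "'a::topological_space \<Rightarrow> real^'n^'m"
  assumes "\<And>i j. continuous_on T (\<lambda>x. F x $ i $ j)"
  shows "continuous_on T F"
proof -
  have "continuous_on T (\<lambda>x. \<chi> i. \<chi> j. F x $ i $ j)"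
    by (intro continuous_on_vec_lambda assms)
  then show ?thesis by simp
qed

lemma continuous_on_matrix_mult [continuous_intros]:
  fixes F :: "'a::topological_space \<Rightarrow> real^'n^'m" and G :: "'a \<Rightarrow> real^'k^'n"
  assumes "continuous_on T F" "continuous_on T G"
  shows "continuous_on T (\<lambda>x. F x ** G x)"
  unfolding matrix_matrix_mult_def
  by (intro continuous_on_vec_lambda continuous_intros assms)

lemma continuous_on_matrix_vector [continuous_intros]:
  fixes F :: "'a::topological_space \<Rightarrow> real^'n^'m" and G :: "'a \<Rightarrow> real^'n"
  assumes "continuous_on T F" "continuous_on T G"
  shows "continuous_on T (\<lambda>x. F x *v G x)"
  unfolding matrix_vector_mult_def
  by (intro continuous_on_vec_lambda continuous_intros assms)

lemma continuous_on_transpose [continuous_intros]: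
  fixes F :: "'a::topological_space \<Rightarrow> real^'n^'m"
  assumes "continuous_on T F"
  shows "continuous_on T (\<lambda>x. transpose (F x))"
  unfolding transpose_def
  by (intro continuous_on_vec_lambda continuous_intros assms)

lemma continuous_on_det [continuous_intros]:
  fixes F :: "'a::topological_space \<Rightarrow> real^'n^'n"
  assumes "continuous_on T F"
  shows "continuous_on T (\<lambda>x. det (F x))"
  unfolding det_def
  by (intro continuous_intros assms)

text \<open>Orthonormal d-frames, stored as the columns of a matrix. The matrix form makes the
  projection \<open>s ** transpose s\<close> a continuous function of the frame.\<close>

definition stiefel :: "(real^'d^'n) set" where
  "stiefel = {s. transpose s ** s = mat 1}"

lemma subspace_range_matrix: "subspace (range ((*v) (A :: real^'d^'n)))"
  by (metis matrix_vector_mul_linear subspace_UNIV linear_subspace_image)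

text \<open>Uniqueness behind the definite description: at each x two candidates differ by a vector
  that lies in U and is orthogonal to U.\<close>

lemma orth_proj_eqI:
  fixes P :: "real^'n^'n"
  assumes "subspace U" "\<And>x. P *v x \<in> U" "\<And>x u. u \<in> U \<Longrightarrow> (x - P *v x) \<bullet> u = 0"
  shows "orth_proj U = P"
  unfolding orth_proj_def
proof (rule the_equality)
  show "\<forall>x. P *v x \<in> U \<and> (\<forall>u\<in>U. (x - P *v x) \<bullet> u = 0)" using assms by blast
next
  fix Q :: "real^'n^'n" assume Q: "\<forall>x. Q *v x \<in> U \<and> (\<forall>u\<in>U. (x - Q *v x) \<bullet> u = 0)"
  have "Q *v x = P *v x" for x
  proof -
    let ?w = "Q *v x - P *v x"
    have w: "?w \<in> U" using assms(1,2) Q by (simp add: subspace_diff)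
    have "(x - P *v x) \<bullet> ?w - (x - Q *v x) \<bullet> ?w = 0" using assms(3) Q w by simp
    then have "?w \<bullet> ?w = 0" by (simp add: algebra_simps inner_diff_left)
    then show ?thesis by simp
  qed
  then show "Q = P" by (simp add: matrix_eq)
qed

lemma orth_proj_range_frame:
  fixes s :: "real^'d^'n"
  assumes "s \<in> stiefel"
  shows "orth_proj (range ((*v) s)) = s ** transpose s"
proof (rule orth_proj_eqI[OF subspace_range_matrix])
  show "(s ** transpose s) *v x \<in> range ((*v) s)" for x
    by (simp flip: matrix_vector_mul_assoc)
  show "(x - (s ** transpose s) *v x) \<bullet> u = 0" if "u \<in> range ((*v) s)" for x u
  proof -
    from that obtain v where u: "u = s *v v" by blast
    have "transpose s *v ((s ** transpose s) *v x) = transpose s *v x"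
      using assms unfolding stiefel_def by (simp add: matrix_vector_mul_assoc matrix_mul_assoc)
    then show ?thesis unfolding u
      by (simp add: inner_commute[of _ "s *v v"] inner_transpose_matrix_vector matrix_vector_mult_diff_distrib)
  qed
qed

lemma plane_of_frame:
  fixes s :: "real^'d^'n"
  assumes "s \<in> stiefel"
  shows "plane_of (s ** transpose s) = range ((*v) s)"
proof
  show "plane_of (s ** transpose s) \<subseteq> range ((*v) s)"
    unfolding plane_of_def by (auto simp flip: matrix_vector_mul_assoc)
  show "range ((*v) s) \<subseteq> plane_of (s ** transpose s)"
  proof
    fix u assume "u \<in> range ((*v) s)"
    then obtain v where u: "u = s *v v" by blast
    have "(s ** transpose s) *v u = s *v ((transpose s ** s) *v v)"
      unfolding u by (simp add: matrix_vector_mul_assoc matrix_mul_assoc)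
    then have "(s ** transpose s) *v u = u" using assms u by (simp add: stiefel_def)
    then show "u \<in> plane_of (s ** transpose s)" unfolding plane_of_def by (metis rangeI)
  qed
qed

text \<open>Bridge between the frames of \<open>orthonormal_basis_of\<close>, which are functions on
  the index type, and those of \<open>stiefel\<close>, which are matrices.\<close>

lemma range_matrix_eq_span_columns:
  fixes f :: "'d::finite \<Rightarrow> real^'n"
  shows "range ((*v) (\<chi> i j. f j $ i)) = span (range f)"
proof
  have col: "column j (\<chi> i j. f j $ i) = f j" for j
    by (simp add: column_def vec_eq_iff)
  show "range ((*v) (\<chi> i j. f j $ i)) \<subseteq> span (range f)"
    by (auto simp: matrix_mult_sum col scalar_mult_eq_scaleR intro!: span_sum span_mul intro: span_base)
  have "f j \<in> range ((*v) (\<chi> i j. f j $ i))" for j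
    by (metis col matrix_vector_mult_basis rangeI)
  then show "span (range f) \<subseteq> range ((*v) (\<chi> i j. f j $ i))"
    by (intro span_minimal subspace_range_matrix) auto
qed

lemma frame_matrix_in_stiefel:
  fixes f :: "'d::finite \<Rightarrow> real^'n"
  assumes "\<And>i j. f i \<bullet> f j = (if i = j then 1 else 0)"
  shows "(\<chi> i j. f j $ i) \<in> stiefel"
  unfolding stiefel_def
  using assms by (simp add: vec_eq_iff matrix_matrix_mult_def transpose_def mat_def inner_vec_def)

lemma exists_frame:
  fixes U :: "(real^'n) set"
  assumes "subspace U" "dim U = CARD('d::finite)"
  shows "\<exists>f :: 'd \<Rightarrow> real^'n. orthonormal_basis_of f U"
proof -
  obtain B where B: "B \<subseteq> U" "pairwise orthogonal B" "\<And>x. x \<in> B \<Longrightarrow> norm x = 1"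
      "independent B" "card B = dim U" "span B = U"
    using orthonormal_basis_subspace[OF assms(1)] by blast
  have "finite B" using B(4) independent_imp_finite by blast
  then obtain f :: "'d \<Rightarrow> real^'n" where f: "bij_betw f UNIV B"
    using finite_same_card_bij[of "UNIV :: 'd set" B] B(5) assms(2) by auto
  have "f i \<bullet> f j = (if i = j then 1 else 0)" for i j
  proof -
    have "f i \<in> B" "f j \<in> B" using f by (auto simp: bij_betw_def)
    moreover have "f i \<noteq> f j" if "i \<noteq> j" using f that by (auto simp: bij_betw_def inj_on_def)
    ultimately show ?thesis using B(2,3) by (auto simp: pairwise_def orthogonal_def norm_eq_1)
  qed
  moreover have "span (range f) = U" using f B(6) by (simp add: bij_betw_def)
  ultimately show ?thesis unfolding orthonormal_basis_of_def by blast
qed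

lemma inj_frame:
  fixes s :: "real^'d^'n"
  assumes "s \<in> stiefel"
  shows "inj ((*v) s)"
  by (rule inj_on_inverseI[of _ "\<lambda>x. transpose s *v x"])
     (use assms in \<open>simp add: matrix_vector_mul_assoc stiefel_def\<close>)

lemma dim_range_frame:
  fixes s :: "real^'d^'n"
  assumes "s \<in> stiefel"
  shows "dim (range ((*v) s)) = CARD('d)"
  using dim_image_eq[OF matrix_vector_mul_linear, of s UNIV] inj_frame[OF assms] by simp

text \<open>Every plane has an orthonormal basis, and a frame s projects onto its column space by s
  s^T. This presents the Grassmannian as a continuous image of a compact set and lets each
  projection be written through a frame.\<close>

lemma grassmannian_eq:
  "grassmannian TYPE('d::finite) = (\<lambda>s::real^'d^'n. s ** transpose s) ` stiefel"
proof
  show "grassmannian TYPE('d) \<subseteq> (\<lambda>s::real^'d^'n. s ** transpose s) ` stiefel"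
  proof
    fix S :: "real^'n^'n" assume "S \<in> grassmannian TYPE('d)"
    then obtain U where U: "subspace U" "dim U = CARD('d)" "S = orth_proj U"
      unfolding grassmannian_def by blast
    obtain f :: "'d \<Rightarrow> real^'n" where f: "orthonormal_basis_of f U"
      using exists_frame[OF U(1,2)] by blast
    let ?s = "(\<chi> i j. f j $ i) :: real^'d^'n"
    have s: "?s \<in> stiefel" using frame_matrix_in_stiefel f unfolding orthonormal_basis_of_def by blast
    have "range ((*v) ?s) = U" using f unfolding range_matrix_eq_span_columns orthonormal_basis_of_def by simp
    then have "S = ?s ** transpose ?s" using orth_proj_range_frame[OF s] U(3) by simp
    then show "S \<in> (\<lambda>s::real^'d^'n. s ** transpose s) ` stiefel" using s by blast
  qed
  show "(\<lambda>s::real^'d^'n. s ** transpose s) ` stiefel \<subseteq> grassmannian TYPE('d)"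
    unfolding grassmannian_def
    using orth_proj_range_frame dim_range_frame subspace_range_matrix by (smt (verit) image_iff image_subsetI mem_Collect_eq)
qed

lemma grassmannianE:
  fixes S :: "real^'n^'n"
  assumes "S \<in> grassmannian TYPE('d::finite)"
  obtains s :: "real^'d^'n" where "s \<in> stiefel" "S = s ** transpose s" "plane_of S = range ((*v) s)"
  using assms plane_of_frame unfolding grassmannian_eq by blast

lemma orth_proj_plane_of:
  fixes S :: "real^'n^'n"
  assumes "S \<in> grassmannian TYPE('d::finite)"
  shows "orth_proj (plane_of S) = S"
  using assms by (metis grassmannianE orth_proj_range_frame)

lemma plane_of_grassmannian:
  fixes S :: "real^'n^'n"
  assumes "S \<in> grassmannian TYPE('d::finite)"
  shows "subspace (plane_of S)" "dim (plane_of S) = CARD('d)"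
  using assms by (metis grassmannianE subspace_range_matrix dim_range_frame)+

lemma orth_proj_in_grassmannian:
  fixes U :: "(real^'n) set"
  assumes "subspace U" "dim U = CARD('d::finite)"
  shows "orth_proj U \<in> grassmannian TYPE('d)"
  using assms unfolding grassmannian_def by blast

lemma plane_of_orth_proj:
  fixes U :: "(real^'n) set"
  assumes "subspace U" "dim U = CARD('d::finite)"
  shows "plane_of (orth_proj U) = U"
proof -
  obtain f :: "'d \<Rightarrow> real^'n" where f: "orthonormal_basis_of f U"
    using exists_frame[OF assms] by blast
  let ?s = "(\<chi> i j. f j $ i) :: real^'d^'n"
  have s: "?s \<in> stiefel" using frame_matrix_in_stiefel f unfolding orthonormal_basis_of_def by blast
  have "range ((*v) ?s) = U" using f unfolding range_matrix_eq_span_columns orthonormal_basis_of_def by simp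
  then show ?thesis using orth_proj_range_frame[OF s] plane_of_frame[OF s] by simp
qed

lemma grassmannian_idem:
  fixes S :: "real^'n^'n"
  assumes "S \<in> grassmannian TYPE('d::finite)"
  shows "S *v (S *v x) = S *v x"
proof -
  obtain s :: "real^'d^'n" where "s \<in> stiefel" "S = s ** transpose s"
    using assms grassmannianE by blast
  then show ?thesis unfolding stiefel_def
    by (simp add: matrix_vector_mul_assoc)
       (metis (no_types, lifting) matrix_mul_assoc matrix_mul_lid mem_Collect_eq)
qed

lemma grassmannian_transpose:
  fixes S :: "real^'n^'n"
  assumes "S \<in> grassmannian TYPE('d::finite)"
  shows "transpose S = S"
  using assms by (metis grassmannianE matrix_transpose_mul transpose_transpose)

lemma grassmannian_inner:
  fixes S :: "real^'n^'n"
  assumes "S \<in> grassmannian TYPE('d::finite)"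
  shows "(S *v x) \<bullet> y = x \<bullet> (S *v y)"
  using grassmannian_transpose[OF assms] inner_transpose_matrix_vector by metis

lemma grassmannian_norm:
  fixes S :: "real^'n^'n"
  assumes "S \<in> grassmannian TYPE('d::finite)"
  shows "norm (S *v x) \<le> norm x"
proof -
  have "norm (S *v x) ^ 2 = x \<bullet> (S *v x)"
    using grassmannian_inner[OF assms] grassmannian_idem[OF assms] by (simp add: power2_norm_eq_inner)
  also have "\<dots> \<le> norm x * norm (S *v x)" by (rule norm_cauchy_schwarz)
  finally show ?thesis
    by (metis mult_le_cancel_right norm_ge_zero not_le order.strict_iff_order power2_eq_square)
qed

text \<open>A diagonal entry of s^T s is the sum of squares over a column, so every entry of s has
  absolute value at most 1.\<close>

lemma compact_stiefel: "compact (stiefel :: (real^'d^'n) set)"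
proof -
  have "\<bar>s $ i $ j\<bar> \<le> 1" if "s \<in> stiefel" for s :: "real^'d^'n" and i j
  proof -
    have "(transpose s ** s) $ j $ j = 1" using that by (simp add: stiefel_def mat_def)
    then have "(\<Sum>k\<in>UNIV. (s $ k $ j)^2) = 1"
      by (simp add: matrix_matrix_mult_def transpose_def power2_eq_square)
    moreover have "(s $ i $ j)^2 \<le> (\<Sum>k\<in>UNIV. (s $ k $ j)^2)"
      by (rule member_le_sum) auto
    ultimately show ?thesis by (simp add: abs_square_le_1)
  qed
  then have "bounded (stiefel :: (real^'d^'n) set)"
    unfolding bounded_iff using norm_matrix_le_sum by blast
  moreover have "closed (stiefel :: (real^'d^'n) set)"
    unfolding stiefel_def by (intro closed_Collect_eq continuous_intros)
  ultimately show ?thesis using compact_eq_bounded_closed by blast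
qed

lemma compact_grassmannian: "compact (grassmannian TYPE('d::finite) :: (real^'n^'n) set)"
  unfolding grassmannian_eq
  by (intro compact_continuous_image continuous_intros compact_stiefel)

section \<open>Images of planes and tangential Jacobians\<close>

lemma plane_of_fixed:
  fixes S :: "real^'n^'n"
  assumes "S \<in> grassmannian TYPE('d::finite)" "u \<in> plane_of S"
  shows "S *v u = u"
  using assms grassmannian_idem unfolding plane_of_def by force

text \<open>\<open>P - Q = (1 - Q) P - Q (1 - P)\<close>, and \<open>Q (1 - P)\<close> is the transpose of \<open>(1 - P) Q\<close>.\<close>

lemma orth_proj_dist:
  fixes P Q :: "real^'n^'n"
  assumes P: "P \<in> grassmannian TYPE('d::finite)" and Q: "Q \<in> grassmannian TYPE('d)"
    and \<delta>: "0 \<le> \<delta>"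
    and PQ: "\<And>u. u \<in> plane_of P \<Longrightarrow> \<exists>w\<in>plane_of Q. norm (u - w) \<le> \<delta> * norm u"
    and QP: "\<And>u. u \<in> plane_of Q \<Longrightarrow> \<exists>w\<in>plane_of P. norm (u - w) \<le> \<delta> * norm u"
  shows "norm (P *v v - Q *v v) \<le> 2 * \<delta> * norm v"
proof -
  have contr: "norm (z - R *v z) \<le> norm z" if "R \<in> grassmannian TYPE('d)" for R :: "real^'n^'n" and z
  proof -
    have "(R *v z) \<bullet> (z - R *v z) = 0"
      using grassmannian_inner[OF that] grassmannian_idem[OF that]
      by (simp add: inner_diff_right inner_commute)
    then have "norm (z - R *v z) ^ 2 = z \<bullet> (z - R *v z)"
      by (simp add: power2_norm_eq_inner inner_diff_left)
    also have "\<dots> \<le> norm z * norm (z - R *v z)" by (rule norm_cauchy_schwarz)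
    finally show ?thesis
      by (metis mult_le_cancel_right norm_ge_zero not_le order.strict_iff_order power2_eq_square)
  qed
  \<comment> \<open>A vector \<open>w\<close> of the plane is fixed by \<open>R\<close>, so
    \<open>u\<close> and \<open>u - w\<close> have the same residual, and the complementary
    projection is a contraction.\<close>
  have near: "norm (u - R *v u) \<le> \<delta> * norm u"
    if R: "R \<in> grassmannian TYPE('d)" and ex: "\<exists>w\<in>plane_of R. norm (u - w) \<le> \<delta> * norm u"
    for R :: "real^'n^'n" and u
  proof -
    obtain w where w: "w \<in> plane_of R" "norm (u - w) \<le> \<delta> * norm u" using ex by blast
    have "u - R *v u = (u - w) - R *v (u - w)"
      using plane_of_fixed[OF R w(1)] by (simp add: matrix_vector_mult_diff_distrib)
    then show ?thesis using contr[OF R, of "u - w"] w(2) by (metis order.trans)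
  qed
  let ?q = "v - P *v v"
  let ?y = "Q *v ?q"
  have Pq: "P *v ?q = 0"
    using grassmannian_idem[OF P] by (simp add: matrix_vector_mult_diff_distrib)
  have y: "?y \<in> plane_of Q" unfolding plane_of_def by blast
  have "norm ?y ^ 2 = ?y \<bullet> ?q"
    by (metis Q grassmannian_idem grassmannian_inner power2_norm_eq_inner)
  also have "\<dots> = (?y - P *v ?y) \<bullet> ?q"
    using Pq grassmannian_inner[OF P, of ?y ?q] by (simp add: inner_diff_left)
  also have "\<dots> \<le> norm (?y - P *v ?y) * norm ?q" by (rule norm_cauchy_schwarz)
  also have "\<dots> \<le> (\<delta> * norm ?y) * norm v"
    by (intro mult_mono near[OF P QP[OF y]] contr[OF P]) (use \<delta> in auto)
  finally have "norm ?y * norm ?y \<le> (\<delta> * norm v) * norm ?y" by (simp add: power2_eq_square algebra_simps)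
  then have 2: "norm ?y \<le> \<delta> * norm v"
    by (cases "norm ?y = 0") (use \<delta> in auto)
  have "P *v v \<in> plane_of P" unfolding plane_of_def by blast
  then have "norm (P *v v - Q *v (P *v v)) \<le> \<delta> * norm (P *v v)" using near[OF Q PQ] by blast
  also have "\<dots> \<le> \<delta> * norm v" by (intro mult_left_mono grassmannian_norm[OF P] \<delta>)
  finally have 1: "norm (P *v v - Q *v (P *v v)) \<le> \<delta> * norm v" .
  have "P *v v - Q *v v = (P *v v - Q *v (P *v v)) - ?y"
    by (simp add: matrix_vector_mult_diff_distrib)
  then have "norm (P *v v - Q *v v) \<le> norm (P *v v - Q *v (P *v v)) + norm ?y"
    by (metis norm_triangle_ineq4)
  then show ?thesis using 1 2 by simp
qed

text \<open>Quantitative injectivity. The factor 2 is what remains after perturbing the identity by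
  a matrix of norm at most 1/2; it bounds preimages of vectors of the image plane uniformly.\<close>

definition expansive :: "real^'n^'n \<Rightarrow> bool" where
  "expansive L \<longleftrightarrow> (\<forall>v. norm v \<le> 2 * norm (L *v v))"

lemma expansive_perturbation:
  fixes A :: "real^'n^'n"
  assumes "norm A \<le> 1/2"
  shows "expansive (mat 1 + A)"
  unfolding expansive_def
proof
  fix v :: "real^'n"
  have "norm (A *v v) \<le> norm v / 2"
    using norm_matrix_vector_le[of A v] mult_right_mono[OF assms norm_ge_zero[of v]] by simp
  moreover have "norm v \<le> norm (v + A *v v) + norm (A *v v)" by norm
  ultimately show "norm v \<le> 2 * norm ((mat 1 + A) *v v)"
    by (simp add: matrix_vector_mult_add_rdistrib)
qed

text \<open>The image plane of \<open>push_plane\<close> with the derivative as a matrix argument,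
  so that joint continuity in L and S can be stated.\<close>

definition push_matrix :: "real^'n^'n \<Rightarrow> real^'n^'n \<Rightarrow> real^'n^'n" where
  "push_matrix L S = orth_proj ((*v) L ` plane_of S)"

lemma image_plane:
  fixes L S :: "real^'n^'n"
  assumes "expansive L" "S \<in> grassmannian TYPE('d::finite)"
  shows "subspace ((*v) L ` plane_of S)" "dim ((*v) L ` plane_of S) = CARD('d)"
proof -
  show "subspace ((*v) L ` plane_of S)"
    using plane_of_grassmannian[OF assms(2)] linear_subspace_image[OF matrix_vector_mul_linear] by blast
  have "inj ((*v) L)"
  proof (rule injI)
    fix x y assume "L *v x = L *v y"
    then have "L *v (x - y) = 0" by (simp add: matrix_vector_mult_diff_distrib)
    then show "x = y" using assms(1) unfolding expansive_def
      by (metis eq_iff_diff_eq_0 mult_zero_right norm_le_zero_iff norm_zero)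
  qed
  then show "dim ((*v) L ` plane_of S) = CARD('d)"
    using dim_image_eq[OF matrix_vector_mul_linear, of L "plane_of S"] plane_of_grassmannian[OF assms(2)]
    by (metis inj_on_subset subset_UNIV)
qed

lemma push_matrix_in_grassmannian:
  fixes L S :: "real^'n^'n"
  assumes "expansive L" "S \<in> grassmannian TYPE('d::finite)"
  shows "push_matrix L S \<in> grassmannian TYPE('d)"
  unfolding push_matrix_def by (rule orth_proj_in_grassmannian[OF image_plane[OF assms]])

text \<open>A vector of the first image plane is u = L p with p in the plane of S. The competitor L'
  S' p in the second plane differs from u by (L S - L' S') p, and norm p <= 2 * norm u. The constant
  4 is this 2 times the 2 of \<open>orth_proj_dist\<close>.\<close>

lemma push_matrix_dist:
  fixes L L' S S' :: "real^'n^'n"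
  assumes L: "expansive L" "expansive L'"
    and S: "S \<in> grassmannian TYPE('d::finite)" "S' \<in> grassmannian TYPE('d)"
  shows "norm (push_matrix L S *v v - push_matrix L' S' *v v) \<le> 4 * norm (L ** S - L' ** S') * norm v"
proof -
  have *: "\<exists>w\<in>plane_of (push_matrix L' S'). norm (u - w) \<le> (2 * norm (L ** S - L' ** S')) * norm u"
    if L: "expansive L" "expansive L'"
    and S: "S \<in> grassmannian TYPE('d::finite)" "S' \<in> grassmannian TYPE('d)"
    and u: "u \<in> plane_of (push_matrix L S)" for L L' S S' :: "real^'n^'n" and u
  proof -
    have pl: "plane_of (push_matrix L S) = (*v) L ` plane_of S"
      "plane_of (push_matrix L' S') = (*v) L' ` plane_of S'"
      unfolding push_matrix_def
      by (rule plane_of_orth_proj[OF image_plane[OF L(1) S(1)]] plane_of_orth_proj[OF image_plane[OF L(2) S(2)]])+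
    obtain p where p: "p \<in> plane_of S" "u = L *v p" using u pl by blast
    let ?w = "L' *v (S' *v p)"
    have w: "?w \<in> plane_of (push_matrix L' S')" unfolding pl by (auto simp: plane_of_def)
    have "u - ?w = (L ** S - L' ** S') *v p"
      using plane_of_fixed[OF S(1) p(1)] p(2)
      by (simp add: matrix_vector_mult_diff_rdistrib flip: matrix_vector_mul_assoc)
    then have "norm (u - ?w) \<le> norm (L ** S - L' ** S') * norm p"
      using norm_matrix_vector_le by metis
    also have "\<dots> \<le> norm (L ** S - L' ** S') * (2 * norm u)"
      using L(1) p(2) unfolding expansive_def by (intro mult_left_mono) auto
    finally show ?thesis using w by (intro bexI[of _ ?w]) (auto simp: algebra_simps)
  qed
  have "norm (push_matrix L S *v v - push_matrix L' S' *v v) \<le> 2 * (2 * norm (L ** S - L' ** S')) * norm v"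
  proof (rule orth_proj_dist[where 'd='d])
    show "push_matrix L S \<in> grassmannian TYPE('d)" "push_matrix L' S' \<in> grassmannian TYPE('d)"
      by (intro push_matrix_in_grassmannian L S)+
    show "\<exists>w\<in>plane_of (push_matrix L S). norm (u - w) \<le> 2 * norm (L ** S - L' ** S') * norm u"
      if "u \<in> plane_of (push_matrix L' S')" for u
      using *[OF L(2,1) S(2,1) that] by (simp add: norm_minus_commute)
  qed (use *[OF L S] in auto)
  then show ?thesis by simp
qed

lemma push_matrix_id:
  fixes S :: "real^'n^'n"
  assumes "S \<in> grassmannian TYPE('d::finite)"
  shows "push_matrix (mat 1) S = S"
  unfolding push_matrix_def using orth_proj_plane_of[OF assms] by simp

text \<open>Measurability of the push-forward map comes from here: \<open>push_matrix_dist\<close>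
  compares two values through \<open>L ** S\<close> alone, which is continuous in the pair.\<close>

lemma continuous_on_push_matrix:
  "continuous_on ({L. expansive L} \<times> grassmannian TYPE('d::finite))
     (\<lambda>z. push_matrix (fst z) (snd z :: real^'n^'n))"
proof (rule continuous_on_matrixI)
  fix i j :: 'n
  let ?T = "{L. expansive L} \<times> grassmannian TYPE('d) :: ((real^'n^'n) \<times> (real^'n^'n)) set"
  show "continuous_on ?T (\<lambda>z. push_matrix (fst z) (snd z) $ i $ j)"
    unfolding continuous_on_def
  proof
    fix z assume z: "z \<in> ?T"
    have "continuous_on ?T (\<lambda>w. 4 * norm (fst w ** snd w - fst z ** snd z))"
      by (intro continuous_intros)
    then have lim: "((\<lambda>w. 4 * norm (fst w ** snd w - fst z ** snd z)) \<longlongrightarrow> 0) (at z within ?T)"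
      using bspec[OF iffD1[OF continuous_on_def] z] by force
    have "\<bar>push_matrix (fst w) (snd w) $ i $ j - push_matrix (fst z) (snd z) $ i $ j\<bar>
        \<le> 4 * norm (fst w ** snd w - fst z ** snd z)" if "w \<in> ?T" for w
    proof -
      let ?P = "push_matrix (fst w) (snd w)" and ?Q = "push_matrix (fst z) (snd z)"
      have "\<bar>(?P *v axis j 1 - ?Q *v axis j 1) $ i\<bar> \<le> norm (?P *v axis j 1 - ?Q *v axis j 1)"
        by (rule component_le_norm_cart)
      also have "\<dots> \<le> 4 * norm (fst w ** snd w - fst z ** snd z) * norm (axis j (1::real))"
        by (rule push_matrix_dist[where 'd='d]) (use that z in \<open>auto simp: mem_Times_iff\<close>)
      finally show ?thesis by (simp add: matrix_vector_mult_basis column_def)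
    qed
    then have "eventually (\<lambda>w. norm (push_matrix (fst w) (snd w) $ i $ j - push_matrix (fst z) (snd z) $ i $ j)
        \<le> 4 * norm (fst w ** snd w - fst z ** snd z)) (at z within ?T)"
      unfolding eventually_at_topological by (auto intro!: exI[of _ UNIV])
    from Lim_null_comparison[OF this lim]
    show "((\<lambda>w. push_matrix (fst w) (snd w) $ i $ j) \<longlongrightarrow> push_matrix (fst z) (snd z) $ i $ j) (at z within ?T)"
      using Lim_null by blast
  qed
qed

section \<open>Gram determinants and the tangential Jacobian of a linear map\<close>

definition gram :: "real^'n^'n \<Rightarrow> real^'d^'n \<Rightarrow> real^'d^'d" where
  "gram L s = transpose (L ** s) ** (L ** s)"

text \<open>Two frames of one plane differ by Q = s^T s', which is orthogonal because s s^T fixes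
  the columns of s'. The Gram matrix is conjugated by Q, and its determinant changes by the factor
  (det Q)^2 = 1.\<close>

lemma det_gram_cong:
  fixes s s' :: "real^'d^'n"
  assumes s: "s \<in> stiefel" "s' \<in> stiefel" "s ** transpose s = s' ** transpose s'"
  shows "det (gram L s) = det (gram L s')"
proof -
  let ?Q = "transpose s ** s'"
  have s': "s' = s ** ?Q"
  proof -
    have "s ** ?Q = s' ** (transpose s' ** s')" using s(3) by (metis matrix_mul_assoc)
    then show ?thesis using s(2) by (simp add: stiefel_def)
  qed
  have "transpose ?Q ** ?Q = transpose s' ** (s ** transpose s) ** s'"
    by (simp add: matrix_transpose_mul matrix_mul_assoc)
  also have "\<dots> = (transpose s' ** s') ** (transpose s' ** s')"
    using s(3) by (simp add: matrix_mul_assoc)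
  also have "\<dots> = mat 1" using s(2) by (simp add: stiefel_def)
  finally have Q: "det ?Q * det ?Q = 1" by (metis det_I det_mul det_transpose)
  have "gram L s' = transpose ?Q ** gram L s ** ?Q"
    by (subst s') (simp only: gram_def matrix_transpose_mul matrix_mul_assoc)
  then have "det (gram L s') = det ?Q * det ?Q * det (gram L s)"
    by (simp add: det_mul)
  then show ?thesis using Q by simp
qed

text \<open>\<open>tangential_jacobian\<close> with the derivative replaced by a matrix argument. By
  \<open>det_gram_cong\<close> the choice made by \<open>SOME\<close> is immaterial, which
  \<open>jac_eq\<close> records.\<close>

definition jac :: "'d::finite itself \<Rightarrow> real^'n^'n \<Rightarrow> real^'n^'n \<Rightarrow> real" where
  "jac _ L S = sqrt (det (gram L (SOME s::real^'d^'n. s \<in> stiefel \<and> s ** transpose s = S)))"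

lemma jac_eq:
  fixes s :: "real^'d^'n"
  assumes "s \<in> stiefel"
  shows "jac TYPE('d) L (s ** transpose s) = sqrt (det (gram L s))"
proof -
  let ?P = "\<lambda>r::real^'d^'n. r \<in> stiefel \<and> r ** transpose r = s ** transpose s"
  have "?P (SOME r. ?P r)" by (rule someI[of ?P s]) (use assms in simp)
  then have "det (gram L (SOME r. ?P r)) = det (gram L s)" by (intro det_gram_cong assms) auto
  then show ?thesis unfolding jac_def by simp
qed

lemma tangential_jacobian_eq_jac:
  fixes S :: "real^'n^'n"
  assumes S: "S \<in> grassmannian TYPE('d::finite)" and L: "frechet_derivative f (at x) = (*v) L"
  shows "tangential_jacobian TYPE('d) f x S = jac TYPE('d) L S"
proof -
  define s where "s = (SOME s::'d \<Rightarrow> real^'n. orthonormal_basis_of s (plane_of S))"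
  have "\<exists>s::'d \<Rightarrow> real^'n. orthonormal_basis_of s (plane_of S)"
    by (intro exists_frame plane_of_grassmannian[OF S])
  then have s: "orthonormal_basis_of s (plane_of S)" unfolding s_def by (rule someI_ex)
  let ?M = "(\<chi> i j. s j $ i) :: real^'d^'n"
  have M: "?M \<in> stiefel" using frame_matrix_in_stiefel s unfolding orthonormal_basis_of_def by blast
  have "range ((*v) ?M) = plane_of S"
    using s unfolding range_matrix_eq_span_columns orthonormal_basis_of_def by simp
  then have "?M ** transpose ?M = S" using orth_proj_range_frame[OF M] orth_proj_plane_of[OF S] by simp
  then show ?thesis
    using jac_eq[OF M, of L] L
    unfolding tangential_jacobian_def s_def[symmetric] by (simp add: gram_def matrix_of_matrix_vector_mul Let_def)
qed

text \<open>
  A continuous selection of frames exists only locally. Instead, the preimage of a closed set is the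
  projection of a closed set along the compact Stiefel manifold, since the Gram determinant does not
  depend on the frame.
\<close>

lemma continuous_on_jac:
  "continuous_on (UNIV \<times> grassmannian TYPE('d::finite)) (\<lambda>z. jac TYPE('d) (fst z) (snd z :: real^'n^'n))"
proof (subst continuous_on_closed_vimage)
  show "closed (UNIV \<times> grassmannian TYPE('d) :: ((real^'n^'n) \<times> (real^'n^'n)) set)"
    by (intro closed_Times closed_UNIV compact_imp_closed compact_grassmannian)
  show "\<forall>B. closed B \<longrightarrow> closed ((\<lambda>z. jac TYPE('d) (fst z) (snd z :: real^'n^'n)) -` B \<inter>
         (UNIV \<times> grassmannian TYPE('d)))"
  proof (intro allI impI)
    fix B :: "real set" assume B: "closed B"
    let ?T = "{z :: (real^'d^'n) \<times> ((real^'n^'n) \<times> (real^'n^'n)).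
      fst z ** transpose (fst z) = snd (snd z) \<and> sqrt (det (gram (fst (snd z)) (fst z))) \<in> B}"
    have "continuous_on UNIV (\<lambda>z :: (real^'d^'n) \<times> ((real^'n^'n) \<times> (real^'n^'n)).
        sqrt (det (gram (fst (snd z)) (fst z))))"
      unfolding gram_def by (intro continuous_intros)
    then have "closed ?T"
      using closed_vimage[OF B]
      by (intro closed_Collect_conj closed_Collect_eq continuous_intros) (simp add: vimage_def)
    then have "closed {y. \<exists>x. x \<in> stiefel \<and> (x, y) \<in> ?T}"
      by (rule closed_compact_projection[OF compact_stiefel])
    moreover have "{y. \<exists>x. x \<in> stiefel \<and> (x, y) \<in> ?T} =
        (\<lambda>z. jac TYPE('d) (fst z) (snd z)) -` B \<inter> (UNIV \<times> grassmannian TYPE('d))"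
      by (auto simp: jac_eq grassmannian_eq)
    ultimately show "closed ((\<lambda>z. jac TYPE('d) (fst z) (snd z :: real^'n^'n)) -` B \<inter>
         (UNIV \<times> grassmannian TYPE('d)))" by simp
  qed
qed

text \<open>A further factor turns the remainder r into e_i * (sum) + (1 + e_i) * r. The first term
  is at most card I * \<eta>^2, hence at most 3^(card I) * \<eta>^2, and the second at most twice
  the old bound; this explains the base 3.\<close>

lemma prod_one_plus_expansion:
  fixes e :: "'a \<Rightarrow> real"
  assumes "finite I" "\<And>i. i \<in> I \<Longrightarrow> \<bar>e i\<bar> \<le> \<eta>" "0 \<le> \<eta>" "\<eta> \<le> 1"
  shows "\<bar>(\<Prod>i\<in>I. 1 + e i) - 1 - (\<Sum>i\<in>I. e i)\<bar> \<le> 3 ^ card I * \<eta>\<^sup>2"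
  using assms(1,2)
proof (induction rule: finite_induct)
  case (insert i I)
  let ?s = "\<Sum>i\<in>I. e i"
  let ?r = "(\<Prod>i\<in>I. 1 + e i) - 1 - ?s"
  have r: "\<bar>?r\<bar> \<le> 3 ^ card I * \<eta>\<^sup>2" using insert by simp
  have s: "\<bar>?s\<bar> \<le> card I * \<eta>"
    using order.trans[OF sum_abs[of e I] sum_bounded_above[of I "\<lambda>i. \<bar>e i\<bar>" \<eta>]] insert.prems by simp
  have e: "\<bar>e i\<bar> \<le> \<eta>" using insert by simp
  have "\<bar>e i * ?s\<bar> \<le> \<eta> * (card I * \<eta>)" unfolding abs_mult by (intro mult_mono e s) (use assms in auto)
  moreover have "\<bar>(1 + e i) * ?r\<bar> \<le> 2 * (3 ^ card I * \<eta>\<^sup>2)"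
    unfolding abs_mult by (intro mult_mono r) (use assms e in auto)
  moreover have "(\<Prod>i\<in>insert i I. 1 + e i) - 1 - (\<Sum>i\<in>insert i I. e i) = e i * ?s + (1 + e i) * ?r"
    using insert by (simp add: algebra_simps)
  moreover have "real (card I) * \<eta>\<^sup>2 \<le> 3 ^ card I * \<eta>\<^sup>2"
  proof (intro mult_right_mono)
    have "card I \<le> 3 ^ card I" by (rule less_imp_le[OF power_gt_expt]) simp
    then show "real (card I) \<le> 3 ^ card I" by (metis of_nat_le_iff of_nat_numeral of_nat_power)
  qed simp
  ultimately have "\<bar>(\<Prod>i\<in>insert i I. 1 + e i) - 1 - (\<Sum>i\<in>insert i I. e i)\<bar> \<le> 3 * (3 ^ card I * \<eta>\<^sup>2)"
    by (simp add: power2_eq_square algebra_simps)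
  then show ?case using insert by (simp add: mult.assoc)
qed simp

text \<open>Leibniz formula. The identity permutation contributes the diagonal product. Any other
  permutation p moves some i and then also p i, so two factors are off-diagonal entries of size at
  most \<eta>, while the remaining ones are at most 2.\<close>

lemma det_mat1_plus_expansion:
  "\<exists>K\<ge>0. \<forall>(E::real^'d^'d) \<eta>. 0 \<le> \<eta> \<and> \<eta> \<le> 1 \<and> (\<forall>i j. \<bar>E $ i $ j\<bar> \<le> \<eta>)
      \<longrightarrow> \<bar>det (mat 1 + E) - 1 - (\<Sum>i\<in>UNIV. E $ i $ i)\<bar> \<le> K * \<eta>\<^sup>2"
proof -
  let ?d = "CARD('d)"
  let ?P = "{p. p permutes (UNIV :: 'd set)}"
  have finP: "finite ?P" by (simp add: finite_permutations)
  let ?K = "3 ^ ?d + card ?P * 2 ^ ?d :: real"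
  have "\<bar>det (mat 1 + E) - 1 - (\<Sum>i\<in>UNIV. E $ i $ i)\<bar> \<le> ?K * \<eta>\<^sup>2"
    if \<eta>: "0 \<le> \<eta>" "\<eta> \<le> 1" and E: "\<And>i j. \<bar>E $ i $ j\<bar> \<le> \<eta>" for E :: "real^'d^'d" and \<eta>
  proof -
    let ?t = "\<lambda>p. of_int (sign p) * (\<Prod>i\<in>UNIV. (mat 1 + E) $ i $ p i)"
    have off: "\<bar>?t p\<bar> \<le> 2 ^ ?d * \<eta>\<^sup>2" if p: "p \<in> ?P - {id}" for p
    proof -
      have perm: "p permutes UNIV" "p \<noteq> id" using p by auto
      then obtain i where i: "p i \<noteq> i" by (auto simp: fun_eq_iff)
      let ?j = "p i"
      have j: "p ?j \<noteq> ?j" using i permutes_inj[OF perm(1)] by (auto dest: injD)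
      let ?f = "\<lambda>k. \<bar>(mat 1 + E) $ k $ p k\<bar>"
      have f2: "?f k \<le> 2" for k using E[of k "p k"] \<eta> by (auto simp: mat_def)
      have fi: "?f i \<le> \<eta>" using E[of i "p i"] i by (auto simp: mat_def)
      have fj: "?f ?j \<le> \<eta>" using E[of ?j "p ?j"] j by (auto simp: mat_def)
      have "\<bar>?t p\<bar> = (\<Prod>k\<in>UNIV. ?f k)" by (simp add: abs_mult abs_prod sign_def)
      also have "\<dots> = ?f i * (?f ?j * (\<Prod>k\<in>UNIV - {i} - {?j}. ?f k))"
        using i by (subst prod.remove[of _ i]; simp) (subst prod.remove[of _ ?j]; simp)
      also have "\<dots> \<le> \<eta> * (\<eta> * (\<Prod>k\<in>UNIV - {i} - {?j}. 2))"
        by (intro mult_mono fi fj prod_mono) (use f2 \<eta> in \<open>auto intro!: prod_nonneg mult_nonneg_nonneg\<close>)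
      also have "\<dots> \<le> \<eta> * (\<eta> * 2 ^ ?d)"
      proof (intro mult_left_mono \<eta>)
        have "card (UNIV - {i} - {?j}) \<le> ?d" by (rule card_mono) auto
        then show "(\<Prod>k\<in>UNIV - {i} - {?j}. 2) \<le> (2::real) ^ ?d" by (simp del: card_Diff_insert)
      qed
      finally show ?thesis by (simp add: power2_eq_square algebra_simps)
    qed
    have "det (mat 1 + E) = ?t id + (\<Sum>p\<in>?P - {id}. ?t p)"
      unfolding det_def by (rule sum.remove[OF finP]) (simp add: permutes_id)
    moreover have "?t id = (\<Prod>i\<in>UNIV. 1 + E $ i $ i)" by (simp add: mat_def sign_id)
    moreover have "\<bar>\<Sum>p\<in>?P - {id}. ?t p\<bar> \<le> card ?P * (2 ^ ?d * \<eta>\<^sup>2)"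
    proof -
      have "\<bar>\<Sum>p\<in>?P - {id}. ?t p\<bar> \<le> (\<Sum>p\<in>?P - {id}. \<bar>?t p\<bar>)" by (rule sum_abs)
      also have "\<dots> \<le> card (?P - {id}) * (2 ^ ?d * \<eta>\<^sup>2)" by (rule sum_bounded_above[OF off])
      also have "\<dots> \<le> card ?P * (2 ^ ?d * \<eta>\<^sup>2)"
        by (intro mult_right_mono) (auto intro!: card_mono finP)
      finally show ?thesis .
    qed
    moreover have "\<bar>(\<Prod>i\<in>UNIV. 1 + E $ i $ i) - 1 - (\<Sum>i\<in>UNIV. E $ i $ i)\<bar> \<le> 3 ^ ?d * \<eta>\<^sup>2"
      by (rule prod_one_plus_expansion) (use E \<eta> in auto)
    ultimately show ?thesis by (simp add: algebra_simps)
  qed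
  then show ?thesis by (intro exI[of _ ?K]) auto
qed

text \<open>With y = sqrt (1 + x) the left side is (y - 1)^2 / 2, while x^2 = (y - 1)^2 * (y + 1)^2
  and y + 1 >= 1.\<close>

lemma sqrt_one_plus_expansion:
  fixes x :: real
  assumes "-1 \<le> x"
  shows "\<bar>sqrt (1 + x) - 1 - x / 2\<bar> \<le> x\<^sup>2 / 2"
proof -
  define y where "y = sqrt (1 + x)"
  have y: "0 \<le> y" and x: "x = y\<^sup>2 - 1" using assms by (auto simp: y_def)
  have "y - 1 - x / 2 = - ((y - 1)\<^sup>2 / 2)" unfolding x by (simp add: power2_eq_square field_simps)
  moreover have "(y - 1)\<^sup>2 * 1 \<le> (y - 1)\<^sup>2 * (y + 1)\<^sup>2"
    by (rule mult_left_mono) (use y in \<open>auto intro: one_le_power\<close>)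
  moreover have "(y - 1)\<^sup>2 * (y + 1)\<^sup>2 = x\<^sup>2" unfolding x by (simp add: power2_eq_square algebra_simps)
  ultimately show ?thesis unfolding y_def by simp
qed

text \<open>For orthonormal columns the left side is the divergence of the linear map A along their
  span; the right side expresses it by the projection. It is the first-order term of the
  Jacobian.\<close>

lemma trace_frame:
  fixes s :: "real^'d^'n" and A :: "real^'n^'n"
  shows "(\<Sum>i\<in>UNIV. column i s \<bullet> (A *v column i s)) = trace (A ** (s ** transpose s))"
proof -
  have "(\<Sum>i\<in>UNIV. column i s \<bullet> (A *v column i s)) =
      (\<Sum>i\<in>UNIV. \<Sum>a\<in>UNIV. \<Sum>b\<in>UNIV. A $ a $ b * (s $ b $ i * s $ a $ i))"
    by (simp add: inner_vec_def column_def matrix_vector_mult_def sum_distrib_left algebra_simps)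
  also have "\<dots> = (\<Sum>a\<in>UNIV. \<Sum>i\<in>UNIV. \<Sum>b\<in>UNIV. A $ a $ b * (s $ b $ i * s $ a $ i))"
    by (rule sum.swap)
  also have "\<dots> = (\<Sum>a\<in>UNIV. \<Sum>b\<in>UNIV. \<Sum>i\<in>UNIV. A $ a $ b * (s $ b $ i * s $ a $ i))"
    by (intro sum.cong refl sum.swap)
  also have "\<dots> = trace (A ** (s ** transpose s))"
    by (simp add: trace_def matrix_matrix_mult_def transpose_def sum_distrib_left)
  finally show ?thesis .
qed

text \<open>For a frame with columns p_i the Gram matrix of 1 + A is 1 + E, where tr E is 2 tr (A S)
  plus the sum of the |A p_i|^2. The determinant is 1 + tr E up to second order, and the square root
  halves the trace.\<close>

lemma jac_expansion:
  "\<exists>K a. 0 < K \<and> 0 < a \<and> a \<le> 1/2 \<and> (\<forall>(A::real^'n^'n) S. S \<in> grassmannian TYPE('d::finite) \<and> norm A \<le> a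
      \<longrightarrow> \<bar>jac TYPE('d) (mat 1 + A) S - 1 - trace (A ** S)\<bar> \<le> K * (norm A)\<^sup>2)"
proof -
  obtain K where K: "0 \<le> K" "\<And>(E::real^'d^'d) \<eta>. 0 \<le> \<eta> \<Longrightarrow> \<eta> \<le> 1 \<Longrightarrow> (\<And>i j. \<bar>E $ i $ j\<bar> \<le> \<eta>)
      \<Longrightarrow> \<bar>det (mat 1 + E) - 1 - (\<Sum>i\<in>UNIV. E $ i $ i)\<bar> \<le> K * \<eta>\<^sup>2"
    using det_mat1_plus_expansion[where 'd='d] by blast
  define d where "d = real CARD('d)"
  \<comment> \<open>Chosen so that the deviation x of the Gram determinant from 1 satisfies |x| <= B
    * norm A; then norm A <= 1/B keeps the radicand 1 + x nonnegative. As B >= 3, the entries of E,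
    bounded by 3 * norm A, are at most 1.\<close>
  define B where "B = 3 * d + 9 * K"
  have d: "1 \<le> d" unfolding d_def using zero_less_card_finite[where 'a='d] by linarith
  have B: "3 \<le> B" using d K(1) unfolding B_def by simp
  \<comment> \<open>The three summands stem from the square root, from the terms |A p_i|^2 and from
    the determinant.\<close>
  define K' where "K' = B\<^sup>2 / 2 + d / 2 + 9 * K / 2"
  have "\<bar>jac TYPE('d) (mat 1 + A) S - 1 - trace (A ** S)\<bar> \<le> K' * (norm A)\<^sup>2"
    if S: "S \<in> grassmannian TYPE('d)" and A: "norm A \<le> 1 / B" for A S :: "real^'n^'n"
  proof -
    obtain s :: "real^'d^'n" where s: "s \<in> stiefel" "S = s ** transpose s" using grassmannianE[OF S] by metis
    define a where "a = norm A"
    have a: "0 \<le> a" "a \<le> 1/3" "a * B \<le> 1"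
      using A B order.trans[OF A, of "1/3"] by (auto simp: a_def field_simps)
    let ?p = "\<lambda>i. column i s"
    have pp: "?p i \<bullet> ?p j = (if i = j then 1 else 0)" for i j
    proof -
      have "(transpose s ** s) $ i $ j = ?p i \<bullet> ?p j"
        by (simp add: matrix_matrix_mult_def transpose_def column_def inner_vec_def)
      then show ?thesis using s(1) by (simp add: stiefel_def mat_def)
    qed
    then have np: "norm (?p i) = 1" for i by (simp add: norm_eq_1)
    have nAp: "norm (A *v ?p i) \<le> a" for i using norm_matrix_vector_le[of A "?p i"] np by (simp add: a_def)
    define E :: "real^'d^'d" where
      "E = (\<chi> i j. (A *v ?p i) \<bullet> ?p j + ?p i \<bullet> (A *v ?p j) + (A *v ?p i) \<bullet> (A *v ?p j))"
    have "gram L s $ i $ j = (L *v ?p i) \<bullet> (L *v ?p j)" for L i j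
      by (simp add: gram_def matrix_matrix_mult_def transpose_def column_def inner_vec_def matrix_vector_mult_def)
    then have gram: "gram (mat 1 + A) s = mat 1 + E"
      by (simp add: vec_eq_iff E_def pp matrix_vector_mult_add_rdistrib inner_add_left inner_add_right)
         (simp add: mat_def)
    have E: "\<bar>E $ i $ j\<bar> \<le> 3 * a" for i j
    proof -
      have "\<bar>(A *v ?p i) \<bullet> ?p j\<bar> \<le> a" "\<bar>?p i \<bullet> (A *v ?p j)\<bar> \<le> a"
        using Cauchy_Schwarz_ineq2[of "A *v ?p i" "?p j"] Cauchy_Schwarz_ineq2[of "?p i" "A *v ?p j"]
          nAp[of i] nAp[of j] np by simp_all
      moreover have "\<bar>(A *v ?p i) \<bullet> (A *v ?p j)\<bar> \<le> a * 1"
        by (rule order.trans[OF Cauchy_Schwarz_ineq2], intro mult_mono nAp order.trans[OF nAp]) (use a in auto)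
      ultimately show ?thesis by (simp add: E_def)
    qed
    let ?tr = "\<Sum>i\<in>UNIV. E $ i $ i"
    have det: "\<bar>det (mat 1 + E) - 1 - ?tr\<bar> \<le> K * (3 * a)\<^sup>2"
      by (rule K(2)) (use a E in auto)
    have tr: "?tr = 2 * trace (A ** S) + (\<Sum>i\<in>UNIV. (norm (A *v ?p i))\<^sup>2)"
      unfolding s(2) trace_frame[symmetric]
      by (simp add: E_def sum.distrib power2_norm_eq_inner inner_commute sum_distrib_left flip: mult_2)
    have q: "\<bar>\<Sum>i\<in>UNIV. (norm (A *v ?p i))\<^sup>2\<bar> \<le> d * a\<^sup>2"
    proof -
      have "(\<Sum>i\<in>UNIV. (norm (A *v ?p i))\<^sup>2) \<le> real CARD('d) * a\<^sup>2"
        by (rule sum_bounded_above) (use nAp in \<open>auto intro!: power_mono\<close>)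
      then show ?thesis by (simp add: d_def sum_nonneg)
    qed
    have trE: "\<bar>?tr\<bar> \<le> d * (3 * a)"
    proof -
      have "\<bar>?tr\<bar> \<le> (\<Sum>i\<in>UNIV. \<bar>E $ i $ i\<bar>)" by (rule sum_abs)
      also have "\<dots> \<le> real CARD('d) * (3 * a)" by (rule sum_bounded_above) (rule E)
      finally show ?thesis by (simp only: d_def)
    qed
    define x where "x = det (mat 1 + E) - 1"
    have aa: "a\<^sup>2 \<le> a" using a by (simp add: power2_eq_square mult_left_le_one_le)
    have "\<bar>x\<bar> \<le> d * (3 * a) + K * (3 * a)\<^sup>2" using det trE unfolding x_def by linarith
    also have "\<dots> \<le> B * a" using mult_left_mono[OF aa K(1)] by (simp add: B_def power2_eq_square algebra_simps)
    finally have x: "\<bar>x\<bar> \<le> B * a" .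
    then have x1: "- 1 \<le> x" using a(3) by (simp add: mult.commute)
    have x2: "x\<^sup>2 \<le> (B * a)\<^sup>2" using x by (rule power2_le_iff_abs_le[THEN iffD2, rotated]) (use B a in auto)
    have "jac TYPE('d) (mat 1 + A) S = sqrt (1 + x)"
      unfolding s(2) jac_eq[OF s(1)] gram x_def by simp
    then have "\<bar>jac TYPE('d) (mat 1 + A) S - 1 - x / 2\<bar> \<le> (B * a)\<^sup>2 / 2"
      using sqrt_one_plus_expansion[OF x1] x2 by simp
    moreover have "\<bar>x / 2 - trace (A ** S)\<bar> \<le> d * a\<^sup>2 / 2 + K * (3 * a)\<^sup>2 / 2"
      using det q unfolding tr x_def abs_le_iff by (simp add: field_simps)
    ultimately have "\<bar>jac TYPE('d) (mat 1 + A) S - 1 - trace (A ** S)\<bar> \<le> (B * a)\<^sup>2 / 2 + d * a\<^sup>2 / 2 + K * (3 * a)\<^sup>2 / 2"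
      by linarith
    then show ?thesis by (simp add: K'_def a_def power2_eq_square algebra_simps)
  qed
  moreover have "0 < K'" unfolding K'_def using d K(1) by (simp add: add_pos_nonneg add_nonneg_pos)
  moreover have "1 / B \<le> 1/2" "0 < 1 / B" using B by (auto simp: field_simps)
  ultimately show ?thesis by (intro exI[of _ K'] exI[of _ "1 / B"]) auto
qed

section \<open>Regularity of the kernel\<close>

lemma has_derivative_grad:
  fixes f :: "real^'n \<Rightarrow> real"
  assumes "f differentiable (at x)"
  shows "(f has_derivative (\<lambda>v. grad f x \<bullet> v)) (at x)"
proof -
  let ?f' = "frechet_derivative f (at x)"
  have f': "(f has_derivative ?f') (at x)" using assms frechet_derivative_works by blast
  then interpret f': linear ?f' by (rule has_derivative_linear)
  have "?f' v = grad f x \<bullet> v" for v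
  proof -
    have "?f' v = ?f' (\<Sum>i\<in>UNIV. v $ i *\<^sub>R axis i 1)"
      using basis_expansion[of v] by (simp add: scalar_mult_eq_scaleR)
    then show ?thesis by (simp add: f'.sum f'.scaleR grad_def inner_vec_def mult.commute)
  qed
  then show ?thesis using f' by (metis has_derivative_transform_eventually has_derivative_eq_rhs ext)
qed

lemma cutoff_bounds:
  assumes "cutoff \<psi>"
  shows "0 \<le> \<psi> x" "1 \<le> norm x \<Longrightarrow> \<psi> x = 0" "C_k (Suc 0) \<psi>"
  using assms unfolding cutoff_def by blast+

text \<open>All factors independent of x are gathered in c and k, so that differentiating the kernel
  is the product rule for \<psi> times an exponential.\<close>

lemma kernel_eq:
  fixes \<psi> :: "real^'n \<Rightarrow> real"
  assumes "cutoff \<psi>"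
  obtains c k where "0 \<le> c" "kernel \<psi> \<epsilon> = (\<lambda>x. c * (\<psi> x * exp ((x \<bullet> x) * k)))"
proof -
  let ?a = "(2 * pi * \<epsilon>^2) powr (- (real CARD('n) / 2))"
  let ?c = "?a / (\<integral>z. truncated_gaussian \<psi> \<epsilon> z \<partial>lborel)"
  have "0 \<le> truncated_gaussian \<psi> \<epsilon> z" for z
    unfolding truncated_gaussian_def by (intro mult_nonneg_nonneg cutoff_bounds(1)[OF assms]) auto
  then have "0 \<le> ?c" by (intro divide_nonneg_nonneg integral_nonneg) auto
  moreover have "kernel \<psi> \<epsilon> = (\<lambda>x. ?c * (\<psi> x * exp ((x \<bullet> x) * (- 1 / (2 * \<epsilon>^2)))))"
    by (simp add: kernel_def truncated_gaussian_def power2_norm_eq_inner fun_eq_iff)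
  ultimately show thesis using that by blast
qed

lemma kernel_differentiable_and_continuous_grad:
  fixes \<psi> :: "real^'n \<Rightarrow> real"
  assumes "cutoff \<psi>"
  shows "kernel \<psi> \<epsilon> differentiable (at x)" "continuous_on UNIV (grad (kernel \<psi> \<epsilon>))"
proof -
  have diff: "\<And>x. \<psi> differentiable (at x)"
    and cont': "\<And>v. continuous_on UNIV (\<lambda>x. frechet_derivative \<psi> (at x) v)"
    using cutoff_bounds(3)[OF assms] by auto
  have cont: "continuous_on UNIV \<psi>" using diff by (simp add: differentiable_imp_continuous_on differentiable_on_def)
  obtain c k where c: "kernel \<psi> \<epsilon> = (\<lambda>x. c * (\<psi> x * exp ((x \<bullet> x) * k)))"
    using kernel_eq[OF assms] by metis
  let ?D = "\<lambda>x v. c * (\<psi> x * ((x \<bullet> v + v \<bullet> x) * k * exp ((x \<bullet> x) * k))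
      + frechet_derivative \<psi> (at x) v * exp ((x \<bullet> x) * k))"
  have D: "(kernel \<psi> \<epsilon> has_derivative ?D x) (at x)" for x
    unfolding c
    by (intro has_derivative_mult_right has_derivative_mult has_derivative_exp has_derivative_mult_left
        has_derivative_inner has_derivative_ident frechet_derivative_works[THEN iffD1] diff)
  show "kernel \<psi> \<epsilon> differentiable (at x)" using D differentiable_def by blast
  have "grad (kernel \<psi> \<epsilon>) = (\<lambda>x. \<chi> i. ?D x (axis i 1))"
    unfolding grad_def using frechet_derivative_at[OF D] by (simp add: fun_eq_iff)
  moreover have "continuous_on UNIV (\<lambda>x. \<chi> i. ?D x (axis i 1))"
    by (intro continuous_on_vec_lambda continuous_intros cont cont')
  ultimately show "continuous_on UNIV (grad (kernel \<psi> \<epsilon>))" by simp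
qed

text \<open>Heine-Cantor on the ball of radius 3. Of two points at distance below 1, either one has
  norm at most 2 and both lie in that ball, or both lie outside the unit ball, where f
  vanishes.\<close>

lemma uniformly_continuous_on_compact_support:
  fixes f :: "'a::euclidean_space \<Rightarrow> 'b::real_normed_vector"
  assumes f: "continuous_on UNIV f" and supp: "\<And>x. 1 < norm x \<Longrightarrow> f x = 0"
  shows "uniformly_continuous_on UNIV f"
  unfolding uniformly_continuous_on_def
proof (intro allI impI)
  fix e :: real assume e: "0 < e"
  have "uniformly_continuous_on (cball 0 3) f"
    by (intro compact_uniformly_continuous continuous_on_subset[OF f]) auto
  then obtain d where d: "0 < d" "\<And>x y. x \<in> cball 0 3 \<Longrightarrow> y \<in> cball 0 3 \<Longrightarrow> dist y x < d \<Longrightarrow> dist (f y) (f x) < e"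
    unfolding uniformly_continuous_on_def using e by meson
  have "dist (f y) (f x) < e" if "dist y x < min d 1" for x y
  proof (cases "norm x \<le> 2")
    case True
    moreover have "norm y \<le> 3" using True that norm_triangle_ineq2[of y x] by (simp add: dist_norm)
    ultimately show ?thesis using d(2) that by simp
  next
    case False
    then have "1 < norm y" using that norm_triangle_ineq2[of x y] by (simp add: dist_norm norm_minus_commute)
    then show ?thesis using supp False e by simp
  qed
  then show "\<exists>d>0. \<forall>x\<in>UNIV. \<forall>x'\<in>UNIV. dist x' x < d \<longrightarrow> dist (f x') (f x) < e"
    using d(1) by (intro exI[of _ "min d 1"]) auto
qed

lemma kernel_properties:
  fixes \<psi> :: "real^'n \<Rightarrow> real"
  assumes "cutoff \<psi>"
  shows "0 \<le> kernel \<psi> \<epsilon> x" "1 < norm x \<Longrightarrow> kernel \<psi> \<epsilon> x = 0" "1 < norm x \<Longrightarrow> grad (kernel \<psi> \<epsilon>) x = 0"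
    "continuous_on UNIV (kernel \<psi> \<epsilon>)"
    "\<exists>B>0. \<forall>x. kernel \<psi> \<epsilon> x \<le> B \<and> norm (grad (kernel \<psi> \<epsilon>) x) \<le> B"
proof -
  obtain c k where c: "0 \<le> c" "kernel \<psi> \<epsilon> = (\<lambda>x. c * (\<psi> x * exp ((x \<bullet> x) * k)))"
    using kernel_eq[OF assms] by metis
  show "0 \<le> kernel \<psi> \<epsilon> x" using c cutoff_bounds(1)[OF assms] by simp
  have zero: "kernel \<psi> \<epsilon> x = 0" if "1 < norm x" for x
    using that c cutoff_bounds(2)[OF assms, of x] by simp
  then show "1 < norm x \<Longrightarrow> kernel \<psi> \<epsilon> x = 0" .
  \<comment> \<open>The strict inequality describes an open set on which the kernel is constantly 0,
    so its derivative vanishes there too.\<close>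
  have zero': "grad (kernel \<psi> \<epsilon>) x = 0" if x: "1 < norm x" for x
  proof -
    have "open {x :: real^'n. 1 < norm x}" by (intro open_Collect_less continuous_intros)
    then have "(kernel \<psi> \<epsilon> has_derivative (\<lambda>v. 0)) (at x)"
      by (rule has_derivative_transform_within_open[OF has_derivative_const[of 0]]) (use x zero in auto)
    then have "frechet_derivative (kernel \<psi> \<epsilon>) (at x) = (\<lambda>v. 0)" by (rule frechet_derivative_at[symmetric])
    then show ?thesis by (simp add: grad_def vec_eq_iff)
  qed
  then show "1 < norm x \<Longrightarrow> grad (kernel \<psi> \<epsilon>) x = 0" .
  show cont: "continuous_on UNIV (kernel \<psi> \<epsilon>)"
    using kernel_differentiable_and_continuous_grad(1)[OF assms]
    by (simp add: differentiable_imp_continuous_on differentiable_on_def)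
  have "compact (kernel \<psi> \<epsilon> ` cball 0 1)" "compact (grad (kernel \<psi> \<epsilon>) ` cball 0 1)"
    using cont kernel_differentiable_and_continuous_grad(2)[OF assms]
    by (auto intro!: compact_continuous_image intro: continuous_on_subset)
  then obtain b b' where b: "0 < b" "\<And>y. y \<in> kernel \<psi> \<epsilon> ` cball 0 1 \<Longrightarrow> norm y \<le> b"
    and b': "0 < b'" "\<And>y. y \<in> grad (kernel \<psi> \<epsilon>) ` cball 0 1 \<Longrightarrow> norm y \<le> b'"
    by (meson compact_imp_bounded bounded_pos)
  have "kernel \<psi> \<epsilon> x \<le> max b b' \<and> norm (grad (kernel \<psi> \<epsilon>) x) \<le> max b b'" for x
  proof (cases "norm x \<le> 1")
    case True
    have "norm (kernel \<psi> \<epsilon> x) \<le> b" "norm (grad (kernel \<psi> \<epsilon>) x) \<le> b'"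
      using True by (intro b b'; simp)+
    then show ?thesis by auto
  next
    case False
    then show ?thesis using zero zero' b(1) by auto
  qed
  then show "\<exists>B>0. \<forall>x. kernel \<psi> \<epsilon> x \<le> B \<and> norm (grad (kernel \<psi> \<epsilon>) x) \<le> B"
    using b(1) by (intro exI[of _ "max b b'"]) auto
qed

text \<open>Dominated convergence along sequences. It serves both for integrals over a varifold with
  parameter y and for integrals over y with parameter x.\<close>

lemma continuous_on_integral_dominated:
  fixes f :: "'a::metric_space \<Rightarrow> 'z \<Rightarrow> 'b::{banach, second_countable_topology}"
  assumes "\<And>y. f y \<in> borel_measurable M" "integrable M w"
    and "\<And>y z. z \<in> space M \<Longrightarrow> norm (f y z) \<le> w z"
    and "\<And>z. z \<in> space M \<Longrightarrow> continuous_on UNIV (\<lambda>y. f y z)"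
  shows "continuous_on UNIV (\<lambda>y. \<integral>z. f y z \<partial>M)"
  unfolding continuous_on_sequentially
proof (intro allI ballI impI, elim conjE)
  fix x :: "nat \<Rightarrow> 'a" and y :: 'a assume x: "(x \<longlongrightarrow> y) sequentially"
  show "((\<lambda>y. \<integral>z. f y z \<partial>M) \<circ> x) \<longlonglongrightarrow> (\<integral>z. f y z \<partial>M)"
    unfolding comp_def
  proof (rule integral_dominated_convergence[where w=w])
    show "AE z in M. (\<lambda>i. f (x i) z) \<longlonglongrightarrow> f y z"
    proof (rule AE_I2)
      fix z assume "z \<in> space M"
      then have "isCont (\<lambda>y. f y z) y" using assms(4) by (simp add: continuous_on_eq_continuous_at)
      then show "(\<lambda>i. f (x i) z) \<longlonglongrightarrow> f y z" using x by (rule isCont_tendsto_compose)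
    qed
  qed (use assms in auto)
qed

lemma integrable_continuous_compact_support:
  fixes f :: "'a::euclidean_space \<Rightarrow> 'b::{banach, second_countable_topology}"
  assumes "continuous_on UNIV f" "\<And>y. r < norm y \<Longrightarrow> f y = 0"
  shows "integrable lborel f"
proof -
  have "integrable lborel (\<lambda>x. indicator (cball 0 r) x *\<^sub>R f x)"
    by (rule borel_integrable_compact) (auto intro: continuous_on_subset[OF assms(1)])
  also have "(\<lambda>x. indicator (cball 0 r) x *\<^sub>R f x) = f"
    using assms(2) by (auto simp: fun_eq_iff indicator_def not_le)
  finally show ?thesis .
qed

section \<open>Compactly supported varifolds of bounded mass\<close>

text \<open>The support condition is an almost-everywhere statement, which passes through
  \<open>density\<close> and \<open>distr\<close> and can be tested by integrals in a weak-star
  limit. The bound by \<open>ennreal m\<close> includes finiteness.\<close>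

definition bounded_varifold ::
    "'d::finite itself \<Rightarrow> real \<Rightarrow> real \<Rightarrow> ((real^'n) \<times> (real^'n^'n)) measure \<Rightarrow> bool" where
  "bounded_varifold D R m V \<longleftrightarrow> sets V = sets (varifold_space D) \<and>
     emeasure V (space V) \<le> ennreal m \<and> (AE z in V. norm (fst z) \<le> R)"

lemma space_varifold:
  fixes V :: "((real^'n) \<times> (real^'n^'n)) measure"
  assumes "sets V = sets (varifold_space D)"
  shows "space V = UNIV \<times> grassmannian D"
  using sets_eq_imp_space_eq[OF assms] by (simp add: varifold_space_def space_restrict_space)

lemma measurable_continuous_on_varifold:
  fixes V :: "((real^'n) \<times> (real^'n^'n)) measure"
  assumes "sets V = sets (varifold_space D)" "continuous_on (UNIV \<times> grassmannian D) f"
  shows "f \<in> borel_measurable V"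
  unfolding measurable_cong_sets[OF assms(1) refl] varifold_space_def
  by (rule borel_measurable_continuous_on_restrict[OF assms(2)])

lemma measurable_fst_snd_varifold:
  fixes V :: "((real^'n) \<times> (real^'n^'n)) measure"
  assumes "sets V = sets (varifold_space D)"
  shows "fst \<in> borel_measurable V" "snd \<in> borel_measurable V"
  by (rule measurable_continuous_on_varifold[OF assms]; intro continuous_intros)+

lemma borel_measurable_matrix_vector:
  fixes F :: "'a \<Rightarrow> real^'n^'m"
  assumes "F \<in> borel_measurable M" "G \<in> borel_measurable M"
  shows "(\<lambda>x. F x *v G x) \<in> borel_measurable M"
  by (rule borel_measurable_continuous_Pair[OF assms]) (intro continuous_intros)

lemma emeasure_weight:
  fixes V :: "((real^'n) \<times> (real^'n^'n)) measure"
  assumes "sets V = sets (varifold_space D)"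
  shows "emeasure (weight V) UNIV = emeasure V (space V)"
  unfolding weight_def
  by (subst emeasure_distr) (auto simp: measurable_fst_snd_varifold[OF assms])

lemma mass_eq:
  fixes V :: "((real^'n) \<times> (real^'n^'n)) measure"
  assumes "sets V = sets (varifold_space D)"
  shows "mass V = measure V (space V)"
  unfolding mass_def measure_def emeasure_weight[OF assms] ..

lemma bounded_varifold_finite:
  assumes "bounded_varifold D R m V"
  shows "finite_measure V"
  by standard (use assms in \<open>auto simp: bounded_varifold_def top_unique\<close>)

lemma bounded_varifold_mass:
  assumes "bounded_varifold D R m V" "0 \<le> m"
  shows "mass V \<le> m" "0 \<le> mass V"
proof -
  interpret finite_measure V by (rule bounded_varifold_finite[OF assms(1)])
  have "sets V = sets (varifold_space D)" using assms(1) by (simp add: bounded_varifold_def)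
  moreover have "measure V (space V) \<le> m"
    using assms by (simp add: bounded_varifold_def emeasure_eq_measure)
  ultimately show "mass V \<le> m" "0 \<le> mass V" using mass_eq[of V D] by (simp_all add: mass_def)
qed

text \<open>\<open>B\<close> is any common bound for the kernel and its gradient at the fixed
  \<epsilon>; \<open>kernel_properties\<close> supplies one by compactness of the unit ball, and the
  later constants are expressed through it.\<close>

locale mollifier =
  fixes \<psi> :: "real^'n \<Rightarrow> real" and \<epsilon> B :: real
  assumes cutoff: "cutoff \<psi>" and eps: "0 < \<epsilon>" and B: "0 < B"
    and kernel_le: "kernel \<psi> \<epsilon> x \<le> B"
    and norm_grad_kernel_le: "norm (grad (kernel \<psi> \<epsilon>) x) \<le> B"
begin

abbreviation "\<Phi> \<equiv> kernel \<psi> \<epsilon>"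
abbreviation "D\<Phi> \<equiv> grad (kernel \<psi> \<epsilon>)"

definition "ball_vol = measure lborel (cball (0::real^'n) 1)"

lemmas kernel_nonneg = kernel_properties(1)[OF cutoff, of \<epsilon>]
  and kernel_eq_0 = kernel_properties(2)[OF cutoff]
  and grad_kernel_eq_0 = kernel_properties(3)[OF cutoff]
  and continuous_kernel = kernel_properties(4)[OF cutoff]
  and continuous_grad_kernel = kernel_differentiable_and_continuous_grad(2)[OF cutoff]

lemma kernel_has_derivative: "(\<Phi> has_derivative (\<lambda>v. D\<Phi> x \<bullet> v)) (at x)"
  by (intro has_derivative_grad kernel_differentiable_and_continuous_grad(1) cutoff)

lemma continuous_kernel_comp [continuous_intros]:
  "continuous_on T g \<Longrightarrow> continuous_on T (\<lambda>x. \<Phi> (g x))"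
  by (rule continuous_on_compose2[OF continuous_kernel]) auto

lemma continuous_grad_kernel_comp [continuous_intros]:
  "continuous_on T g \<Longrightarrow> continuous_on T (\<lambda>x. D\<Phi> (g x))"
  by (rule continuous_on_compose2[OF continuous_grad_kernel]) auto

lemma kernel_measurable [measurable]: "\<Phi> \<in> borel_measurable borel" "D\<Phi> \<in> borel_measurable borel"
  by (intro borel_measurable_continuous_onI continuous_kernel continuous_grad_kernel)+

text \<open>Mean value inequality with the modulus of uniform continuity of the gradient. The radius
  d does not depend on z, as differentiation under an integral over y requires.\<close>

lemma kernel_linearization:
  assumes "0 < e"
  obtains d where "0 < d" "\<And>z v. norm v < d \<Longrightarrow> \<bar>\<Phi> (z + v) - \<Phi> z - D\<Phi> z \<bullet> v\<bar> \<le> e * norm v"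
proof -
  have "uniformly_continuous_on UNIV D\<Phi>"
    by (intro uniformly_continuous_on_compact_support continuous_grad_kernel grad_kernel_eq_0)
  then obtain d where d: "0 < d" "\<And>x y. dist y x < d \<Longrightarrow> dist (D\<Phi> y) (D\<Phi> x) < e"
    unfolding uniformly_continuous_on_def using assms by (meson UNIV_I)
  have "\<bar>\<Phi> (z + v) - \<Phi> z - D\<Phi> z \<bullet> v\<bar> \<le> e * norm v" if "norm v < d" for z v
  proof -
    have "norm (\<Phi> (z + v) - \<Phi> z - D\<Phi> z \<bullet> ((z + v) - z)) \<le> norm ((z + v) - z) * e"
    proof (rule differentiable_bound_linearization[where S = "ball z d" and f' = "\<lambda>x v. D\<Phi> x \<bullet> v" and ?x0.0 = z])
      show "z + t *\<^sub>R (z + v - z) \<in> ball z d" if "t \<in> {0..1}" for t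
      proof -
        have "norm (t *\<^sub>R v) \<le> norm v" using that by (simp add: mult_left_le_one_le)
        then show ?thesis using \<open>norm v < d\<close> by (simp add: dist_norm)
      qed
      show "(\<Phi> has_derivative (\<lambda>v. D\<Phi> x \<bullet> v)) (at x within ball z d)" for x
        using kernel_has_derivative has_derivative_at_withinI by blast
      show "onorm ((\<lambda>v. D\<Phi> x \<bullet> v) - (\<lambda>v. D\<Phi> z \<bullet> v)) \<le> e" if "x \<in> ball z d" for x
      proof (rule onorm_le)
        fix v
        have "norm (((\<lambda>v. D\<Phi> x \<bullet> v) - (\<lambda>v. D\<Phi> z \<bullet> v)) v) = \<bar>(D\<Phi> x - D\<Phi> z) \<bullet> v\<bar>"
          by (simp add: inner_diff_left)
        also have "\<dots> \<le> norm (D\<Phi> x - D\<Phi> z) * norm v" by (rule Cauchy_Schwarz_ineq2)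
        also have "\<dots> \<le> e * norm v"
          using d(2)[of x z] that by (intro mult_right_mono) (auto simp: dist_norm norm_minus_commute)
        finally show "norm (((\<lambda>v. D\<Phi> x \<bullet> v) - (\<lambda>v. D\<Phi> z \<bullet> v)) v) \<le> e * norm v" .
      qed
    qed (use d(1) in simp)
    then show ?thesis by (simp add: mult.commute)
  qed
  then show thesis using that d(1) by blast
qed

lemma norm_integral_over_ball_le:
  fixes f :: "real^'n \<Rightarrow> 'b::{banach, second_countable_topology}"
  assumes "integrable lborel f" "\<And>y. norm (f y) \<le> C * indicator (cball x r) y" 
  shows "norm (\<integral>y. f y \<partial>lborel) \<le> C * measure lborel (cball x r)"
proof -
  have i: "integrable lborel (indicator (cball x r) :: real^'n \<Rightarrow> real)"
    by (rule integrable_real_indicator) (use emeasure_bounded_finite in \<open>auto simp flip: infinity_ennreal_def\<close>)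
  have "norm (\<integral>y. f y \<partial>lborel) \<le> (\<integral>y. C * indicator (cball x r) y \<partial>lborel)"
    by (rule Bochner_Integration.integral_norm_bound_integral) (use assms i in auto)
  then show ?thesis by simp
qed

lemma measure_unit_cball: "measure lborel (cball (x::real^'n) 1) = ball_vol"
  unfolding ball_vol_def measure_def by (simp add: emeasure_cball)

lemma ball_vol_nonneg: "0 \<le> ball_vol" by (simp add: ball_vol_def)

lemma conv_weight_eq:
  assumes "sets V = sets (varifold_space D)"
  shows "conv_weight \<psi> \<epsilon> V y = (\<integral>z. \<Phi> (fst z - y) \<partial>V)"
  unfolding conv_weight_def weight_def
  by (rule integral_distr) (auto simp: measurable_fst_snd_varifold[OF assms])

lemma conv_first_variation_eq:
  "conv_first_variation \<psi> \<epsilon> V y = (\<integral>z. snd z *v D\<Phi> (fst z - y) \<partial>V)"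
  unfolding conv_first_variation_def by (intro Bochner_Integration.integral_cong refl) auto

section \<open>The approximate mean curvature of a varifold of bounded mass and support\<close>

context
  fixes V :: "((real^'n) \<times> (real^'n^'n)) measure" and R m :: real
  assumes bv: "bounded_varifold TYPE('d::finite) R m V" and m: "0 \<le> m"
begin

private lemma setsV: "sets V = sets (varifold_space TYPE('d))"
  using bv by (simp add: bounded_varifold_def)

interpretation finite_measure V by (rule bounded_varifold_finite[OF bv])

lemma AE_support: "AE z in V. norm (fst z) \<le> R"
  using bv by (simp add: bounded_varifold_def)

lemma space_snd: "z \<in> space V \<Longrightarrow> snd z \<in> grassmannian TYPE('d)"
  unfolding space_varifold[OF setsV] by auto

lemma measure_le: "measure V (space V) \<le> m"
  using bounded_varifold_mass[OF bv m] mass_eq[OF setsV] by simp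

lemma norm_integral_le:
  fixes f :: "(real^'n) \<times> (real^'n^'n) \<Rightarrow> 'b::{banach, second_countable_topology}"
  assumes "f \<in> borel_measurable V" "\<And>z. z \<in> space V \<Longrightarrow> norm (f z) \<le> C" "0 \<le> C"
  shows "integrable V f" "norm (\<integral>z. f z \<partial>V) \<le> C * m"
proof -
  show i: "integrable V f" by (rule integrable_const_bound[of _ C]) (use assms in auto)
  have "norm (\<integral>z. f z \<partial>V) \<le> (\<integral>z. C \<partial>V)"
    by (rule Bochner_Integration.integral_norm_bound_integral) (use assms i in auto)
  also have "\<dots> \<le> C * m" using mult_left_mono[OF measure_le assms(3)] by (simp add: mult.commute)
  finally show "norm (\<integral>z. f z \<partial>V) \<le> C * m" .
qed

lemma measurable_fst_V [measurable]: "fst \<in> borel_measurable V"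
  and measurable_snd_V [measurable]: "snd \<in> borel_measurable V"
  using measurable_fst_snd_varifold[OF setsV] by auto

lemma measurable_first_variation_integrand [measurable]:
  "(\<lambda>z. snd z *v D\<Phi> (fst z - y)) \<in> borel_measurable V"
  by (rule borel_measurable_matrix_vector) measurable

lemma norm_first_variation_integrand_le:
  assumes "z \<in> space V"
  shows "norm (snd z *v D\<Phi> x) \<le> B"
  using grassmannian_norm[OF space_snd[OF assms], of "D\<Phi> x"] norm_grad_kernel_le[of x] by simp

lemma conv_weight_nonneg: "0 \<le> conv_weight \<psi> \<epsilon> V y"
  unfolding conv_weight_eq[OF setsV] by (intro Bochner_Integration.integral_nonneg kernel_nonneg)

lemma conv_first_variation_le: "norm (conv_first_variation \<psi> \<epsilon> V y) \<le> B * m"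
  unfolding conv_first_variation_eq
  by (rule norm_integral_le) (use norm_first_variation_integrand_le B in auto)

lemma continuous_conv_weight: "continuous_on UNIV (conv_weight \<psi> \<epsilon> V)"
  unfolding conv_weight_eq[OF setsV, abs_def]
  by (rule continuous_on_integral_dominated[where w = "\<lambda>_. B"])
     (use kernel_nonneg kernel_le in \<open>auto intro!: continuous_intros\<close>)

lemma continuous_conv_first_variation: "continuous_on UNIV (conv_first_variation \<psi> \<epsilon> V)"
  unfolding conv_first_variation_eq[abs_def]
  by (rule continuous_on_integral_dominated[where w = "\<lambda>_. B"])
     (use norm_first_variation_integrand_le in \<open>auto intro!: continuous_intros\<close>)

text \<open>V is concentrated over the ball of radius R and the kernel has range 1. Thus
  \<open>h_tilde\<close> and the dissipation have compact support, and the integrals over y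
  converge.\<close>

lemma conv_first_variation_eq_0:
  assumes "R + 1 < norm y"
  shows "conv_first_variation \<psi> \<epsilon> V y = 0"
proof -
  have "AE z in V. snd z *v D\<Phi> (fst z - y) = 0"
    using AE_support
  proof eventually_elim
    case (elim z)
    then have "1 < norm (fst z - y)" using assms norm_triangle_ineq2[of y "fst z"] by (simp add: norm_minus_commute)
    then show ?case by (simp add: grad_kernel_eq_0)
  qed
  then have "(\<integral>z. snd z *v D\<Phi> (fst z - y) \<partial>V) = (\<integral>z. 0 \<partial>V)"
    by (intro integral_cong_AE) auto
  then show ?thesis unfolding conv_first_variation_eq by simp
qed

lemma denominator_pos: "0 < conv_weight \<psi> \<epsilon> V y + \<epsilon>"
  using conv_weight_nonneg eps by (simp add: add_nonneg_pos)

lemma continuous_dissipation: "continuous_on UNIV (dissipation \<psi> \<epsilon> V)"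
  unfolding dissipation_def[abs_def] using denominator_pos
  by (intro continuous_intros continuous_conv_weight continuous_conv_first_variation) (auto simp: less_imp_neq[THEN not_sym])

lemma dissipation_nonneg: "0 \<le> dissipation \<psi> \<epsilon> V y"
  unfolding dissipation_def using denominator_pos by (simp add: less_imp_le)

text \<open>The regularising \<epsilon> keeps the denominator away from 0. The right side knows V
  only through R and m, so it dominates a whole family of varifolds at once.\<close>

lemma dissipation_le: "dissipation \<psi> \<epsilon> V y \<le> (B * m)\<^sup>2 / \<epsilon> * indicator (cball 0 (R + 1)) y"
proof (cases "norm y \<le> R + 1")
  case True
  have "dissipation \<psi> \<epsilon> V y \<le> (B * m)\<^sup>2 / \<epsilon>"
    unfolding dissipation_def
    by (intro frac_le power_mono conv_first_variation_le) (use eps conv_weight_nonneg in auto)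
  then show ?thesis using True by simp
next
  case False
  then show ?thesis by (simp add: dissipation_def conv_first_variation_eq_0)
qed

lemma integrable_dissipation: "integrable lborel (dissipation \<psi> \<epsilon> V)"
  by (rule integrable_continuous_compact_support[OF continuous_dissipation, of "R + 1"])
     (simp add: dissipation_def conv_first_variation_eq_0)

lemma continuous_h_tilde: "continuous_on UNIV (h_tilde \<psi> \<epsilon> V)"
  unfolding h_tilde_def[abs_def] using denominator_pos
  by (intro continuous_intros continuous_conv_weight continuous_conv_first_variation) (auto simp: less_imp_neq[THEN not_sym])

lemma h_tilde_measurable [measurable]: "h_tilde \<psi> \<epsilon> V \<in> borel_measurable borel"
  by (intro borel_measurable_continuous_onI continuous_h_tilde)

lemma continuous_h_tilde_comp [continuous_intros]:
  "continuous_on T g \<Longrightarrow> continuous_on T (\<lambda>x. h_tilde \<psi> \<epsilon> V (g x))"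
  by (rule continuous_on_compose2[OF continuous_h_tilde]) auto

lemma norm_h_tilde_le: "norm (h_tilde \<psi> \<epsilon> V y) \<le> B * m / \<epsilon>"
proof -
  have "norm (h_tilde \<psi> \<epsilon> V y) = norm (conv_first_variation \<psi> \<epsilon> V y) / (conv_weight \<psi> \<epsilon> V y + \<epsilon>)"
    using denominator_pos[of y] by (simp add: h_tilde_def divide_inverse)
  also have "\<dots> \<le> B * m / \<epsilon>"
    by (intro frac_le conv_first_variation_le) (use eps conv_weight_nonneg B m in auto)
  finally show ?thesis .
qed

lemma h_tilde_eq_0: "R + 1 < norm y \<Longrightarrow> h_tilde \<psi> \<epsilon> V y = 0"
  by (simp add: h_tilde_def conv_first_variation_eq_0)

text \<open>Entry (i, j) is the partial derivative in direction j of the i-th component of the mean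
  curvature, with the differentiation moved onto the kernel.\<close>

definition curvature_deriv :: "real^'n \<Rightarrow> real^'n^'n" where
  "curvature_deriv x = (\<chi> i j. \<integral>y. D\<Phi> (x - y) $ j * h_tilde \<psi> \<epsilon> V y $ i \<partial>lborel)"

lemma integrable_h_integrand: "integrable lborel (\<lambda>y. \<Phi> (x - y) *\<^sub>R h_tilde \<psi> \<epsilon> V y)"
  by (rule integrable_continuous_compact_support[of _ "R + 1"])
     (auto intro!: continuous_intros simp: h_tilde_eq_0)

lemma integrable_deriv_integrand: "integrable lborel (\<lambda>y. D\<Phi> (x - y) $ j * h_tilde \<psi> \<epsilon> V y $ i)"
  by (rule integrable_continuous_compact_support[of _ "R + 1"])
     (auto intro!: continuous_intros simp: h_tilde_eq_0)

lemma integrable_deriv_integrand_vec: "integrable lborel (\<lambda>y. (D\<Phi> (x - y) \<bullet> v) *\<^sub>R h_tilde \<psi> \<epsilon> V y)"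
  by (rule integrable_continuous_compact_support[of _ "R + 1"])
     (auto intro!: continuous_intros simp: h_tilde_eq_0)

text \<open>The integral is confined to the unit ball around x, where the kernel lives, and not to
  the ball of radius R + 1 carrying \<open>h_tilde\<close>. The bound is thus free of R, and the
  same constants serve every step although supports spread.\<close>

lemma norm_approx_mean_curvature_le:
  "norm (approx_mean_curvature \<psi> \<epsilon> V x) \<le> B * (B * m / \<epsilon>) * ball_vol"
  unfolding approx_mean_curvature_def measure_unit_cball[of x, symmetric]
proof (rule norm_integral_over_ball_le[OF integrable_h_integrand])
  fix y
  show "norm (\<Phi> (x - y) *\<^sub>R h_tilde \<psi> \<epsilon> V y) \<le> B * (B * m / \<epsilon>) * indicator (cball x 1) y"
  proof (cases "norm (x - y) \<le> 1")
    case True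
    have "norm (\<Phi> (x - y) *\<^sub>R h_tilde \<psi> \<epsilon> V y) \<le> B * (B * m / \<epsilon>)"
      unfolding norm_scaleR
      by (intro mult_mono norm_h_tilde_le) (use kernel_le[of "x - y"] kernel_nonneg[of "x - y"] B in auto)
    then show ?thesis using True by (simp add: dist_norm)
  qed (simp add: kernel_eq_0 dist_norm)
qed

lemma curvature_deriv_entry_le:
  "\<bar>curvature_deriv x $ i $ j\<bar> \<le> B * (B * m / \<epsilon>) * ball_vol"
proof -
  have "norm (\<integral>y. D\<Phi> (x - y) $ j * h_tilde \<psi> \<epsilon> V y $ i \<partial>lborel) \<le> B * (B * m / \<epsilon>) * measure lborel (cball x 1)"
  proof (rule norm_integral_over_ball_le[OF integrable_deriv_integrand])
    fix y
    show "norm (D\<Phi> (x - y) $ j * h_tilde \<psi> \<epsilon> V y $ i) \<le> B * (B * m / \<epsilon>) * indicator (cball x 1) y"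
    proof (cases "norm (x - y) \<le> 1")
      case True
      have "\<bar>D\<Phi> (x - y) $ j\<bar> \<le> B" "\<bar>h_tilde \<psi> \<epsilon> V y $ i\<bar> \<le> B * m / \<epsilon>"
        by (meson component_le_norm_cart order.trans norm_grad_kernel_le norm_h_tilde_le)+
      then have "norm (D\<Phi> (x - y) $ j * h_tilde \<psi> \<epsilon> V y $ i) \<le> B * (B * m / \<epsilon>)"
        unfolding real_norm_def abs_mult by (intro mult_mono) (use B in auto)
      then show ?thesis using True by (simp add: dist_norm)
    qed (simp add: grad_kernel_eq_0 dist_norm)
  qed
  then show ?thesis by (simp add: curvature_deriv_def measure_unit_cball)
qed

lemma norm_curvature_deriv_le:
  "norm (curvature_deriv x) \<le> real CARD('n) * real CARD('n) * (B * (B * m / \<epsilon>) * ball_vol)"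
  by (intro norm_matrix_le_sum curvature_deriv_entry_le)

text \<open>The majorant must serve all x simultaneously, so here it is taken on the ball carrying
  \<open>h_tilde\<close>.\<close>

lemma continuous_curvature_deriv: "continuous_on UNIV curvature_deriv"
proof (rule continuous_on_matrixI)
  fix i j
  have "integrable lborel (\<lambda>y. B * (B * m / \<epsilon>) * indicator (cball 0 (R + 1)) y)"
    by (intro integrable_mult_right integrable_real_indicator) (use emeasure_bounded_finite in \<open>auto simp flip: infinity_ennreal_def\<close>)
  then have "continuous_on UNIV (\<lambda>x. \<integral>y. D\<Phi> (x - y) $ j * h_tilde \<psi> \<epsilon> V y $ i \<partial>lborel)"
  proof (rule continuous_on_integral_dominated[rotated])
    fix x y
    show "norm (D\<Phi> (x - y) $ j * h_tilde \<psi> \<epsilon> V y $ i) \<le> B * (B * m / \<epsilon>) * indicator (cball 0 (R + 1)) y"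
    proof (cases "norm y \<le> R + 1")
      case True
      have "\<bar>D\<Phi> (x - y) $ j\<bar> \<le> B" "\<bar>h_tilde \<psi> \<epsilon> V y $ i\<bar> \<le> B * m / \<epsilon>"
        by (meson component_le_norm_cart order.trans norm_grad_kernel_le norm_h_tilde_le)+
      then have "norm (D\<Phi> (x - y) $ j * h_tilde \<psi> \<epsilon> V y $ i) \<le> B * (B * m / \<epsilon>)"
        unfolding real_norm_def abs_mult by (intro mult_mono) (use B in auto)
      then show ?thesis using True by simp
    qed (simp add: h_tilde_eq_0)
  qed (use integrable_deriv_integrand in \<open>auto intro!: continuous_intros\<close>)
  then show "continuous_on UNIV (\<lambda>x. curvature_deriv x $ i $ j)"
    by (simp add: curvature_deriv_def)
qed

lemma curvature_deriv_mult:
  "curvature_deriv x *v v = (\<integral>y. (D\<Phi> (x - y) \<bullet> v) *\<^sub>R h_tilde \<psi> \<epsilon> V y \<partial>lborel)"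
proof (subst vec_eq_iff, intro allI)
  fix i
  have "(\<integral>y. (D\<Phi> (x - y) \<bullet> v) *\<^sub>R h_tilde \<psi> \<epsilon> V y \<partial>lborel) $ i
      = (\<integral>y. ((D\<Phi> (x - y) \<bullet> v) *\<^sub>R h_tilde \<psi> \<epsilon> V y) $ i \<partial>lborel)"
    by (rule integral_bounded_linear[OF bounded_linear_vec_nth integrable_deriv_integrand_vec, symmetric])
  also have "\<dots> = (\<integral>y. (\<Sum>j\<in>UNIV. (D\<Phi> (x - y) $ j * h_tilde \<psi> \<epsilon> V y $ i) * v $ j) \<partial>lborel)"
    by (simp add: inner_vec_def sum_distrib_left sum_distrib_right algebra_simps)
  also have "\<dots> = (\<Sum>j\<in>UNIV. (\<integral>y. D\<Phi> (x - y) $ j * h_tilde \<psi> \<epsilon> V y $ i \<partial>lborel) * v $ j)"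
    by (subst Bochner_Integration.integral_sum) (auto intro!: integrable_mult_left integrable_deriv_integrand)
  also have "\<dots> = (curvature_deriv x *v v) $ i"
    by (simp add: matrix_vector_mult_def curvature_deriv_def)
  finally show "(curvature_deriv x *v v) $ i = (\<integral>y. (D\<Phi> (x - y) \<bullet> v) *\<^sub>R h_tilde \<psi> \<epsilon> V y \<partial>lborel) $ i" ..
qed

text \<open>The linearisation error of the kernel is uniform in y by
  \<open>kernel_linearization\<close>, hence survives integration against the bounded, compactly
  supported \<open>h_tilde\<close>.\<close>

lemma approx_mean_curvature_has_derivative:
  "(approx_mean_curvature \<psi> \<epsilon> V has_derivative ((*v) (curvature_deriv x))) (at x)"
  unfolding has_derivative_at_alt
proof (intro conjI allI impI matrix_vector_mul_bounded_linear)
  let ?h = "h_tilde \<psi> \<epsilon> V" and ?vol = "measure lborel (cball (0::real^'n) (R + 1))"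
  fix e :: real assume e: "0 < e"
  \<comment> \<open>The product bounds the integral of the norm of \<open>h_tilde\<close>; the
    summand 1 makes it positive, so that \<open>e / C\<close> is a usable tolerance.\<close>
  define C where "C = (B * m / \<epsilon>) * ?vol + 1"
  have "0 \<le> B * m / \<epsilon>" using B m eps by simp
  then have C: "0 < C" unfolding C_def by (intro add_nonneg_pos mult_nonneg_nonneg) auto
  obtain d where d: "0 < d" "\<And>z v. norm v < d \<Longrightarrow> \<bar>\<Phi> (z + v) - \<Phi> z - D\<Phi> z \<bullet> v\<bar> \<le> (e / C) * norm v"
    using kernel_linearization[of "e / C"] e C by auto
  show "\<exists>d>0. \<forall>y. norm (y - x) < d \<longrightarrow> norm (approx_mean_curvature \<psi> \<epsilon> V y - approx_mean_curvature \<psi> \<epsilon> V x - curvature_deriv x *v (y - x))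
      \<le> e * norm (y - x)"
  proof (intro exI[of _ d] conjI allI impI d(1))
    fix z assume z: "norm (z - x) < d"
    let ?f = "\<lambda>y. (\<Phi> (z - y) - \<Phi> (x - y) - D\<Phi> (x - y) \<bullet> (z - x)) *\<^sub>R ?h y"
    have f: "?f = (\<lambda>y. \<Phi> (z - y) *\<^sub>R ?h y - \<Phi> (x - y) *\<^sub>R ?h y - (D\<Phi> (x - y) \<bullet> (z - x)) *\<^sub>R ?h y)"
      by (simp add: scaleR_left_diff_distrib)
    have i: "integrable lborel ?f" unfolding f
      by (intro Bochner_Integration.integrable_diff integrable_h_integrand integrable_deriv_integrand_vec)
    have "approx_mean_curvature \<psi> \<epsilon> V z - approx_mean_curvature \<psi> \<epsilon> V x - curvature_deriv x *v (z - x)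
        = (\<integral>y. ?f y \<partial>lborel)"
      unfolding f approx_mean_curvature_def curvature_deriv_mult
      by (simp add: integrable_h_integrand integrable_deriv_integrand_vec)
    also have "norm (\<integral>y. ?f y \<partial>lborel) \<le> ((e / C) * norm (z - x) * (B * m / \<epsilon>)) * ?vol"
    proof (rule norm_integral_over_ball_le[OF i])
      fix y
      show "norm (?f y) \<le> (e / C) * norm (z - x) * (B * m / \<epsilon>) * indicator (cball 0 (R + 1)) y"
      proof (cases "norm y \<le> R + 1")
        case True
        have "norm (?f y) \<le> ((e / C) * norm (z - x)) * (B * m / \<epsilon>)"
          unfolding norm_scaleR real_norm_def
          using d(2)[OF z, of "x - y"] e C by (intro mult_mono norm_h_tilde_le) auto
        then show ?thesis using True by simp
      qed (simp add: h_tilde_eq_0)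
    qed
    also have "\<dots> = (e * norm (z - x)) * (((B * m / \<epsilon>) * ?vol) / C)"
      by (simp add: algebra_simps)
    also have "\<dots> \<le> (e * norm (z - x)) * 1"
    proof (rule mult_left_mono)
      have "(B * m / \<epsilon>) * ?vol \<le> C" unfolding C_def by linarith
      then show "((B * m / \<epsilon>) * ?vol) / C \<le> 1" using divide_le_eq_1_pos[OF C] by blast
    qed (use e in simp)
    finally show "norm (approx_mean_curvature \<psi> \<epsilon> V z - approx_mean_curvature \<psi> \<epsilon> V x - curvature_deriv x *v (z - x))
      \<le> e * norm (z - x)" by simp
  qed
qed

text \<open>Moving the symmetric S onto the gradient produces the integrand of
  \<open>conv_first_variation\<close>.\<close>

lemma trace_curvature_deriv:
  assumes "S \<in> grassmannian TYPE('d)"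
  shows "trace (curvature_deriv x ** S) = (\<integral>y. (S *v D\<Phi> (x - y)) \<bullet> h_tilde \<psi> \<epsilon> V y \<partial>lborel)"
proof -
  have S: "S $ i $ j = S $ j $ i" for i j
    using grassmannian_transpose[OF assms] by (metis transpose_def vec_lambda_beta)
  have "(\<integral>y. (S *v D\<Phi> (x - y)) \<bullet> h_tilde \<psi> \<epsilon> V y \<partial>lborel)
      = (\<integral>y. (\<Sum>i\<in>UNIV. \<Sum>j\<in>UNIV. (D\<Phi> (x - y) $ j * h_tilde \<psi> \<epsilon> V y $ i) * S $ i $ j) \<partial>lborel)"
    by (simp add: inner_vec_def matrix_vector_mult_def sum_distrib_left sum_distrib_right algebra_simps)
  also have "\<dots> = (\<Sum>i\<in>UNIV. \<Sum>j\<in>UNIV. (\<integral>y. D\<Phi> (x - y) $ j * h_tilde \<psi> \<epsilon> V y $ i \<partial>lborel) * S $ i $ j)"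
    by (simp add: Bochner_Integration.integral_sum Bochner_Integration.integrable_sum integrable_deriv_integrand)
  also have "\<dots> = trace (curvature_deriv x ** S)"
    by (simp add: trace_def matrix_matrix_mult_def curvature_deriv_def S)
  finally show ?thesis ..
qed

text \<open>This is the point of smoothing twice: Fubini transfers the outer convolution of h to V,
  where it yields the smoothed first variation, and \<open>h_tilde\<close> is minus that vector over
  the regularised density. Both convolutions evaluate the kernel at x - y, so no reflection
  intervenes.\<close>

lemma integral_trace_curvature_deriv:
  "(\<integral>z. trace (curvature_deriv (fst z) ** snd z) \<partial>V) = - (\<integral>y. dissipation \<psi> \<epsilon> V y \<partial>lborel)"
proof -
  let ?h = "h_tilde \<psi> \<epsilon> V"
  let ?f = "\<lambda>z y. (snd z *v D\<Phi> (fst z - y)) \<bullet> ?h y"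
  interpret P: pair_sigma_finite V lborel by standard
  have "(\<lambda>w. snd (fst w) *v D\<Phi> (fst (fst w) - snd w)) \<in> borel_measurable (V \<Otimes>\<^sub>M lborel)"
    by (rule borel_measurable_matrix_vector) measurable
  then have meas: "case_prod ?f \<in> borel_measurable (V \<Otimes>\<^sub>M lborel)"
    unfolding case_prod_beta by measurable
  \<comment> \<open>V is finite and \<open>h_tilde\<close> vanishes outside the ball, so a constant
    on this product set dominates the integrand.\<close>
  let ?E = "space V \<times> cball (0::real^'n) (R + 1)"
  have "emeasure (V \<Otimes>\<^sub>M lborel) ?E = emeasure V (space V) * emeasure lborel (cball (0::real^'n) (R + 1))"
    by (rule lborel.emeasure_pair_measure_Times) auto
  also have "\<dots> < \<infinity>"
    using emeasure_bounded_finite[OF bounded_cball, of "0::real^'n" "R + 1"]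
    by (simp add: ennreal_mult_less_top emeasure_eq_measure)
  finally have iE: "integrable (V \<Otimes>\<^sub>M lborel) (\<lambda>w. B * (B * m / \<epsilon>) * indicator ?E w)"
    by (intro integrable_mult_right integrable_real_indicator) auto
  have "integrable (V \<Otimes>\<^sub>M lborel) (case_prod ?f)"
  proof (rule Bochner_Integration.integrable_bound[OF iE meas], rule AE_I2)
    fix w :: "((real^'n) \<times> (real^'n^'n)) \<times> (real^'n)" assume "w \<in> space (V \<Otimes>\<^sub>M lborel)"
    then obtain z y where w: "w = (z, y)" "z \<in> space V" by (auto simp: space_pair_measure)
    show "norm (case_prod ?f w) \<le> norm (B * (B * m / \<epsilon>) * indicator ?E w)"
    proof (cases "norm y \<le> R + 1")
      case True
      have "\<bar>?f z y\<bar> \<le> norm (snd z *v D\<Phi> (fst z - y)) * norm (?h y)" by (rule Cauchy_Schwarz_ineq2)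
      also have "\<dots> \<le> B * (B * m / \<epsilon>)"
        by (intro mult_mono norm_h_tilde_le norm_first_variation_integrand_le w) (use B in auto)
      finally show ?thesis using True w B m eps by (simp add: abs_mult)
    qed (simp add: w h_tilde_eq_0)
  qed
  then have "(\<integral>y. (\<integral>z. ?f z y \<partial>V) \<partial>lborel) = (\<integral>z. (\<integral>y. ?f z y \<partial>lborel) \<partial>V)"
    by (rule P.Fubini_integral)
  also have "\<dots> = (\<integral>z. trace (curvature_deriv (fst z) ** snd z) \<partial>V)"
    by (intro Bochner_Integration.integral_cong refl) (simp add: trace_curvature_deriv space_snd)
  finally have "(\<integral>z. trace (curvature_deriv (fst z) ** snd z) \<partial>V) = (\<integral>y. (\<integral>z. ?f z y \<partial>V) \<partial>lborel)" ..
  also have "\<dots> = (\<integral>y. - dissipation \<psi> \<epsilon> V y \<partial>lborel)"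
  proof (intro Bochner_Integration.integral_cong refl)
    fix y
    have "integrable V (\<lambda>z. snd z *v D\<Phi> (fst z - y))"
      by (rule norm_integral_le(1)[where C = B]) (use norm_first_variation_integrand_le B in auto)
    then have "(\<integral>z. ?f z y \<partial>V) = conv_first_variation \<psi> \<epsilon> V y \<bullet> ?h y"
      unfolding conv_first_variation_eq by (intro integral_inner_left) auto
    also have "\<dots> = - dissipation \<psi> \<epsilon> V y"
      by (simp add: h_tilde_def dissipation_def power2_norm_eq_inner divide_inverse)
    finally show "(\<integral>z. ?f z y \<partial>V) = - dissipation \<psi> \<epsilon> V y" .
  qed
  finally show ?thesis by simp
qed

end

end

section \<open>One Euler step\<close>

text \<open>The trace is a sum over a frame of d unit vectors, each contributing at most
  \<open>norm A\<close>.\<close>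

lemma abs_trace_mult_le:
  fixes A S :: "real^'n^'n"
  assumes "S \<in> grassmannian TYPE('d::finite)"
  shows "\<bar>trace (A ** S)\<bar> \<le> real CARD('d) * norm A"
proof -
  obtain s :: "real^'d^'n" where s: "s \<in> stiefel" "S = s ** transpose s" using grassmannianE[OF assms] by metis
  have "\<bar>column i s \<bullet> (A *v column i s)\<bar> \<le> norm A" for i
  proof -
    have "(transpose s ** s) $ i $ i = column i s \<bullet> column i s"
      by (simp add: matrix_matrix_mult_def transpose_def column_def inner_vec_def)
    then have n: "norm (column i s) = 1" using s(1) by (simp add: stiefel_def mat_def norm_eq_1)
    show ?thesis
      using Cauchy_Schwarz_ineq2[of "column i s" "A *v column i s"] norm_matrix_vector_le[of A "column i s"]
      by (simp add: n)
  qed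
  then have "(\<Sum>i\<in>UNIV. \<bar>column i s \<bullet> (A *v column i s)\<bar>) \<le> real CARD('d) * norm A"
    by (rule sum_bounded_above)
  then show ?thesis unfolding s(2) trace_frame[symmetric] by (rule order.trans[OF sum_abs])
qed

text \<open>The constants of the Jacobian expansion, tied to d and n only. The bounds 0 and 2 make
  the density of a push-forward nonnegative and bounded.\<close>

definition jacobian_bounds :: "'d::finite itself \<Rightarrow> 'n::finite itself \<Rightarrow> real \<Rightarrow> real \<Rightarrow> bool" where
  "jacobian_bounds D N K a \<longleftrightarrow> 0 < K \<and> 0 < a \<and> a \<le> 1/2 \<and>
    (\<forall>(A::real^'n^'n) S. S \<in> grassmannian D \<and> norm A \<le> a \<longrightarrow>
      \<bar>jac D (mat 1 + A) S - 1 - trace (A ** S)\<bar> \<le> K * (norm A)\<^sup>2 \<and>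
      \<bar>jac D (mat 1 + A) S - 1\<bar> \<le> K * norm A \<and>
      0 \<le> jac D (mat 1 + A) S \<and> jac D (mat 1 + A) S \<le> 2)"

lemma ex_jacobian_bounds: "\<exists>K a. jacobian_bounds TYPE('d::finite) TYPE('n::finite) K a"
proof -
  obtain K a where K: "0 < K" "0 < a" "a \<le> 1/2"
    "\<And>(A::real^'n^'n) S. S \<in> grassmannian TYPE('d) \<Longrightarrow> norm A \<le> a
      \<Longrightarrow> \<bar>jac TYPE('d) (mat 1 + A) S - 1 - trace (A ** S)\<bar> \<le> K * (norm A)\<^sup>2"
    using jac_expansion[where 'd='d and 'n='n] by metis
  \<comment> \<open>The trace term is at most d * norm A, hence the summand d.\<close>
  define K' where "K' = real CARD('d) + K"
  have K': "0 < K'" unfolding K'_def using K(1) by simp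
  \<comment> \<open>The second entry of the minimum forces |J - 1| <= 1, hence 0 <= J <= 2.\<close>
  define a' where "a' = min a (1 / K')"
  have "\<bar>jac TYPE('d) (mat 1 + A) S - 1 - trace (A ** S)\<bar> \<le> K' * (norm A)\<^sup>2 \<and>
      \<bar>jac TYPE('d) (mat 1 + A) S - 1\<bar> \<le> K' * norm A \<and>
      0 \<le> jac TYPE('d) (mat 1 + A) S \<and> jac TYPE('d) (mat 1 + A) S \<le> 2"
    if S: "S \<in> grassmannian TYPE('d)" and A: "norm A \<le> a'" for A S :: "real^'n^'n"
  proof -
    let ?J = "jac TYPE('d) (mat 1 + A) S"
    have 1: "\<bar>?J - 1 - trace (A ** S)\<bar> \<le> K * (norm A)\<^sup>2" using K(4) S A by (simp add: a'_def)
    have n1: "norm A \<le> 1" using A K(3) by (simp add: a'_def)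
    have "K * (norm A)\<^sup>2 \<le> K * norm A"
      using n1 K(1) by (simp add: power2_eq_square mult_left_le_one_le)
    then have 2: "\<bar>?J - 1\<bar> \<le> K' * norm A"
      using 1 abs_trace_mult_le[OF S, of A] unfolding K'_def distrib_right by linarith
    have "K' * norm A \<le> K' * (1 / K')" using A K' by (intro mult_left_mono) (auto simp: a'_def)
    then have 3: "\<bar>?J - 1\<bar> \<le> 1" using 2 K' by simp
    have "K * (norm A)\<^sup>2 \<le> K' * (norm A)\<^sup>2" by (intro mult_right_mono) (auto simp: K'_def)
    then show ?thesis using 1 2 3 by auto
  qed
  moreover have "0 < a'" "a' \<le> 1/2" using K K' by (auto simp: a'_def)
  ultimately show ?thesis unfolding jacobian_bounds_def using K' by blast
qed

context mollifier
begin

text \<open>Bounds on the velocity and on the norm of its derivative at mass at most m; neither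
  mentions the radius of the support.\<close>

definition "h_bound m = B * (B * m / \<epsilon>) * ball_vol"
definition "deriv_bound m = real CARD('n) * real CARD('n) * h_bound m"

lemma h_bound_nonneg: "0 \<le> m \<Longrightarrow> 0 \<le> h_bound m" "0 \<le> m \<Longrightarrow> 0 \<le> deriv_bound m"
  using B eps ball_vol_nonneg by (auto simp: h_bound_def deriv_bound_def)

section \<open>Jacobian, mass, support and convolutions under a single step\<close>

context
  fixes V W :: "((real^'n) \<times> (real^'n^'n)) measure" and R m K a \<tau> :: real
    and f :: "real^'n \<Rightarrow> real^'n" and A :: "real^'n \<Rightarrow> real^'n^'n"
    and J :: "(real^'n) \<times> (real^'n^'n) \<Rightarrow> real"
    and T :: "(real^'n) \<times> (real^'n^'n) \<Rightarrow> (real^'n) \<times> (real^'n^'n)"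
  assumes bv: "bounded_varifold TYPE('d::finite) R m V" and m: "0 \<le> m"
    and jb: "jacobian_bounds TYPE('d) TYPE('n) K a"
    and tau: "0 \<le> \<tau>" "\<tau> * deriv_bound m \<le> a"
  defines f_def: "f \<equiv> \<lambda>x. x + \<tau> *\<^sub>R approx_mean_curvature \<psi> \<epsilon> V x"
    and A_def: "A \<equiv> \<lambda>x. \<tau> *\<^sub>R curvature_deriv V x"
    and J_def: "J \<equiv> \<lambda>z. tangential_jacobian TYPE('d) f (fst z) (snd z)"
    and T_def: "T \<equiv> \<lambda>z. (f (fst z), push_plane f (fst z) (snd z))"
    and W_def: "W \<equiv> euler_step TYPE('d) \<psi> \<epsilon> \<tau> V"
begin

private lemma sets_source: "sets V = sets (varifold_space TYPE('d))"
  using bv by (simp add: bounded_varifold_def)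

interpretation finite_measure V by (rule bounded_varifold_finite[OF bv])

private lemma W_eq: "W = distr (density V (\<lambda>z. ennreal (J z))) (varifold_space TYPE('d)) T"
  unfolding W_def euler_step_def push_forward_def J_def T_def f_def case_prod_beta by (simp add: prod_eq_iff)

private lemma norm_A: "norm (A x) \<le> \<tau> * deriv_bound m" "norm (A x) \<le> a" "norm (A x) \<le> 1/2"
proof -
  show 1: "norm (A x) \<le> \<tau> * deriv_bound m"
    using mult_left_mono[OF norm_curvature_deriv_le[OF bv m, of x] tau(1)] tau(1)
    by (simp add: A_def deriv_bound_def h_bound_def)
  then show "norm (A x) \<le> a" "norm (A x) \<le> 1/2" using tau(2) jb by (auto simp: jacobian_bounds_def)
qed

private lemma norm_f_minus: "norm (f x - x) \<le> \<tau> * h_bound m"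
  using mult_left_mono[OF norm_approx_mean_curvature_le[OF bv m, of x] tau(1)] tau(1)
  by (simp add: f_def h_bound_def)

private lemma f_deriv: "frechet_derivative f (at x) = (*v) (mat 1 + A x)"
proof -
  have "(f has_derivative (\<lambda>v. v + \<tau> *\<^sub>R (curvature_deriv V x *v v))) (at x)"
    unfolding f_def
    by (intro has_derivative_add has_derivative_ident has_derivative_scaleR_right
        approx_mean_curvature_has_derivative[OF bv m])
  then have "frechet_derivative f (at x) = (\<lambda>v. v + \<tau> *\<^sub>R (curvature_deriv V x *v v))"
    by (rule frechet_derivative_at[symmetric])
  then show ?thesis by (simp add: A_def fun_eq_iff matrix_vector_mult_add_rdistrib scaleR_matrix_vector_assoc)
qed

private lemma expansive_A: "expansive (mat 1 + A x)"
  by (rule expansive_perturbation[OF norm_A(3)])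

private lemma push_eq: "push_plane f x S = push_matrix (mat 1 + A x) S"
  unfolding push_plane_def push_matrix_def f_deriv ..

private lemma snd_space: "z \<in> space V \<Longrightarrow> snd z \<in> grassmannian TYPE('d)"
  unfolding space_varifold[OF sets_source] by auto

private lemma J_eq: "z \<in> space V \<Longrightarrow> J z = jac TYPE('d) (mat 1 + A (fst z)) (snd z)"
  unfolding J_def by (rule tangential_jacobian_eq_jac[OF snd_space f_deriv])

private lemma J_bounds:
  assumes "z \<in> space V"
  shows "\<bar>J z - 1 - \<tau> * trace (curvature_deriv V (fst z) ** snd z)\<bar> \<le> K * (\<tau> * deriv_bound m)\<^sup>2"
    "\<bar>J z - 1\<bar> \<le> K * (\<tau> * deriv_bound m)" "0 \<le> J z" "J z \<le> 2"
proof -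
  have K: "0 < K" using jb by (simp add: jacobian_bounds_def)
  have *: "\<bar>J z - 1 - trace (A (fst z) ** snd z)\<bar> \<le> K * (norm (A (fst z)))\<^sup>2 \<and>
      \<bar>J z - 1\<bar> \<le> K * norm (A (fst z)) \<and> 0 \<le> J z \<and> J z \<le> 2"
    using jb snd_space[OF assms] norm_A(2)[of "fst z"] unfolding J_eq[OF assms] jacobian_bounds_def by blast
  then show "0 \<le> J z" "J z \<le> 2" by auto
  have "trace (A (fst z) ** snd z) = \<tau> * trace (curvature_deriv V (fst z) ** snd z)"
    by (simp add: A_def trace_def matrix_matrix_mult_def sum_distrib_left mult.assoc)
  moreover have "K * (norm (A (fst z)))\<^sup>2 \<le> K * (\<tau> * deriv_bound m)\<^sup>2"
    using K by (intro mult_left_mono power_mono norm_A) auto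
  ultimately show "\<bar>J z - 1 - \<tau> * trace (curvature_deriv V (fst z) ** snd z)\<bar> \<le> K * (\<tau> * deriv_bound m)\<^sup>2"
    using * by linarith
  have "K * norm (A (fst z)) \<le> K * (\<tau> * deriv_bound m)" using K by (intro mult_left_mono norm_A) auto
  then show "\<bar>J z - 1\<bar> \<le> K * (\<tau> * deriv_bound m)" using * by linarith
qed

private lemma cont_A: "continuous_on S g \<Longrightarrow> continuous_on S (\<lambda>z. mat 1 + A (g z))"
  unfolding A_def
  by (intro continuous_intros continuous_on_compose2[OF continuous_curvature_deriv[OF bv m]]) auto

private lemma J_measurable [measurable]: "J \<in> borel_measurable V"
proof (rule measurable_cong[THEN iffD2, OF J_eq])
  \<comment> \<open>The pair is written out so that the map is literally a composition with the
    function of \<open>continuous_on_jac\<close>.\<close>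
  have "continuous_on (UNIV \<times> grassmannian TYPE('d)) (\<lambda>z. jac TYPE('d) (fst (mat 1 + A (fst z), snd z)) (snd (mat 1 + A (fst z), snd z)))"
    by (rule continuous_on_compose2[OF continuous_on_jac])
       (auto intro!: continuous_on_Pair cont_A continuous_intros)
  then show "(\<lambda>z. jac TYPE('d) (mat 1 + A (fst z)) (snd z)) \<in> borel_measurable V"
    by (intro measurable_continuous_on_varifold[OF sets_source]) simp
qed

private lemma T_in: "z \<in> UNIV \<times> grassmannian TYPE('d) \<Longrightarrow> T z \<in> UNIV \<times> grassmannian TYPE('d)"
  unfolding T_def push_eq by (auto intro!: push_matrix_in_grassmannian expansive_A)

text \<open>Without measurability of \<open>T\<close> the image measure would be the junk value \<open>0\<close>.\<close>

private lemma T_measurable [measurable]: "T \<in> V \<rightarrow>\<^sub>M varifold_space TYPE('d)"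
  unfolding varifold_space_def
proof (rule measurable_restrict_space2)
  show "T \<in> space V \<rightarrow> UNIV \<times> grassmannian TYPE('d)"
    unfolding space_varifold[OF sets_source] using T_in by blast
  have h: "continuous_on UNIV (approx_mean_curvature \<psi> \<epsilon> V)"
    using has_derivative_continuous[OF approx_mean_curvature_has_derivative[OF bv m]]
    by (simp add: continuous_on_eq_continuous_at)
  have "continuous_on (UNIV \<times> grassmannian TYPE('d)) (\<lambda>z :: (real^'n) \<times> (real^'n^'n). f (fst z))"
    unfolding f_def by (intro continuous_intros continuous_on_compose2[OF h]) auto
  moreover have "continuous_on (UNIV \<times> grassmannian TYPE('d))
      (\<lambda>z :: (real^'n) \<times> (real^'n^'n). push_matrix (fst (mat 1 + A (fst z), snd z)) (snd (mat 1 + A (fst z), snd z)))"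
    by (rule continuous_on_compose2[OF continuous_on_push_matrix[where 'd='d]])
       (auto intro!: continuous_on_Pair cont_A continuous_intros expansive_A)
  ultimately have "continuous_on (UNIV \<times> grassmannian TYPE('d)) T"
    unfolding T_def push_eq by (intro continuous_on_Pair) auto
  then show "T \<in> borel_measurable V" by (rule measurable_continuous_on_varifold[OF sets_source])
qed

lemma sets_euler_step: "sets W = sets (varifold_space TYPE('d))"
  unfolding W_eq by simp

private lemma integral_W:
  fixes \<phi> :: "(real^'n) \<times> (real^'n^'n) \<Rightarrow> 'b::{banach, second_countable_topology}"
  assumes "\<phi> \<in> borel_measurable (varifold_space TYPE('d))"
  shows "(\<integral>z. \<phi> z \<partial>W) = (\<integral>z. J z *\<^sub>R \<phi> (T z) \<partial>V)"
proof -
  have "(\<integral>z. \<phi> z \<partial>W) = (\<integral>z. \<phi> (T z) \<partial>density V (\<lambda>z. ennreal (J z)))"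
    unfolding W_eq by (rule integral_distr[OF _ assms]) simp
  also have "\<dots> = (\<integral>z. J z *\<^sub>R \<phi> (T z) \<partial>V)"
    by (rule integral_density) (use measurable_compose[OF T_measurable assms] J_bounds in \<open>auto intro!: AE_I2\<close>)
  finally show ?thesis .
qed

private lemma integrable_J: "integrable V J"
  by (rule integrable_const_bound[of _ 2]) (use J_bounds in \<open>auto intro!: AE_I2\<close>)

private lemma emeasure_W: "emeasure W (space W) = ennreal (\<integral>z. J z \<partial>V)"
proof -
  have "T -` space (varifold_space TYPE('d)) \<inter> space V = space V"
    using measurable_space[OF T_measurable] by auto
  then have "emeasure W (space W) = (\<integral>\<^sup>+z. ennreal (J z) \<partial>V)"
    unfolding W_eq
    by (simp add: emeasure_distr emeasure_density cong: nn_integral_cong)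
  also have "\<dots> = ennreal (\<integral>z. J z \<partial>V)"
    by (rule nn_integral_eq_integral[OF integrable_J]) (use J_bounds in \<open>auto intro!: AE_I2\<close>)
  finally show ?thesis .
qed

text \<open>The new mass is the integral of J over V. After subtraction of 1 and the trace term the
  integrand is of second order in the step, and the integral of the trace is known from
  \<open>integral_trace_curvature_deriv\<close>.\<close>

lemma mass_euler_step:
  "\<bar>mass W - mass V + \<tau> * (\<integral>y. dissipation \<psi> \<epsilon> V y \<partial>lborel)\<bar> \<le> K * (\<tau> * deriv_bound m)\<^sup>2 * m"
proof -
  let ?t = "\<lambda>z. trace (curvature_deriv V (fst z) ** snd z)"
  have "continuous_on (UNIV \<times> grassmannian TYPE('d)) (\<lambda>z :: (real^'n) \<times> (real^'n^'n). curvature_deriv V (fst z) ** snd z)"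
    by (intro continuous_intros continuous_on_compose2[OF continuous_curvature_deriv[OF bv m]]) auto
  then have "?t \<in> borel_measurable V"
    unfolding trace_def
    by (intro measurable_continuous_on_varifold[OF sets_source] continuous_on_sum continuous_on_component)
  moreover have "norm (?t z) \<le> real CARD('d) * deriv_bound m" if "z \<in> space V" for z
    using abs_trace_mult_le[OF snd_space[OF that], of "curvature_deriv V (fst z)"]
      mult_left_mono[OF norm_curvature_deriv_le[OF bv m, of "fst z"], of "real CARD('d)"]
    by (simp add: deriv_bound_def h_bound_def)
  moreover have "0 \<le> real CARD('d) * deriv_bound m" using h_bound_nonneg(2)[OF m] by simp
  ultimately have t: "integrable V ?t" by (rule norm_integral_le(1)[OF bv m])
  have K: "0 \<le> K" using jb by (simp add: jacobian_bounds_def)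
  have "0 \<le> (\<integral>z. J z \<partial>V)" by (rule Bochner_Integration.integral_nonneg_AE) (use J_bounds in auto)
  then have mW: "mass W = (\<integral>z. J z \<partial>V)"
    unfolding mass_eq[OF sets_euler_step] measure_def emeasure_W by simp
  have mV: "mass V = (\<integral>z. 1 \<partial>V)" unfolding mass_eq[OF sets_source] by simp
  have "norm (\<integral>z. J z - 1 - \<tau> * ?t z \<partial>V) \<le> K * (\<tau> * deriv_bound m)\<^sup>2 * m"
    by (rule norm_integral_le(2)[OF bv m]) (use J_bounds t K integrable_J in auto)
  also have "(\<integral>z. J z - 1 - \<tau> * ?t z \<partial>V) = (\<integral>z. J z \<partial>V) - (\<integral>z. 1 \<partial>V) - \<tau> * (\<integral>z. ?t z \<partial>V)"
    using t integrable_J by simp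
  also have "\<dots> = mass W - mass V + \<tau> * (\<integral>y. dissipation \<psi> \<epsilon> V y \<partial>lborel)"
    unfolding integral_trace_curvature_deriv[OF bv m] mW mV by simp
  finally show ?thesis by simp
qed

text \<open>Points move by at most the step length times the velocity bound. The mass parameter is
  the exact new mass; the growth allowed per step is fixed only when steps are combined.\<close>

lemma bounded_varifold_euler_step:
  "bounded_varifold TYPE('d) (R + \<tau> * h_bound m) (mass W) W"
  unfolding bounded_varifold_def
proof (intro conjI sets_euler_step)
  have "emeasure W (space W) = ennreal (measure W (space W))"
    by (simp add: emeasure_W measure_def)
  then show "emeasure W (space W) \<le> ennreal (mass W)" by (simp add: mass_eq[OF sets_euler_step])
  have "AE z in V. norm (fst (T z)) \<le> R + \<tau> * h_bound m"
    using AE_support[OF bv m]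
  proof eventually_elim
    case (elim z)
    then show ?case unfolding T_def using norm_f_minus[of "fst z"] norm_triangle_ineq2[of "f (fst z)" "fst z"] by simp
  qed
  then show "AE z in W. norm (fst z) \<le> R + \<tau> * h_bound m"
    unfolding W_eq
  proof (subst AE_distr_iff)
    show "T \<in> density V (\<lambda>z. ennreal (J z)) \<rightarrow>\<^sub>M varifold_space TYPE('d)" by simp
    have [measurable]: "fst \<in> borel_measurable (varifold_space TYPE('d) :: ((real^'n) \<times> (real^'n^'n)) measure)"
      by (rule measurable_fst_snd_varifold[OF refl])
    show "{z \<in> space (varifold_space TYPE('d)). norm (fst z :: real^'n) \<le> R + \<tau> * h_bound m} \<in> sets (varifold_space TYPE('d))"
      by measurable
  qed (auto simp: AE_density)
qed

text \<open>The change of the integrand is J * (new - old) + old * (J - 1), where new and old are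
  the two kernel values. With J <= 2 the first term is at most 2 e. The bound is uniform in y
  because e is a modulus of continuity for all base points.\<close>

lemma conv_weight_euler_step:
  assumes "\<And>x v. norm v \<le> \<tau> * h_bound m \<Longrightarrow> \<bar>\<Phi> (x + v) - \<Phi> x\<bar> \<le> e"
  shows "\<bar>conv_weight \<psi> \<epsilon> W y - conv_weight \<psi> \<epsilon> V y\<bar> \<le> (2 * e + B * (K * (\<tau> * deriv_bound m))) * m"
proof -
  have e: "0 \<le> e" using assms[of 0] tau h_bound_nonneg(1)[OF m] by simp
  have K: "0 \<le> K" using jb by (simp add: jacobian_bounds_def)
  have phi: "(\<lambda>z. \<Phi> (fst z - y)) \<in> borel_measurable (varifold_space TYPE('d))"
    by (rule measurable_continuous_on_varifold[OF refl]) (intro continuous_intros)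
  have bound: "norm (J z *\<^sub>R \<Phi> (fst (T z) - y) - \<Phi> (fst z - y)) \<le> 2 * e + B * (K * (\<tau> * deriv_bound m))"
    if z: "z \<in> space V" for z
  proof -
    have "\<bar>\<Phi> ((fst z - y) + (f (fst z) - fst z)) - \<Phi> (fst z - y)\<bar> \<le> e" by (intro assms norm_f_minus)
    then have 1: "\<bar>\<Phi> (fst (T z) - y) - \<Phi> (fst z - y)\<bar> \<le> e" by (simp add: T_def)
    have "J z *\<^sub>R \<Phi> (fst (T z) - y) - \<Phi> (fst z - y) =
        J z * (\<Phi> (fst (T z) - y) - \<Phi> (fst z - y)) + \<Phi> (fst z - y) * (J z - 1)"
      by (simp add: algebra_simps)
    moreover have "\<bar>J z * (\<Phi> (fst (T z) - y) - \<Phi> (fst z - y))\<bar> \<le> 2 * e"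
      unfolding abs_mult by (intro mult_mono 1) (use J_bounds[OF z] in auto)
    moreover have "\<bar>\<Phi> (fst z - y) * (J z - 1)\<bar> \<le> B * (K * (\<tau> * deriv_bound m))"
      unfolding abs_mult by (intro mult_mono J_bounds z) (use kernel_le kernel_nonneg B in auto)
    ultimately show ?thesis by (simp only: real_norm_def)
  qed
  have i1: "integrable V (\<lambda>z. J z *\<^sub>R \<Phi> (fst (T z) - y))"
  proof (rule norm_integral_le(1)[OF bv m])
    show "(\<lambda>z. J z *\<^sub>R \<Phi> (fst (T z) - y)) \<in> borel_measurable V"
      using measurable_compose[OF T_measurable phi] by simp
    show "norm (J z *\<^sub>R \<Phi> (fst (T z) - y)) \<le> 2 * B" if "z \<in> space V" for z
      unfolding norm_scaleR using J_bounds[OF that] kernel_le[of "fst (T z) - y"] kernel_nonneg[of "fst (T z) - y"]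
      by (intro mult_mono) auto
  qed (use B in simp)
  have i2: "integrable V (\<lambda>z. \<Phi> (fst z - y))"
    by (rule norm_integral_le(1)[OF bv m, of _ B])
       (use kernel_le kernel_nonneg B measurable_cong_sets[OF sets_source refl] phi in auto)
  have "conv_weight \<psi> \<epsilon> W y - conv_weight \<psi> \<epsilon> V y = (\<integral>z. J z *\<^sub>R \<Phi> (fst (T z) - y) - \<Phi> (fst z - y) \<partial>V)"
    unfolding conv_weight_eq[OF sets_source] conv_weight_eq[OF sets_euler_step] integral_W[OF phi]
    using i1 i2 by simp
  also have "norm \<dots> \<le> (2 * e + B * (K * (\<tau> * deriv_bound m))) * m"
  proof (rule norm_integral_le(2)[OF bv m _ bound])
    show "0 \<le> 2 * e + B * (K * (\<tau> * deriv_bound m))"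
      using e B K tau(1) h_bound_nonneg(2)[OF m] by (intro add_nonneg_nonneg mult_nonneg_nonneg) auto
  qed (use i1 i2 in auto)
  finally show ?thesis by simp
qed

text \<open>Three changes are separated: the Jacobian, the tilt of the plane and the displacement of
  the point. The tilt is estimated by \<open>push_matrix_dist\<close> against the identity matrix,
  and \<open>n * n\<close> comes from passing from the entries of \<open>A ** S\<close> to its
  norm.\<close>

lemma conv_first_variation_euler_step:
  assumes "\<And>x v. norm v \<le> \<tau> * h_bound m \<Longrightarrow> norm (D\<Phi> (x + v) - D\<Phi> x) \<le> e"
  defines "n \<equiv> real CARD('n)"
  shows "norm (conv_first_variation \<psi> \<epsilon> W y - conv_first_variation \<psi> \<epsilon> V y)
    \<le> (e + (K + 4 * (n * n)) * (\<tau> * deriv_bound m) * B) * m"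
proof -
  define \<beta> where "\<beta> = \<tau> * deriv_bound m"
  have \<beta>: "0 \<le> \<beta>" unfolding \<beta>_def using tau(1) h_bound_nonneg(2)[OF m] by simp
  have e: "0 \<le> e" using assms(1)[of 0 0] tau h_bound_nonneg(1)[OF m] by simp
  have K: "0 \<le> K" using jb by (simp add: jacobian_bounds_def)
  let ?g = "\<lambda>z. snd z *v D\<Phi> (fst z - y)"
  have phi: "?g \<in> borel_measurable (varifold_space TYPE('d))"
    by (rule measurable_continuous_on_varifold[OF refl]) (intro continuous_intros)
  have bound: "norm (J z *\<^sub>R ?g (T z) - ?g z) \<le> e + (K + 4 * (n * n)) * \<beta> * B"
    if z: "z \<in> space V" for z
  proof -
    let ?S = "snd z" and ?P = "snd (T z)"
    let ?p = "D\<Phi> (fst (T z) - y)" and ?q = "D\<Phi> (fst z - y)"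
    have S: "?S \<in> grassmannian TYPE('d)" by (rule snd_space[OF z])
    have "T z \<in> UNIV \<times> grassmannian TYPE('d)"
      using z T_in unfolding space_varifold[OF sets_source] by blast
    then have P: "?P \<in> grassmannian TYPE('d)" by auto
    have "norm (D\<Phi> ((fst z - y) + (f (fst z) - fst z)) - D\<Phi> (fst z - y)) \<le> e" by (intro assms norm_f_minus)
    then have 1: "norm (?S *v (?p - ?q)) \<le> e"
      using grassmannian_norm[OF S, of "?p - ?q"] by (simp add: T_def)
    have "norm ((J z - 1) *\<^sub>R (?P *v ?p)) \<le> (K * \<beta>) * B"
      unfolding norm_scaleR real_norm_def \<beta>_def
      by (intro mult_mono J_bounds z order.trans[OF grassmannian_norm[OF P] norm_grad_kernel_le])
         (use K \<beta> \<beta>_def in auto)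
    then have 2: "norm ((J z - 1) *\<^sub>R (?P *v ?p)) \<le> K * \<beta> * B" by simp
    have AS: "norm (A (fst z) ** ?S) \<le> n * n * \<beta>"
      unfolding n_def
    proof (rule norm_matrix_le_sum)
      fix i j
      have "\<bar>(A (fst z) *v (?S *v axis j 1)) $ i\<bar> \<le> norm (A (fst z) *v (?S *v axis j 1))"
        by (rule component_le_norm_cart)
      also have "\<dots> \<le> norm (A (fst z)) * norm (?S *v axis j 1)" by (rule norm_matrix_vector_le)
      also have "\<dots> \<le> \<beta> * 1"
        using grassmannian_norm[OF S, of "axis j 1"] \<beta> norm_A(1)[of "fst z"] by (intro mult_mono) (auto simp: \<beta>_def)
      finally show "\<bar>(A (fst z) ** ?S) $ i $ j\<bar> \<le> \<beta>"
        by (simp only: matrix_vector_mul_assoc) (simp add: matrix_vector_mult_basis column_def)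
    qed
    \<comment> \<open>The old plane is its own image under \<open>mat 1\<close>, which is expansive
      as the zero perturbation.\<close>
    have "norm (push_matrix (mat 1 + A (fst z)) ?S *v ?p - push_matrix (mat 1) ?S *v ?p)
        \<le> 4 * norm ((mat 1 + A (fst z)) ** ?S - mat 1 ** ?S) * norm ?p"
      by (rule push_matrix_dist[OF expansive_A _ S S]) (use expansive_perturbation[of 0] in simp)
    also have "(mat 1 + A (fst z)) ** ?S - mat 1 ** ?S = A (fst z) ** ?S"
      by (simp add: vec_eq_iff matrix_matrix_mult_def sum.distrib distrib_right)
    also have "4 * norm (A (fst z) ** ?S) * norm ?p \<le> 4 * (n * n * \<beta>) * B"
      using AS \<beta> norm_grad_kernel_le by (intro mult_mono) (auto simp: n_def)
    finally have 3: "norm (?P *v ?p - ?S *v ?p) \<le> 4 * (n * n) * \<beta> * B"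
      by (simp add: push_matrix_id[OF S] T_def push_eq algebra_simps)
    have "J z *\<^sub>R ?g (T z) - ?g z = ((J z - 1) *\<^sub>R (?P *v ?p) + (?P *v ?p - ?S *v ?p)) + ?S *v (?p - ?q)"
      by (simp add: algebra_simps matrix_vector_mult_diff_distrib)
    then have "norm (J z *\<^sub>R ?g (T z) - ?g z) \<le> (K * \<beta> * B + 4 * (n * n) * \<beta> * B) + e"
      using 1 2 3 by (metis add_mono norm_triangle_mono)
    then show ?thesis by (simp add: algebra_simps)
  qed
  have i1: "integrable V (\<lambda>z. J z *\<^sub>R ?g (T z))"
  proof (rule norm_integral_le(1)[OF bv m])
    show "(\<lambda>z. J z *\<^sub>R ?g (T z)) \<in> borel_measurable V"
      using measurable_compose[OF T_measurable phi] by simp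
    show "norm (J z *\<^sub>R ?g (T z)) \<le> 2 * B" if z: "z \<in> space V" for z
    proof -
      have "T z \<in> UNIV \<times> grassmannian TYPE('d)"
        using z T_in unfolding space_varifold[OF sets_source] by blast
      then have P: "snd (T z) \<in> grassmannian TYPE('d)" by auto
      show ?thesis unfolding norm_scaleR
        by (intro mult_mono order.trans[OF grassmannian_norm[OF P] norm_grad_kernel_le]) (use J_bounds[OF z] in auto)
    qed
  qed (use B in simp)
  have i2: "integrable V ?g"
    by (rule norm_integral_le(1)[OF bv m, of _ B])
       (use norm_first_variation_integrand_le[OF bv m] B measurable_first_variation_integrand[OF bv m] in auto)
  have "conv_first_variation \<psi> \<epsilon> W y - conv_first_variation \<psi> \<epsilon> V y = (\<integral>z. J z *\<^sub>R ?g (T z) - ?g z \<partial>V)"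
    unfolding conv_first_variation_eq integral_W[OF phi] using i1 i2 by simp
  also have "norm \<dots> \<le> (e + (K + 4 * (n * n)) * \<beta> * B) * m"
  proof (rule norm_integral_le(2)[OF bv m _ bound])
    show "0 \<le> e + (K + 4 * (n * n)) * \<beta> * B"
      using e B K \<beta> by (intro add_nonneg_nonneg mult_nonneg_nonneg) (auto simp: n_def)
  qed (use i1 i2 in auto)
  finally show ?thesis unfolding \<beta>_def .
qed

end

text \<open>\<delta> precedes V, R, \<tau> and y in the quantifiers, because the varifold at a node
  changes with the subdivision and closeness must hold for all of them together.\<close>

lemma euler_step_close:
  assumes m: "0 \<le> m" and jb: "jacobian_bounds TYPE('d::finite) TYPE('n) K a" and e: "0 < e"
  shows "\<exists>\<delta>>0. \<forall>V R \<tau> y. bounded_varifold TYPE('d) R m V \<and> 0 \<le> \<tau> \<and> \<tau> < \<delta> \<longrightarrow>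
     \<bar>conv_weight \<psi> \<epsilon> (euler_step TYPE('d) \<psi> \<epsilon> \<tau> V) y - conv_weight \<psi> \<epsilon> V y\<bar> \<le> e \<and>
     norm (conv_first_variation \<psi> \<epsilon> (euler_step TYPE('d) \<psi> \<epsilon> \<tau> V) y - conv_first_variation \<psi> \<epsilon> V y) \<le> e"
proof -
  define n where "n = real CARD('n)"
  \<comment> \<open>Both error bounds will be at most 3 * \<open>e1\<close> * m; the divisor m + 1
    also covers m = 0.\<close>
  define e1 where "e1 = e / (4 * (m + 1))"
  have e1: "0 < e1" using e m by (simp add: e1_def)
  have K: "0 < K" "0 < a" using jb by (simp_all add: jacobian_bounds_def)
  obtain d1 where d1: "0 < d1" "\<And>x y. dist y x < d1 \<Longrightarrow> dist (\<Phi> y) (\<Phi> x) < e1"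
    using uniformly_continuous_on_compact_support[OF continuous_kernel kernel_eq_0] e1
    unfolding uniformly_continuous_on_def by (meson UNIV_I)
  obtain d2 where d2: "0 < d2" "\<And>x y. dist y x < d2 \<Longrightarrow> dist (D\<Phi> y) (D\<Phi> x) < e1"
    using uniformly_continuous_on_compact_support[OF continuous_grad_kernel grad_kernel_eq_0] e1
    unfolding uniformly_continuous_on_def by (meson UNIV_I)
  define H where "H = h_bound m + 1"
  define G where "G = deriv_bound m + 1"
  define C where "C = (K + 4 * (n * n)) * B"
  have H: "0 < H" "h_bound m \<le> H" and G: "0 < G" "deriv_bound m \<le> G"
    using h_bound_nonneg[OF m] by (auto simp: H_def G_def)
  have C: "0 < C" unfolding C_def n_def using K B by (intro mult_pos_pos add_pos_nonneg) auto
  \<comment> \<open>The entries keep the displacement within the two moduli of continuity, keep the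
    derivative in the range of \<open>jacobian_bounds\<close>, and push the Jacobian and tilt errors
    below \<open>e1\<close>. H and G carry a summand 1 to be positive divisors.\<close>
  define \<delta> where "\<delta> = min (min (d1 / H) (d2 / H)) (min (a / G) (e1 / (C * G)))"
  have \<delta>: "0 < \<delta>" using d1(1) d2(1) H G K C e1 by (simp add: \<delta>_def)
  show ?thesis
  proof (intro exI[of _ \<delta>] conjI allI impI \<delta>; elim conjE)
    fix V :: "((real^'n) \<times> (real^'n^'n)) measure" and R \<tau> :: real and y :: "real^'n"
    assume bv: "bounded_varifold TYPE('d) R m V" and tau: "0 \<le> \<tau>" "\<tau> < \<delta>"
    have "\<tau> * H < d1" "\<tau> * H < d2" "\<tau> * G < a" "\<tau> * (C * G) < e1"
      using tau H G C by (auto simp: \<delta>_def pos_less_divide_eq)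
    moreover have "\<tau> * h_bound m \<le> \<tau> * H" "\<tau> * deriv_bound m \<le> \<tau> * G" "\<tau> * (C * deriv_bound m) \<le> \<tau> * (C * G)"
      using tau H G C by (auto intro!: mult_left_mono)
    ultimately have t: "\<tau> * h_bound m < d1" "\<tau> * h_bound m < d2" "\<tau> * deriv_bound m \<le> a"
        "\<tau> * (C * deriv_bound m) \<le> e1" by linarith+
    have small: "x * m \<le> e" if "x \<le> 3 * e1" for x
    proof -
      have "x * m \<le> (4 * e1) * (m + 1)"
        by (rule order.trans[OF mult_right_mono[OF that m]]) (use e1 m in \<open>auto intro!: mult_mono\<close>)
      also have "\<dots> = e" unfolding e1_def using m by (simp add: field_simps)
      finally show ?thesis .
    qed
    have "B * K \<le> C" unfolding C_def n_def using B by (simp add: algebra_simps)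
    then have "(B * K) * (\<tau> * deriv_bound m) \<le> C * (\<tau> * deriv_bound m)"
      using tau h_bound_nonneg(2)[OF m] by (intro mult_right_mono) auto
    then have "B * (K * (\<tau> * deriv_bound m)) \<le> e1" using t(4) by (simp add: algebra_simps)
    then have 1: "(2 * e1 + B * (K * (\<tau> * deriv_bound m))) * m \<le> e" by (intro small) simp
    have "\<bar>conv_weight \<psi> \<epsilon> (euler_step TYPE('d) \<psi> \<epsilon> \<tau> V) y - conv_weight \<psi> \<epsilon> V y\<bar>
        \<le> (2 * e1 + B * (K * (\<tau> * deriv_bound m))) * m"
      by (rule conv_weight_euler_step[OF bv m jb tau(1) t(3)])
         (use d1(2) t in \<open>fastforce simp: dist_norm intro: less_imp_le\<close>)
    with 1 show "\<bar>conv_weight \<psi> \<epsilon> (euler_step TYPE('d) \<psi> \<epsilon> \<tau> V) y - conv_weight \<psi> \<epsilon> V y\<bar> \<le> e" by linarith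
    have "(K + 4 * (n * n)) * (\<tau> * deriv_bound m) * B \<le> e1" using t(4) by (simp add: C_def algebra_simps)
    then have 2: "(e1 + (K + 4 * (n * n)) * (\<tau> * deriv_bound m) * B) * m \<le> e" using e1 by (intro small) simp
    have "norm (conv_first_variation \<psi> \<epsilon> (euler_step TYPE('d) \<psi> \<epsilon> \<tau> V) y - conv_first_variation \<psi> \<epsilon> V y)
        \<le> (e1 + (K + 4 * (n * n)) * (\<tau> * deriv_bound m) * B) * m"
      unfolding n_def
      by (rule conv_first_variation_euler_step[OF bv m jb tau(1) t(3)])
         (use d2(2) t in \<open>fastforce simp: dist_norm intro: less_imp_le\<close>)
    with 2 show "norm (conv_first_variation \<psi> \<epsilon> (euler_step TYPE('d) \<psi> \<epsilon> \<tau> V) y - conv_first_variation \<psi> \<epsilon> V y) \<le> e"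
      by linarith
  qed
qed

end

section \<open>Weak-star limits\<close>

lemma bounded_varifold_AE: "bounded_varifold D R m V \<Longrightarrow> AE z in V. norm (fst z) \<le> R"
  by (simp add: bounded_varifold_def)

lemma bounded_varifold_mono:
  assumes "bounded_varifold D R m V" "R \<le> R'" "m \<le> m'"
  shows "bounded_varifold D R' m' V"
proof -
  have "emeasure V (space V) \<le> ennreal m'"
    using assms unfolding bounded_varifold_def by (meson ennreal_leI order.trans)
  moreover have "AE z in V. norm (fst z) \<le> R'"
    using bounded_varifold_AE[OF assms(1)]
    by (rule AE_mp) (use assms(2) in auto)
  ultimately show ?thesis using assms(1) unfolding bounded_varifold_def by simp
qed

lemma compact_in_sets_varifold:
  fixes V :: "((real^'n) \<times> (real^'n^'n)) measure"
  assumes "sets V = sets (varifold_space D)" "compact C" "C \<subseteq> UNIV \<times> grassmannian D"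
  shows "C \<in> sets V"
proof -
  have "C \<in> sets borel" using assms(2) by (simp add: compact_imp_closed)
  then have "(UNIV \<times> grassmannian D) \<inter> C \<in> sets (varifold_space D)"
    unfolding varifold_space_def sets_restrict_space by blast
  then show ?thesis using assms(1,3) by (simp add: inf_absorb2)
qed

lemma varifold_integrable:
  fixes V :: "((real^'n) \<times> (real^'n^'n)) measure" and \<phi> :: "(real^'n) \<times> (real^'n^'n) \<Rightarrow> real"
  assumes V: "varifold D V" and \<phi>: "continuous_on (UNIV \<times> grassmannian D) \<phi>"
    and C: "compact C" "C \<subseteq> UNIV \<times> grassmannian D"
    and supp: "\<And>z. z \<in> UNIV \<times> grassmannian D - C \<Longrightarrow> \<phi> z = 0"
  shows "integrable V \<phi>"
proof -
  have sets_limit: "sets V = sets (varifold_space D)" using V by (simp add: varifold_def)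
  have "compact (\<phi> ` C)" by (rule compact_continuous_image[OF continuous_on_subset[OF \<phi> C(2)] C(1)])
  then obtain b where b: "\<And>y. y \<in> \<phi> ` C \<Longrightarrow> norm y \<le> b" by (meson compact_imp_bounded bounded_pos)
  have "emeasure V C < \<infinity>" using V C unfolding varifold_def by blast
  then have "integrable V (\<lambda>z. b * indicator C z)"
    by (intro integrable_mult_right integrable_real_indicator compact_in_sets_varifold[OF sets_limit C])
  then show ?thesis
  proof (rule Bochner_Integration.integrable_bound)
    show "\<phi> \<in> borel_measurable V" by (rule measurable_continuous_on_varifold[OF sets_limit \<phi>])
    show "AE z in V. norm (\<phi> z) \<le> norm (b * indicator C z)"
    proof (rule AE_I2)
      fix z assume "z \<in> space V"
      then have z: "z \<in> UNIV \<times> grassmannian D" using space_varifold[OF sets_limit] by blast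
      show "norm (\<phi> z) \<le> norm (b * indicator C z)"
        using supp[of z] z b[of "\<phi> z"] by (cases "z \<in> C") auto
    qed
  qed
qed

lemma compact_cball_grassmannian:
  "compact (cball (x::real^'n) r \<times> (grassmannian TYPE('d::finite) :: (real^'n^'n) set))"
  by (intro compact_Times compact_cball compact_grassmannian)

text \<open>Points off the support have open null neighbourhoods. Lindelof reduces their union to
  countably many, so the complement of the support is null.\<close>

lemma compact_support_AE:
  fixes V :: "((real^'n) \<times> (real^'n^'n)) measure"
  assumes V: "varifold D V" and supp: "compact (varifold_support D V)"
  shows "\<exists>R\<ge>0. AE z in V. norm (fst z) \<le> R"
proof -
  let ?\<Omega> = "UNIV \<times> grassmannian D :: ((real^'n) \<times> (real^'n^'n)) set"
  have sets_limit: "sets V = sets (varifold_space D)" using V by (simp add: varifold_def)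
  have spaceV: "space V = ?\<Omega>" by (rule space_varifold[OF sets_limit])
  define F where "F = {W. open W \<and> emeasure V (W \<inter> ?\<Omega>) = 0}"
  obtain F' where F': "F' \<subseteq> F" "countable F'" "\<Union>F' = \<Union>F"
    using Lindelof[of F] unfolding F_def by blast
  have "W \<inter> ?\<Omega> \<in> null_sets V" if "W \<in> F'" for W
  proof -
    have "W \<in> sets borel" "emeasure V (W \<inter> ?\<Omega>) = 0" using that F'(1) by (auto simp: F_def)
    moreover have "?\<Omega> \<inter> W \<in> sets V"
      unfolding sets_limit varifold_space_def sets_restrict_space using calculation(1) by blast
    ultimately show ?thesis by (simp add: null_sets_def Int_commute)
  qed
  then have null: "(\<Union>W\<in>F'. W \<inter> ?\<Omega>) \<in> null_sets V" by (rule null_sets_UN'[OF F'(2)])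
  obtain R where R: "\<And>z. z \<in> varifold_support D V \<Longrightarrow> norm z \<le> R" "0 < R"
    using compact_imp_bounded[OF supp] bounded_pos by metis
  have "AE z in V. norm (fst z) \<le> R"
  proof (rule AE_I'[OF null], rule subsetI)
    fix z assume "z \<in> {z \<in> space V. \<not> norm (fst z) \<le> R}"
    then have z: "z \<in> ?\<Omega>" "\<not> norm (fst z) \<le> R" using spaceV by auto
    moreover have "norm (fst z) \<le> norm z" by (simp add: norm_prod_def)
    ultimately have "z \<notin> varifold_support D V" using R(1)[of z] by linarith
    then obtain W where "open W" "z \<in> W" "\<not> 0 < emeasure V (W \<inter> ?\<Omega>)"
      using z(1) unfolding varifold_support_def by blast
    then have "z \<in> \<Union>F" unfolding F_def by (auto simp: not_gr_zero)
    then show "z \<in> (\<Union>W\<in>F'. W \<inter> ?\<Omega>)" using F'(3) z(1) by blast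
  qed
  then show ?thesis using R(2) by (intro exI[of _ R]) auto
qed

section \<open>Weak-star limits of varifolds concentrated over a common ball\<close>

context
  fixes W :: "nat \<Rightarrow> ((real^'n) \<times> (real^'n^'n)) measure" and V :: "((real^'n) \<times> (real^'n^'n)) measure"
    and R m :: real
  assumes W: "\<And>j. bounded_varifold TYPE('d::finite) R m (W j)" and m: "0 \<le> m"
    and V: "varifold TYPE('d) V" and lim: "weak_star_tendsto TYPE('d) W V"
begin

private lemma sets_limit: "sets V = sets (varifold_space TYPE('d))"
  using V by (simp add: varifold_def)

private lemma sets_seq: "sets (W j) = sets (varifold_space TYPE('d))"
  using W by (simp add: bounded_varifold_def)

text \<open>The Grassmannian is compact, so a test function only has to be cut off in space: a
  closed ball times the Grassmannian is the compact set that \<open>weak_star_tendsto\<close> asks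
  for.\<close>

lemma weak_star_integral:
  fixes \<phi> :: "(real^'n) \<times> (real^'n^'n) \<Rightarrow> real"
  assumes "continuous_on (UNIV \<times> grassmannian TYPE('d)) \<phi>" "\<And>z. r < dist x (fst z) \<Longrightarrow> \<phi> z = 0"
  shows "(\<lambda>j. \<integral>z. \<phi> z \<partial>W j) \<longlonglongrightarrow> (\<integral>z. \<phi> z \<partial>V)" "integrable V \<phi>"
proof -
  let ?C = "cball x r \<times> (grassmannian TYPE('d) :: (real^'n^'n) set)"
  have supp: "\<phi> z = 0" if "z \<in> UNIV \<times> grassmannian TYPE('d) - ?C" for z
    using that assms(2)[of z] by (auto simp: mem_Times_iff)
  show "(\<lambda>j. \<integral>z. \<phi> z \<partial>W j) \<longlonglongrightarrow> (\<integral>z. \<phi> z \<partial>V)"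
    using lim[unfolded weak_star_tendsto_def, rule_format, of \<phi>] assms(1) supp
      compact_cball_grassmannian[of x r, where 'd='d]
    by (metis (no_types, lifting) Sigma_mono order.refl subset_UNIV)
  show "integrable V \<phi>"
    by (rule varifold_integrable[OF V assms(1) compact_cball_grassmannian[of x r, where 'd='d] _ supp]) auto
qed

text \<open>The tent \<open>\<phi> k\<close> is positive exactly for R < norm < k. It integrates to
  0 against each \<open>W j\<close>, hence against V, and the countably many k exhaust the exterior
  of the ball.\<close>

lemma weak_star_support: "AE z in V. norm (fst z) \<le> R"
proof -
  define \<phi> :: "nat \<Rightarrow> (real^'n) \<times> (real^'n^'n) \<Rightarrow> real"
    where "\<phi> k z = max 0 (min (norm (fst z) - R) (real k - norm (fst z)))" for k z
  have "AE z in V. \<phi> k z = 0" for k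
  proof -
    have cont: "continuous_on (UNIV \<times> grassmannian TYPE('d)) (\<phi> k)"
      unfolding \<phi>_def by (intro continuous_intros)
    have supp: "\<phi> k z = 0" if "real k < dist 0 (fst z)" for z using that by (simp add: \<phi>_def)
    have "(\<integral>z. \<phi> k z \<partial>W j) = (\<integral>z. 0 \<partial>W j)" for j
    proof (rule integral_cong_AE)
      show "AE z in W j. \<phi> k z = 0" using bounded_varifold_AE[OF W, of j] by eventually_elim (simp add: \<phi>_def)
    qed (use measurable_continuous_on_varifold[OF sets_seq cont] in auto)
    then have "(\<integral>z. \<phi> k z \<partial>V) = 0"
      using LIMSEQ_unique[OF weak_star_integral(1)[where r = k and x = 0, OF cont supp]] by simp
    then show ?thesis
      using integral_nonneg_eq_0_iff_AE[OF weak_star_integral(2)[where r = k and x = 0, OF cont supp]] by (simp add: \<phi>_def)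
  qed
  then have "AE z in V. \<forall>k. \<phi> k z = 0" by (simp add: AE_all_countable)
  then show ?thesis
  proof eventually_elim
    case (elim z)
    obtain k where "norm (fst z) < real k" using reals_Archimedean2 by blast
    then show ?case using elim[rule_format, of k] by (auto simp: \<phi>_def max_def min_def split: if_splits)
  qed
qed

text \<open>All the varifolds live over one ball, so a cutoff equal to 1 there is an admissible test
  function computing the total mass. No mass can escape to infinity.\<close>

lemma weak_star_mass: "(\<lambda>j. mass (W j)) \<longlonglongrightarrow> mass V"
proof -
  define \<phi> :: "(real^'n) \<times> (real^'n^'n) \<Rightarrow> real"
    where "\<phi> z = max 0 (min 1 (R + 1 - norm (fst z)))" for z
  have cont: "continuous_on (UNIV \<times> grassmannian TYPE('d)) \<phi>"
    unfolding \<phi>_def by (intro continuous_intros)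
  have supp: "\<phi> z = 0" if "R + 1 < dist 0 (fst z)" for z using that by (simp add: \<phi>_def)
  have mass: "(\<integral>z. \<phi> z \<partial>U) = mass U"
    if U: "sets U = sets (varifold_space TYPE('d))" and AE: "AE z in U. norm (fst z) \<le> R" for U
  proof -
    have "(\<integral>z. \<phi> z \<partial>U) = (\<integral>z. 1 \<partial>U)"
    proof (rule integral_cong_AE)
      show "AE z in U. \<phi> z = 1" using AE by eventually_elim (simp add: \<phi>_def)
    qed (use measurable_continuous_on_varifold[OF U cont] in auto)
    then show ?thesis using mass_eq[OF U] by simp
  qed
  show ?thesis
    using weak_star_integral(1)[where r = "R + 1" and x = 0, OF cont supp] mass[OF sets_limit weak_star_support] mass[OF sets_seq bounded_varifold_AE[OF W]] by simp
qed

text \<open>Only local finiteness of V is given. Being concentrated on a compact set it is finite,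
  and convergence of the masses then bounds it by m.\<close>

lemma weak_star_bounded: "bounded_varifold TYPE('d) R m V"
proof -
  let ?C = "cball (0::real^'n) R \<times> (grassmannian TYPE('d) :: (real^'n^'n) set)"
  have C: "compact ?C" by (rule compact_cball_grassmannian)
  have "emeasure V (space V) = emeasure V ?C"
  proof (rule emeasure_eq_AE)
    show "AE z in V. (z \<in> space V) = (z \<in> ?C)"
      using weak_star_support AE_space by eventually_elim (auto simp: space_varifold[OF sets_limit])
  qed (use compact_in_sets_varifold[OF sets_limit C] in auto)
  also have "\<dots> < \<infinity>" using V C unfolding varifold_def by blast
  finally have "emeasure V (space V) = ennreal (mass V)"
    by (simp add: mass_eq[OF sets_limit] measure_def less_top)
  moreover have "mass V \<le> m"
    by (rule LIMSEQ_le_const2[OF weak_star_mass]) (use bounded_varifold_mass[OF W m] in blast)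
  ultimately show ?thesis
    unfolding bounded_varifold_def using sets_limit weak_star_support by (simp add: ennreal_leI)
qed

end

context mollifier
begin

section \<open>Pointwise convergence of the two convolutions\<close>

context
  fixes W :: "nat \<Rightarrow> ((real^'n) \<times> (real^'n^'n)) measure" and V :: "((real^'n) \<times> (real^'n^'n)) measure"
    and R m :: real
  assumes W: "\<And>j. bounded_varifold TYPE('d::finite) R m (W j)" and m: "0 \<le> m"
    and V: "varifold TYPE('d) V" and lim: "weak_star_tendsto TYPE('d) W V"
begin

lemma weak_star_conv_weight: "(\<lambda>j. conv_weight \<psi> \<epsilon> (W j) y) \<longlonglongrightarrow> conv_weight \<psi> \<epsilon> V y"
proof -
  have cont: "continuous_on (UNIV \<times> grassmannian TYPE('d)) (\<lambda>z :: (real^'n) \<times> (real^'n^'n). \<Phi> (fst z - y))"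
    by (intro continuous_intros)
  have supp: "\<Phi> (fst z - y) = 0" if "1 < dist y (fst z)" for z :: "(real^'n) \<times> (real^'n^'n)"
    using that by (intro kernel_eq_0) (simp add: dist_norm norm_minus_commute)
  have "sets (W j) = sets (varifold_space TYPE('d))" "sets V = sets (varifold_space TYPE('d))" for j
    using W V by (auto simp: bounded_varifold_def varifold_def)
  then show ?thesis
    using weak_star_integral(1)[OF W m V lim cont supp] by (simp add: conv_weight_eq)
qed

lemma weak_star_conv_first_variation:
  "(\<lambda>j. conv_first_variation \<psi> \<epsilon> (W j) y) \<longlonglongrightarrow> conv_first_variation \<psi> \<epsilon> V y"
proof (rule vec_tendstoI)
  fix i
  let ?g = "\<lambda>z :: (real^'n) \<times> (real^'n^'n). snd z *v D\<Phi> (fst z - y)"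
  have cont: "continuous_on (UNIV \<times> grassmannian TYPE('d)) (\<lambda>z. ?g z $ i)"
    by (intro continuous_intros)
  have supp: "?g z $ i = 0" if "1 < dist y (fst z)" for z
    using that by (subst grad_kernel_eq_0) (auto simp: dist_norm norm_minus_commute)
  \<comment> \<open>Weak-star convergence tests real functions, so components are taken; exchanging
    component and integral rests on integrability, which bounded mass provides.\<close>
  have eq: "conv_first_variation \<psi> \<epsilon> U y $ i = (\<integral>z. ?g z $ i \<partial>U)" if U: "bounded_varifold TYPE('d) R m U" for U
  proof -
    have "integrable U ?g"
      by (rule norm_integral_le(1)[OF U m, of _ B])
         (use norm_first_variation_integrand_le[OF U m] B measurable_first_variation_integrand[OF U m] in auto)
    then show ?thesis
      unfolding conv_first_variation_eq by (rule integral_bounded_linear[OF bounded_linear_vec_nth, symmetric])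
  qed
  show "(\<lambda>j. conv_first_variation \<psi> \<epsilon> (W j) y $ i) \<longlonglongrightarrow> conv_first_variation \<psi> \<epsilon> V y $ i"
    unfolding eq[OF W] eq[OF weak_star_bounded[OF W m V lim]]
    by (rule weak_star_integral(1)[OF W m V lim cont supp])
qed

end

end

section \<open>Uniform subdivisions\<close>

text \<open>\<open>approx_mcf\<close> prescribes the limit along every admissible sequence of
  subdivisions, so the argument may run along equidistant ones.\<close>

definition uniform_subdivision :: "nat \<Rightarrow> real list" where
  "uniform_subdivision N = map (\<lambda>k. real k / real N) [0..<Suc N]"

lemma uniform_subdivision_nth: "i \<le> N \<Longrightarrow> uniform_subdivision N ! i = real i / real N"
  unfolding uniform_subdivision_def by (simp del: upt_Suc)

lemma subdivision_uniform:
  assumes "0 < N"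
  shows "subdivision (uniform_subdivision N)" "mesh (uniform_subdivision N) = 1 / real N"
proof -
  have len: "length (uniform_subdivision N) = Suc N" by (simp add: uniform_subdivision_def)
  then have ne: "uniform_subdivision N \<noteq> []" by auto
  have "sorted_wrt (<) (uniform_subdivision N)"
    using assms by (simp add: sorted_wrt_iff_nth_less len uniform_subdivision_nth divide_strict_right_mono)
  moreover have "hd (uniform_subdivision N) = 0" "last (uniform_subdivision N) = 1"
    using assms by (simp_all add: hd_conv_nth last_conv_nth ne len uniform_subdivision_nth)
  ultimately show "subdivision (uniform_subdivision N)" using ne by (simp add: subdivision_def)
  have "(\<lambda>i. uniform_subdivision N ! Suc i - uniform_subdivision N ! i) ` {i. Suc i < length (uniform_subdivision N)}
      = (\<lambda>i. 1 / real N) ` {i. i < N}"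
    unfolding len
    by (intro image_cong) (auto simp: uniform_subdivision_nth diff_divide_distrib[symmetric])
  also have "\<dots> = {1 / real N}" using assms by auto
  finally show "mesh (uniform_subdivision N) = 1 / real N" by (simp add: mesh_def)
qed

text \<open>The same \<open>LEAST\<close> as in \<open>discrete_flow\<close>, so that the flow at
  time t unfolds to one step from this node.\<close>

definition node :: "nat \<Rightarrow> real \<Rightarrow> nat" where
  "node N t = (LEAST i. t \<le> uniform_subdivision N ! Suc i)"

lemma node_eq:
  assumes "i < N" "real i / real N < t" "t \<le> real (Suc i) / real N"
  shows "node N t = i"
  unfolding node_def
proof (rule Least_equality)
  show "t \<le> uniform_subdivision N ! Suc i" using assms by (simp add: uniform_subdivision_nth)
  show "i \<le> y" if "t \<le> uniform_subdivision N ! Suc y" for y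
  proof (rule ccontr)
    assume "\<not> i \<le> y"
    then have "Suc y \<le> i" by simp
    then have "t \<le> real (Suc y) / real N" "real (Suc y) / real N \<le> real i / real N"
      using that assms(1) by (auto simp: uniform_subdivision_nth divide_right_mono)
    then show False using assms(2) by linarith
  qed
qed

lemma node_bounds:
  assumes "0 < N" "0 \<le> t" "t \<le> 1"
  shows "node N t < N" "real (node N t) / real N \<le> t" "t \<le> real (Suc (node N t)) / real N"
proof -
  let ?P = "\<lambda>i. t \<le> uniform_subdivision N ! Suc i"
  \<comment> \<open>The last node is 1 >= t, so the least index is at most N - 1 and list indexing
    stays within bounds.\<close>
  have P: "?P (N - 1)" using assms by (simp add: uniform_subdivision_nth)
  have "node N t \<le> N - 1" unfolding node_def by (rule Least_le[of ?P, OF P])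
  then show 1: "node N t < N" using assms(1) by simp
  have "?P (node N t)" unfolding node_def by (rule LeastI[of ?P, OF P])
  then show "t \<le> real (Suc (node N t)) / real N" using 1 by (simp add: uniform_subdivision_nth)
  show "real (node N t) / real N \<le> t"
  proof (cases "node N t")
    case (Suc k)
    then have "\<not> ?P k" unfolding node_def by (metis not_less_Least lessI)
    then show ?thesis using Suc 1 by (simp add: uniform_subdivision_nth)
  qed (use assms in simp)
qed

lemma node_measurable [measurable]: "node N \<in> borel \<rightarrow>\<^sub>M count_space UNIV"
  unfolding node_def by measurable

lemma discrete_flow_node:
  assumes "0 < N" "0 \<le> t" "t \<le> 1"
  shows "discrete_flow D \<psi> \<epsilon> V\<^sub>0 (uniform_subdivision N) t =
    euler_step D \<psi> \<epsilon> (t - real (node N t) / real N) (flow_at_node D \<psi> \<epsilon> V\<^sub>0 (uniform_subdivision N) (node N t))"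
  unfolding discrete_flow_def node_def[symmetric] Let_def
  using node_bounds[OF assms] by (simp add: uniform_subdivision_nth)

lemma step_function_has_integral:
  fixes c :: "nat \<Rightarrow> real"
  assumes N: "0 < N" and i: "i < N" and t: "real i / real N \<le> t" "t \<le> real (Suc i) / real N"
  shows "((\<lambda>s. c (node N s)) has_integral (\<Sum>k<i. c k / real N) + (t - real i / real N) * c i) {0..t}"
  using i t
proof (induction i arbitrary: t)
  have piece: "((\<lambda>s. c (node N s)) has_integral (t - real i / real N) * c i) {real i / real N..t}"
    if "i < N" "real i / real N \<le> t" "t \<le> real (Suc i) / real N" for i t
  \<comment> \<open>For i > 0 the left endpoint of a piece still belongs to the previous interval
    under \<open>node\<close>, so this single point is removed.\<close>
  proof (rule has_integral_spike_finite[of "{real i / real N}"])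
    show "((\<lambda>s. c i) has_integral (t - real i / real N) * c i) {real i / real N..t}"
      using has_integral_const_real[of "c i" "real i / real N" t] that by simp
    show "c (node N s) = c i" if "s \<in> {real i / real N..t} - {real i / real N}" for s
      using node_eq[of i N s] that \<open>i < N\<close> \<open>t \<le> real (Suc i) / real N\<close> by auto
  qed simp
  {
    case 0
    then show ?case using piece[of 0 t] by simp
  next
    case (Suc i)
    have "((\<lambda>s. c (node N s)) has_integral (\<Sum>k<i. c k / real N) + (real (Suc i) / real N - real i / real N) * c i) {0..real (Suc i) / real N}"
      by (rule Suc.IH) (use Suc.prems N in \<open>auto simp: divide_right_mono\<close>)
    then have "((\<lambda>s. c (node N s)) has_integral (\<Sum>k<Suc i. c k / real N)) {0..real (Suc i) / real N}"
      by (simp add: diff_divide_distrib[symmetric])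
    then show ?case
      using has_integral_combine[OF _ Suc.prems(2) _ piece[OF Suc.prems]] by simp
  }
qed

section \<open>The discrete energy balance and its limit\<close>

context mollifier
begin

abbreviation "total_dissipation V \<equiv> (\<integral>y. dissipation \<psi> \<epsilon> V y \<partial>lborel)"

lemma total_dissipation_bounds:
  assumes "bounded_varifold TYPE('d::finite) R m V" "0 \<le> m"
  shows "0 \<le> total_dissipation V"
    "total_dissipation V \<le> (B * m)\<^sup>2 / \<epsilon> * measure lborel (cball (0::real^'n) (R + 1))"
proof -
  show "0 \<le> total_dissipation V"
    by (intro Bochner_Integration.integral_nonneg dissipation_nonneg[OF assms])
  have "norm (total_dissipation V) \<le> (B * m)\<^sup>2 / \<epsilon> * measure lborel (cball (0::real^'n) (R + 1))"
    by (rule norm_integral_over_ball_le[OF integrable_dissipation[OF assms]])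
       (use dissipation_nonneg[OF assms] dissipation_le[OF assms] in auto)
  then show "total_dissipation V \<le> (B * m)\<^sup>2 / \<epsilon> * measure lborel (cball (0::real^'n) (R + 1))" by simp
qed

section \<open>A priori bounds and energy balance on a uniform subdivision\<close>

context
  fixes V\<^sub>0 :: "((real^'n) \<times> (real^'n^'n)) measure" and R M K a C :: real and N :: nat
    and W :: "nat \<Rightarrow> ((real^'n) \<times> (real^'n^'n)) measure"
    and U :: "real \<Rightarrow> ((real^'n) \<times> (real^'n^'n)) measure"
  assumes V0: "bounded_varifold TYPE('d::finite) R M V\<^sub>0" and M: "0 \<le> M"
    and jb: "jacobian_bounds TYPE('d) TYPE('n) K a"
    and C: "C = K * (deriv_bound (M + 1))\<^sup>2 * (M + 1)"
    and N: "0 < N" "deriv_bound (M + 1) / real N \<le> a" "C / real N \<le> 1"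
  defines W_def: "W \<equiv> \<lambda>i. flow_at_node TYPE('d) \<psi> \<epsilon> V\<^sub>0 (uniform_subdivision N) i"
    and U_def: "U \<equiv> \<lambda>t. discrete_flow TYPE('d) \<psi> \<epsilon> V\<^sub>0 (uniform_subdivision N) t"
begin

private lemma C_nonneg: "0 \<le> C"
  using jb h_bound_nonneg(2)[of "M + 1"] M by (simp add: C jacobian_bounds_def)

private lemma step_small:
  assumes "0 \<le> \<tau>" "\<tau> \<le> 1 / real N"
  shows "\<tau> * deriv_bound (M + 1) \<le> a"
proof -
  have "\<tau> * deriv_bound (M + 1) \<le> (1 / real N) * deriv_bound (M + 1)"
    using assms h_bound_nonneg(2)[of "M + 1"] M by (intro mult_right_mono) auto
  then show ?thesis using N(2) by simp
qed

text \<open>\<open>C\<close> is the error in \<open>mass_euler_step\<close> at mass bound M + 1 with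
  the squared step length factored out; a shorter final step is covered too.\<close>

private lemma mass_step:
  assumes "bounded_varifold TYPE('d) R' (M + 1) V" "0 \<le> \<tau>" "\<tau> \<le> 1 / real N"
  shows "\<bar>mass (euler_step TYPE('d) \<psi> \<epsilon> \<tau> V) - mass V + \<tau> * total_dissipation V\<bar> \<le> C / (real N)\<^sup>2"
proof -
  have "\<tau>\<^sup>2 \<le> (1 / real N)\<^sup>2" using assms by (intro power_mono)
  then have "C * \<tau>\<^sup>2 \<le> C * (1 / real N)\<^sup>2" using C_nonneg by (rule mult_left_mono)
  moreover have "C * (1 / real N)\<^sup>2 = C / (real N)\<^sup>2" by (simp add: power_divide)
  moreover have "K * (\<tau> * deriv_bound (M + 1))\<^sup>2 * (M + 1) = C * \<tau>\<^sup>2" by (simp add: C power_mult_distrib)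
  moreover have "0 \<le> M + 1" using M by simp
  ultimately show ?thesis
    using mass_euler_step[OF assms(1) _ jb assms(2) step_small[OF assms(2,3)]] by linarith
qed

text \<open>The bootstrap: s is the elapsed time, i the number of steps taken. The dissipation is
  nonnegative, so a step raises the mass bound by at most C / N^2; as i < N, the accumulated excess
  is at most C / N <= 1, and the constants for mass M + 1 remain valid.\<close>

private lemma step_bounded:
  assumes V: "bounded_varifold TYPE('d) (R + s * h_bound (M + 1)) (M + real i * C / (real N)\<^sup>2) V"
    and i: "i < N" and tau: "0 \<le> \<tau>" "\<tau> \<le> 1 / real N"
  shows "bounded_varifold TYPE('d) (R + (s + \<tau>) * h_bound (M + 1)) (M + real (Suc i) * C / (real N)\<^sup>2)
     (euler_step TYPE('d) \<psi> \<epsilon> \<tau> V)" "bounded_varifold TYPE('d) (R + s * h_bound (M + 1)) (M + 1) V"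
proof -
  have "real i * C / (real N)\<^sup>2 \<le> real N * C / (real N)\<^sup>2"
    using i C_nonneg by (intro divide_right_mono mult_right_mono) auto
  also have "\<dots> \<le> 1" using N by (simp add: power2_eq_square)
  finally show V1: "bounded_varifold TYPE('d) (R + s * h_bound (M + 1)) (M + 1) V"
    by (intro bounded_varifold_mono[OF V]) auto
  have M1: "0 \<le> M + 1" using M by simp
  have "0 \<le> M + real i * C / (real N)\<^sup>2" using M C_nonneg by simp
  then have "mass V \<le> M + real i * C / (real N)\<^sup>2" by (rule bounded_varifold_mass(1)[OF V])
  moreover have "0 \<le> \<tau> * total_dissipation V" using total_dissipation_bounds(1)[OF V1 M1] tau by simp
  ultimately have "mass (euler_step TYPE('d) \<psi> \<epsilon> \<tau> V) \<le> M + real i * C / (real N)\<^sup>2 + C / (real N)\<^sup>2"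
    using mass_step[OF V1 tau] by linarith
  also have "\<dots> = M + real (Suc i) * C / (real N)\<^sup>2" by (simp add: add_divide_distrib algebra_simps)
  finally show "bounded_varifold TYPE('d) (R + (s + \<tau>) * h_bound (M + 1)) (M + real (Suc i) * C / (real N)\<^sup>2)
     (euler_step TYPE('d) \<psi> \<epsilon> \<tau> V)"
    by (intro bounded_varifold_mono[OF bounded_varifold_euler_step[OF V1 M1 jb tau(1) step_small[OF tau]]])
       (auto simp: algebra_simps)
qed

private lemma W_Suc: "i < N \<Longrightarrow> W (Suc i) = euler_step TYPE('d) \<psi> \<epsilon> (1 / real N) (W i)"
  unfolding W_def by (simp add: uniform_subdivision_nth diff_divide_distrib[symmetric])

private lemma W_bounded: "i \<le> N \<Longrightarrow>
    bounded_varifold TYPE('d) (R + real i / real N * h_bound (M + 1)) (M + real i * C / (real N)\<^sup>2) (W i)"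
proof (induction i)
  case 0
  then show ?case using V0 by (simp add: W_def)
next
  case (Suc i)
  have "bounded_varifold TYPE('d) (R + (real i / real N + 1 / real N) * h_bound (M + 1))
      (M + real (Suc i) * C / (real N)\<^sup>2) (W (Suc i))"
    using step_bounded(1)[of "real i / real N" i "W i" "1 / real N"] Suc W_Suc by simp
  then show ?case by (simp add: add_divide_distrib add.commute)
qed

lemma node_bounded_varifold:
  assumes "i < N"
  shows "bounded_varifold TYPE('d) (R + h_bound (M + 1)) (M + 1) (W i)"
proof -
  have "real i / real N * h_bound (M + 1) \<le> 1 * h_bound (M + 1)"
    using assms M h_bound_nonneg(1)[of "M + 1"] by (intro mult_right_mono) auto
  \<comment> \<open>The step length 0 is a placeholder: the second conclusion of
    \<open>step_bounded\<close> concerns the varifold before the step.\<close>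
  then show ?thesis
    by (intro bounded_varifold_mono[OF step_bounded(2)[OF W_bounded assms, of 0]]) (use assms in auto)
qed

private lemma node_step:
  assumes "0 \<le> t" "t \<le> 1"
  shows "0 \<le> t - real (node N t) / real N" "t - real (node N t) / real N \<le> 1 / real N"
  using node_bounds[OF N(1) assms] by (auto simp: add_divide_distrib)

lemma flow_step:
  assumes "0 \<le> t" "t \<le> 1"
  shows "U t = euler_step TYPE('d) \<psi> \<epsilon> (t - real (node N t) / real N) (W (node N t))"
  unfolding U_def W_def by (rule discrete_flow_node[OF N(1) assms])

lemma flow_bounded_varifold:
  assumes "0 \<le> t" "t \<le> 1"
  shows "bounded_varifold TYPE('d) (R + h_bound (M + 1)) (M + 1) (U t)"
proof -
  let ?i = "node N t"
  have i: "?i < N" using node_bounds[OF N(1) assms] by simp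
  have "bounded_varifold TYPE('d) (R + (real ?i / real N + (t - real ?i / real N)) * h_bound (M + 1))
      (M + real (Suc ?i) * C / (real N)\<^sup>2) (U t)"
    unfolding flow_step[OF assms] using i by (intro step_bounded(1) W_bounded node_step assms) auto
  moreover have "real (Suc ?i) * C / (real N)\<^sup>2 \<le> 1"
  proof -
    have "real (Suc ?i) * C / (real N)\<^sup>2 \<le> real N * C / (real N)\<^sup>2"
      using i C_nonneg by (intro divide_right_mono mult_right_mono) auto
    also have "\<dots> \<le> 1" using N by (simp add: power2_eq_square)
    finally show ?thesis .
  qed
  moreover have "t * h_bound (M + 1) \<le> 1 * h_bound (M + 1)"
    using assms M h_bound_nonneg(1)[of "M + 1"] by (intro mult_right_mono) auto
  ultimately show ?thesis by (elim bounded_varifold_mono) auto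
qed

private lemma node_mass_balance:
  "i \<le> N \<Longrightarrow> \<bar>mass (W i) - mass V\<^sub>0 + (\<Sum>k<i. total_dissipation (W k) / real N)\<bar> \<le> real i * C / (real N)\<^sup>2"
proof (induction i)
  case 0
  then show ?case by (simp add: W_def)
next
  case (Suc i)
  then have "\<bar>mass (W i) - mass V\<^sub>0 + (\<Sum>k<i. total_dissipation (W k) / real N)\<bar> \<le> real i * C / (real N)\<^sup>2" by simp
  moreover have "\<bar>mass (W (Suc i)) - mass (W i) + total_dissipation (W i) / real N\<bar> \<le> C / (real N)\<^sup>2"
    using mass_step[OF node_bounded_varifold, of i "1 / real N"] Suc.prems W_Suc by simp
  moreover have "real (Suc i) * C / (real N)\<^sup>2 = real i * C / (real N)\<^sup>2 + C / (real N)\<^sup>2"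
    by (simp add: add_divide_distrib algebra_simps)
  ultimately show ?case by simp
qed

lemma node_dissipation_bounds:
  assumes "0 \<le> t" "t \<le> 1"
  shows "0 \<le> total_dissipation (W (node N t))"
    "total_dissipation (W (node N t)) \<le>
      (B * (M + 1))\<^sup>2 / \<epsilon> * measure lborel (cball (0::real^'n) (R + h_bound (M + 1) + 1))"
  using total_dissipation_bounds[OF node_bounded_varifold[OF node_bounds(1)[OF N(1) assms]]] M by auto

lemma node_dissipation_measurable: "(\<lambda>t. total_dissipation (W (node N t))) \<in> borel_measurable borel"
  by (rule measurable_compose[OF node_measurable]) simp

text \<open>At the node i to the left of t the error is at most i * C / N^2 by telescoping; the
  last, possibly partial step adds C / N^2, and i + 1 <= N. The time integral of the step function
  is exactly the sum over full steps plus the partial one.\<close>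

lemma flow_mass_balance:
  assumes t: "0 \<le> t" "t \<le> 1"
  shows "\<bar>mass (U t) - mass V\<^sub>0 + (LBINT s:{0..t}. total_dissipation (W (node N s)))\<bar> \<le> C / real N"
proof -
  let ?d = "\<lambda>s. total_dissipation (W (node N s))" and ?i = "node N t"
  let ?I = "(\<Sum>k<?i. total_dissipation (W k) / real N) + (t - real ?i / real N) * total_dissipation (W ?i)"
  have i: "?i < N" using node_bounds[OF N(1) t] by simp
  have "(?d has_integral ?I) {0..t}"
    by (rule step_function_has_integral[OF N(1) i]) (use node_bounds[OF N(1) t] in auto)
  moreover have "set_integrable lborel {0..t} ?d"
    unfolding set_integrable_def
  proof (rule integrableI_bounded_set_indicator)
    show "AE s in lborel. s \<in> {0..t} \<longrightarrow> norm (?d s) \<le>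
        (B * (M + 1))\<^sup>2 / \<epsilon> * measure lborel (cball (0::real^'n) (R + h_bound (M + 1) + 1))"
      using node_dissipation_bounds t by (intro AE_I2) auto
  qed (use node_dissipation_measurable t in auto)
  ultimately have I: "(LBINT s:{0..t}. ?d s) = ?I"
    using set_borel_integral_eq_integral(2) integral_unique by metis
  have "\<bar>mass (U t) - mass (W ?i) + (t - real ?i / real N) * total_dissipation (W ?i)\<bar> \<le> C / (real N)\<^sup>2"
    unfolding flow_step[OF t] by (rule mass_step[OF node_bounded_varifold[OF i] node_step[OF t]])
  moreover have "\<bar>mass (W ?i) - mass V\<^sub>0 + (\<Sum>k<?i. total_dissipation (W k) / real N)\<bar> \<le> real ?i * C / (real N)\<^sup>2"
    by (rule node_mass_balance) (use i in simp)
  ultimately have "\<bar>mass (U t) - mass V\<^sub>0 + ?I\<bar> \<le> real ?i * C / (real N)\<^sup>2 + C / (real N)\<^sup>2" by linarith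
  also have "\<dots> = real (Suc ?i) * C / (real N)\<^sup>2" by (simp add: add_divide_distrib algebra_simps)
  also have "\<dots> \<le> real N * C / (real N)\<^sup>2"
    using i C_nonneg by (intro divide_right_mono mult_right_mono) auto
  also have "\<dots> = C / real N" by (simp add: power2_eq_square)
  finally show ?thesis unfolding I .
qed

end

text \<open>Dominated convergence acts in y and then in time. Both majorants know the varifolds only
  through the common R' and m, which is why the a priori bounds are uniform in t and in the
  subdivision.\<close>

lemma limit_balance:
  fixes V\<^sub>0 :: "((real^'n) \<times> (real^'n^'n)) measure"
  assumes V0: "bounded_varifold TYPE('d::finite) R M V\<^sub>0" and M: "0 \<le> M" and c3: "0 < c\<^sub>3"
    and mcf: "approx_mcf TYPE('d) \<psi> c\<^sub>3 M \<epsilon> V\<^sub>0 V"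
  shows "\<exists>R' m. 0 \<le> m \<and> (\<forall>t\<in>{0..1}. bounded_varifold TYPE('d) R' m (V t)) \<and>
    set_integrable lborel {0..1} (\<lambda>t. total_dissipation (V t)) \<and>
    (\<forall>t\<in>{0..1}. mass (V t) - mass V\<^sub>0 = - (LBINT s:{0..t}. total_dissipation (V s)))"
proof -
  obtain K a where jb: "jacobian_bounds TYPE('d) TYPE('n) K a"
    using ex_jacobian_bounds by blast
  define m where "m = M + 1"
  define R' where "R' = R + h_bound m"
  define C where "C = K * (deriv_bound m)\<^sup>2 * m"
  have m: "0 \<le> m" using M by (simp add: m_def)
  have "0 < a" using jb by (simp add: jacobian_bounds_def)
  define \<gamma> where "\<gamma> = \<epsilon>^8 / (M + 1)^3"
  have \<gamma>: "0 < \<gamma>" using eps M by (simp add: \<gamma>_def)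
  have "\<forall>\<^sub>F N in sequentially. deriv_bound m / real N < a"
    by (rule order_tendstoD(2)[OF lim_const_over_n \<open>0 < a\<close>])
  moreover have "\<forall>\<^sub>F N in sequentially. C / real N < 1"
    by (rule order_tendstoD(2)[OF lim_const_over_n]) simp
  moreover have "\<forall>\<^sub>F N in sequentially. c\<^sub>3 / real N < \<gamma>"
    by (rule order_tendstoD(2)[OF lim_const_over_n \<gamma>])
  ultimately have "\<forall>\<^sub>F N in sequentially. 0 < N \<and> deriv_bound m / real N \<le> a \<and> C / real N \<le> 1 \<and> c\<^sub>3 / real N \<le> \<gamma>"
    using eventually_gt_at_top[of 0] by eventually_elim auto
  then obtain N0 where N0: "\<And>N. N0 \<le> N \<Longrightarrow> 0 < N \<and> deriv_bound m / real N \<le> a \<and> C / real N \<le> 1 \<and> c\<^sub>3 / real N \<le> \<gamma>"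
    by (auto simp: eventually_sequentially)
  \<comment> \<open>\<open>approx_mcf\<close> demands the mesh condition for every j and not merely
    eventually, so the sequence starts at \<open>N0\<close>.\<close>
  define N where "N j = j + N0" for j
  have N: "0 < N j" "deriv_bound (M + 1) / real (N j) \<le> a" "C / real (N j) \<le> 1" "c\<^sub>3 / real (N j) \<le> \<gamma>" for j
    using N0[of "N j"] by (auto simp: N_def m_def)
  have C': "C = K * (deriv_bound (M + 1))\<^sup>2 * (M + 1)" by (simp add: C_def m_def)
  \<comment> \<open>Indexed by time here: the varifold at the node to the left of t, a node that
    moves with j.\<close>
  define W where "W j t = flow_at_node TYPE('d) \<psi> \<epsilon> V\<^sub>0 (uniform_subdivision (N j)) (node (N j) t)" for j t
  define U where "U j t = discrete_flow TYPE('d) \<psi> \<epsilon> V\<^sub>0 (uniform_subdivision (N j)) t" for j t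
  have over_N: "(\<lambda>j. c / real (N j)) \<longlonglongrightarrow> 0" for c
    unfolding N_def using LIMSEQ_ignore_initial_segment[OF lim_const_over_n[of c], of N0] by simp
  have bdU: "bounded_varifold TYPE('d) R' m (U j t)" if "t \<in> {0..1}" for j t
    unfolding U_def R'_def m_def using flow_bounded_varifold[OF V0 M jb C' N(1-3)] that by simp
  have bdW: "bounded_varifold TYPE('d) R' m (W j t)" if "t \<in> {0..1}" for j t
    unfolding W_def R'_def m_def
    by (rule node_bounded_varifold[OF V0 M jb C' N(1-3)]) (use node_bounds(1)[OF N(1)] that in auto)
  have varV: "varifold TYPE('d) (V t)" if "t \<in> {0..1}" for t
    using mcf that unfolding approx_mcf_def by blast
  have "\<forall>j. subdivision (uniform_subdivision (N j)) \<and> c\<^sub>3 * mesh (uniform_subdivision (N j)) \<le> \<epsilon>^8 / (M + 1)^3"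
    using subdivision_uniform[OF N(1)] N(4) by (simp add: \<gamma>_def)
  moreover have "(\<lambda>j. mesh (uniform_subdivision (N j))) \<longlonglongrightarrow> 0"
    using over_N[of 1] subdivision_uniform(2)[OF N(1)] by simp
  ultimately have lim: "weak_star_tendsto TYPE('d) (\<lambda>j. U j t) (V t)" if "t \<in> {0..1}" for t
    using mcf that unfolding approx_mcf_def U_def
    by (elim conjE allE[of _ "\<lambda>j. uniform_subdivision (N j)"]) blast
  have bdV: "bounded_varifold TYPE('d) R' m (V t)" if "t \<in> {0..1}" for t
    by (rule weak_star_bounded[OF bdU[OF that] m varV[OF that] lim[OF that]])

  have close: "(\<lambda>j. conv_weight \<psi> \<epsilon> (U j t) y - conv_weight \<psi> \<epsilon> (W j t) y) \<longlonglongrightarrow> 0"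
    "(\<lambda>j. conv_first_variation \<psi> \<epsilon> (U j t) y - conv_first_variation \<psi> \<epsilon> (W j t) y) \<longlonglongrightarrow> 0"
    if t: "t \<in> {0..1}" for t y
  proof -
    let ?w = "\<lambda>j. conv_weight \<psi> \<epsilon> (U j t) y - conv_weight \<psi> \<epsilon> (W j t) y"
    let ?v = "\<lambda>j. conv_first_variation \<psi> \<epsilon> (U j t) y - conv_first_variation \<psi> \<epsilon> (W j t) y"
    have "\<forall>\<^sub>F j in sequentially. norm (?w j) \<le> e \<and> norm (?v j) \<le> e" if e: "0 < e" for e
    proof -
      obtain \<delta> where \<delta>: "0 < \<delta>" and close: "\<And>V R \<tau> y. bounded_varifold TYPE('d) R m V \<Longrightarrow> 0 \<le> \<tau> \<Longrightarrow> \<tau> < \<delta> \<Longrightarrow>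
         \<bar>conv_weight \<psi> \<epsilon> (euler_step TYPE('d) \<psi> \<epsilon> \<tau> V) y - conv_weight \<psi> \<epsilon> V y\<bar> \<le> e \<and>
         norm (conv_first_variation \<psi> \<epsilon> (euler_step TYPE('d) \<psi> \<epsilon> \<tau> V) y - conv_first_variation \<psi> \<epsilon> V y) \<le> e"
        using euler_step_close[OF m jb e] by blast
      have "\<forall>\<^sub>F j in sequentially. 1 / real (N j) < \<delta>"
        by (rule order_tendstoD(2)[OF over_N \<delta>])
      then show ?thesis
      proof eventually_elim
        case (elim j)
        let ?\<tau> = "t - real (node (N j) t) / real (N j)"
        have \<tau>: "0 \<le> ?\<tau>" "?\<tau> < \<delta>"
          using node_bounds[OF N(1)[of j], of t] t elim by (auto simp: add_divide_distrib)
        have "U j t = euler_step TYPE('d) \<psi> \<epsilon> ?\<tau> (W j t)"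
          unfolding U_def W_def using t by (intro discrete_flow_node N) auto
        then show ?case using close[OF bdW[OF t] \<tau>, of j y] by simp
      qed
    qed
    note * = this
    have "\<forall>\<^sub>F j in sequentially. dist (?w j) 0 < e \<and> dist (?v j) 0 < e" if "0 < e" for e
      using *[OF half_gt_zero[OF that]] by (rule eventually_mono) (use that in auto)
    then show "?w \<longlonglongrightarrow> 0" "?v \<longlonglongrightarrow> 0"
      unfolding tendsto_iff eventually_conj_iff by blast+
  qed

  \<comment> \<open>The dissipation at y is a continuous function of the two convolutions, the
    limiting denominator being positive. The majorant is that of \<open>dissipation_le\<close> at
    the common radius.\<close>
  have diss: "(\<lambda>j. total_dissipation (W j t)) \<longlonglongrightarrow> total_dissipation (V t)" if t: "t \<in> {0..1}" for t
  proof (rule integral_dominated_convergence)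
    show "integrable lborel (\<lambda>y. (B * m)\<^sup>2 / \<epsilon> * indicator (cball (0::real^'n) (R' + 1)) y)"
      by (intro integrable_mult_right integrable_real_indicator)
         (use emeasure_bounded_finite in \<open>auto simp flip: infinity_ennreal_def\<close>)
    show "AE y in lborel. (\<lambda>j. dissipation \<psi> \<epsilon> (W j t) y) \<longlonglongrightarrow> dissipation \<psi> \<epsilon> (V t) y"
    proof (rule AE_I2)
      fix y
      have "(\<lambda>j. conv_weight \<psi> \<epsilon> (W j t) y) \<longlonglongrightarrow> conv_weight \<psi> \<epsilon> (V t) y"
        using tendsto_diff[OF weak_star_conv_weight[OF bdU[OF t] m varV[OF t] lim[OF t]] close(1)[OF t, of y], of y] by simp
      moreover have "(\<lambda>j. conv_first_variation \<psi> \<epsilon> (W j t) y) \<longlonglongrightarrow> conv_first_variation \<psi> \<epsilon> (V t) y"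
        using tendsto_diff[OF weak_star_conv_first_variation[OF bdU[OF t] m varV[OF t] lim[OF t]] close(2)[OF t, of y], of y] by simp
      ultimately show "(\<lambda>j. dissipation \<psi> \<epsilon> (W j t) y) \<longlonglongrightarrow> dissipation \<psi> \<epsilon> (V t) y"
        unfolding dissipation_def using denominator_pos[OF bdV[OF t] m, of y] by (intro tendsto_intros) auto
    qed
    show "AE y in lborel. norm (dissipation \<psi> \<epsilon> (W j t) y) \<le> (B * m)\<^sup>2 / \<epsilon> * indicator (cball 0 (R' + 1)) y" for j
      using dissipation_le[OF bdW[OF t] m] dissipation_nonneg[OF bdW[OF t] m] by (intro AE_I2) auto
  qed (use integrable_dissipation[OF bdW[OF t] m] integrable_dissipation[OF bdV[OF t] m] in auto)

  have lim_int: "set_integrable lborel {0..t} (\<lambda>s. total_dissipation (V s))"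
    "(\<lambda>j. LBINT s:{0..t}. total_dissipation (W j s)) \<longlonglongrightarrow> (LBINT s:{0..t}. total_dissipation (V s))"
    if t: "t \<in> {0..1}" for t
  proof -
    define c where "c = (B * m)\<^sup>2 / \<epsilon> * measure lborel (cball (0::real^'n) (R' + 1))"
    have w: "integrable lborel (\<lambda>s::real. c * indicator {0..t} s)"
      using t by (intro integrable_mult_right integrable_real_indicator) auto
    have meas: "(\<lambda>s. indicator {0..t} s *\<^sub>R total_dissipation (W j s)) \<in> borel_measurable lborel" for j
      using node_dissipation_measurable[OF V0 M jb C' N(1-3)[of j]] by (simp add: W_def)
    have conv: "(\<lambda>j. indicator {0..t} s *\<^sub>R total_dissipation (W j s)) \<longlonglongrightarrow> indicator {0..t} s *\<^sub>R total_dissipation (V s)" for s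
      using diss[of s] t by (auto simp: indicator_def)
    have bound: "norm (indicator {0..t} s *\<^sub>R total_dissipation (W j s)) \<le> c * indicator {0..t} s" for j s
      using total_dissipation_bounds[OF bdW m, of s j] t by (auto simp: indicator_def c_def)
    \<comment> \<open>The flow is given separately for each t, so measurability in time has to be
      produced: it is inherited from the step functions as their pointwise limit.\<close>
    have meas': "(\<lambda>s. indicator {0..t} s *\<^sub>R total_dissipation (V s)) \<in> borel_measurable lborel"
      by (rule borel_measurable_LIMSEQ_metric[OF meas conv])
    show "set_integrable lborel {0..t} (\<lambda>s. total_dissipation (V s))"
      unfolding set_integrable_def
      by (rule integrable_dominated_convergence[OF meas' meas w AE_I2[OF conv] AE_I2[OF bound]])
    show "(\<lambda>j. LBINT s:{0..t}. total_dissipation (W j s)) \<longlonglongrightarrow> (LBINT s:{0..t}. total_dissipation (V s))"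
      unfolding set_lebesgue_integral_def
      by (rule integral_dominated_convergence[OF meas' meas w AE_I2[OF conv] AE_I2[OF bound]])
  qed

  have "mass (V t) - mass V\<^sub>0 = - (LBINT s:{0..t}. total_dissipation (V s))" if t: "t \<in> {0..1}" for t
  proof -
    have "(\<lambda>j. mass (U j t) - mass V\<^sub>0 + (LBINT s:{0..t}. total_dissipation (W j s)))
        \<longlonglongrightarrow> mass (V t) - mass V\<^sub>0 + (LBINT s:{0..t}. total_dissipation (V s))"
      by (intro tendsto_intros lim_int[OF t] weak_star_mass[OF bdU[OF t] m varV[OF t] lim[OF t]])
    moreover have "(\<lambda>j. mass (U j t) - mass V\<^sub>0 + (LBINT s:{0..t}. total_dissipation (W j s))) \<longlonglongrightarrow> 0"
    proof (rule Lim_null_comparison[OF _ over_N[of C]], rule always_eventually, rule allI)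
      show "norm (mass (U j t) - mass V\<^sub>0 + (LBINT s:{0..t}. total_dissipation (W j s))) \<le> C / real (N j)" for j
        using flow_mass_balance[OF V0 M jb C' N(1-3)[of j], of t] t by (simp add: U_def W_def)
    qed
    ultimately show ?thesis using LIMSEQ_unique by fastforce
  qed
  then show ?thesis using m bdV lim_int(1)[of 1] by (intro exI[of _ R'] exI[of _ m]) simp
qed

end

theorem mainTheorem5:
  fixes \<psi> :: "real^'n \<Rightarrow> real"
    and V\<^sub>0 :: "((real^'n) \<times> (real^'n^'n)) measure"
    and V :: "real \<Rightarrow> ((real^'n) \<times> (real^'n^'n)) measure"
    and \<epsilon> M c\<^sub>3 :: real
  assumes "2 \<le> CARD('n)" and "CARD('d::finite) \<le> CARD('n)"
    and "cutoff \<psi>"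
    and "0 < c\<^sub>3"
    and "0 < \<epsilon>" and "\<epsilon> < 1"
    and "1 \<le> M"
    and "varifold TYPE('d) V\<^sub>0"
    and "compact (varifold_support TYPE('d) V\<^sub>0)"
    and "emeasure (weight V\<^sub>0) UNIV \<le> ennreal M"
    and "approx_mcf TYPE('d) \<psi> c\<^sub>3 M \<epsilon> V\<^sub>0 V"
  shows "(\<forall>t\<in>{0..1}. emeasure (weight (V t)) UNIV < \<infinity>) \<and>
    (\<forall>t\<in>{0..1}. integrable lborel (dissipation \<psi> \<epsilon> (V t))) \<and>
    set_integrable lborel {0..1} (\<lambda>t. \<integral>y. dissipation \<psi> \<epsilon> (V t) y \<partial>lborel) \<and>
    (\<forall>a b. 0 \<le> a \<and> a < b \<and> b \<le> 1 \<longrightarrow>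
       mass (V b) - mass (V a) =
         - (LBINT t:{a..b}. (\<integral>y. dissipation \<psi> \<epsilon> (V t) y \<partial>lborel)) \<and>
       - (LBINT t:{a..b}. (\<integral>y. dissipation \<psi> \<epsilon> (V t) y \<partial>lborel)) \<le> 0) \<and>
    (\<forall>t\<in>{0..1}. mass (V t) \<le> mass V\<^sub>0) \<and>
    (LBINT t:{0..1}. (\<integral>y. dissipation \<psi> \<epsilon> (V t) y \<partial>lborel)) \<le> mass V\<^sub>0"
proof -
  obtain B where "0 < B" "\<And>x. kernel \<psi> \<epsilon> x \<le> B" "\<And>x. norm (grad (kernel \<psi> \<epsilon>) x) \<le> B"
    using kernel_properties(5)[OF assms(3), of \<epsilon>] by blast
  then interpret mollifier \<psi> \<epsilon> B
    by unfold_locales (use assms in auto)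
  let ?D = "\<lambda>t. \<integral>y. dissipation \<psi> \<epsilon> (V t) y \<partial>lborel"
  have setsV0: "sets V\<^sub>0 = sets (varifold_space TYPE('d))" using assms(8) by (simp add: varifold_def)
  obtain R where "AE z in V\<^sub>0. norm (fst z) \<le> R" using compact_support_AE[OF assms(8,9)] by blast
  then have V0: "bounded_varifold TYPE('d) R M V\<^sub>0"
    using assms(10) emeasure_weight[OF setsV0] setsV0 by (simp add: bounded_varifold_def)
  obtain R' m where m: "0 \<le> m" and bdV: "\<And>t. t \<in> {0..1} \<Longrightarrow> bounded_varifold TYPE('d) R' m (V t)"
    and int: "set_integrable lborel {0..1} ?D"
    and bal: "\<And>t. t \<in> {0..1} \<Longrightarrow> mass (V t) - mass V\<^sub>0 = - (LBINT s:{0..t}. ?D s)"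
  proof -
    have "0 \<le> M" using assms(7) by simp
    from limit_balance[OF V0 this assms(4,11)] show ?thesis using that by blast
  qed
  have nonneg: "0 \<le> (LBINT t:{a..b}. ?D t)" if "0 \<le> a" "b \<le> 1" for a b
    unfolding set_lebesgue_integral_def
    by (intro Bochner_Integration.integral_nonneg)
       (use total_dissipation_bounds(1)[OF bdV m] that in \<open>auto simp: indicator_def\<close>)
  have "mass (V b) - mass (V a) = - (LBINT t:{a..b}. ?D t)" if ab: "0 \<le> a" "a < b" "b \<le> 1" for a b
  proof -
    have i: "set_integrable lborel {c..d} ?D" if "0 \<le> c" "d \<le> 1" for c d
      by (rule set_integrable_subset[OF int]) (use that in auto)
    \<comment> \<open>The balance on [a, b] is the difference of two balances from time 0; the time
      integral is split at a through the Henstock-Kurzweil integral.\<close>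
    have "(LBINT t:{0..b}. ?D t) = integral {0..b} ?D"
      using set_borel_integral_eq_integral(2)[OF i] ab by simp
    also have "\<dots> = integral {0..a} ?D + integral {a..b} ?D"
      using Henstock_Kurzweil_Integration.integral_combine[of 0 a b ?D]
        set_borel_integral_eq_integral(1)[OF i[of 0 b]] ab by simp
    also have "\<dots> = (LBINT t:{0..a}. ?D t) + (LBINT t:{a..b}. ?D t)"
      using set_borel_integral_eq_integral(2)[OF i] ab by simp
    finally show ?thesis using bal[of a] bal[of b] ab by simp
  qed
  moreover have "emeasure (weight (V t)) UNIV < \<infinity>" if "t \<in> {0..1}" for t
  proof -
    interpret finite_measure "V t" by (rule bounded_varifold_finite[OF bdV[OF that]])
    show ?thesis
      using bdV[OF that] emeasure_weight[of "V t" "TYPE('d)"]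
      by (simp add: bounded_varifold_def emeasure_eq_measure)
  qed
  \<comment> \<open>At time 1 the balance bounds the total dissipation by the initial mass because
    the final mass is nonnegative.\<close>
  moreover have "(LBINT t:{0..1}. ?D t) \<le> mass V\<^sub>0"
    using bal[of 1] bounded_varifold_mass(2)[OF bdV m, of 1] by simp
  moreover have "mass (V t) \<le> mass V\<^sub>0" if "t \<in> {0..1}" for t
    using bal[OF that] nonneg[of 0 t] that by simp
  ultimately show ?thesis
    using int nonneg integrable_dissipation[OF bdV m] by auto
qed

end
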